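(* Let $k_1,k_2,k_3\in\mathbb{Z}_{\ge0}$. For each $p/q\in\mathbb{Q}\cap[0,\infty)$ and for $p/q=1/0$, the matrix $C_{p/q}$ is a $(k_1,k_2,k_3)$-CGC matrix, and for each vertex $(\frac pq,\frac{p+r}{q+s},\frac rs)$ of the Farey tree, the triple $(C_{p/q},C_{(p+r)/(q+s)},C_{r/s})$ is a $(k_1,k_2,k_3)$-CGC triple.
   Context: Indeterminates $x_1,x_2,x_3$; $\mathbf{x}^{(v_1,v_2,v_3)}=x_1^{v_1}x_2^{v_2}x_3^{v_3}$; $\widehat{x_1}=x_2/x_3$, $\widehat{x_2}=x_3/x_1$, $\widehat{x_3}=x_1/x_2$. Cluster structure: mutations $\mu_1(a,b,c)=(\frac{b^2+k_1bc+c^2}{a},b,c)$, $\mu_2(a,b,c)=(a,\frac{a^2+k_2ac+c^2}{b},c)$, $\mu_3(a,b,c)=(a,b,\frac{a^2+k_3ab+b^2}{c})$; labeled clusters are triples obtained from $(x_1,x_2,x_3)$ by finitely many mutations, non-labeled clusters their permutations, cluster variables their entries; a cluster variable $y$ occurs in a unique position $i$ and its parity is $k_y:=k_i$. $\mathscr{M}=\frac{x_1^2+x_2^2+x_3^2+k_1x_2x_3+k_2x_1x_3+k_3x_1x_2}{x_1x_2x_3}$; $S_P=\begin{bmatrix}\mathscr{M}p_{12}-\mathrm{tr}P&0\\(\mathscr{M}p_{12}-\mathrm{tr}P)\mathscr{M}&\mathscr{M}p_{12}-\mathrm{tr}P\end{bmatrix}$. A CGC matrix is $P\in SL(2,\mathbb{Z}[x_1^{\pm1},x_2^{\pm1},x_3^{\pm1}])$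 with $(1,2)$-entry $p_{12}$ a cluster variable and $\mathrm{tr}P=\mathscr{M}p_{12}-k_{p_{12}}$; a CGC triple is a triple $(P,Q,R)$ of CGC matrices with $Q=PR-S_Q$ and $(p_{12},q_{12},r_{12})$ a non-labeled cluster. Farey tree: root $(\frac01,\frac11,\frac10)$; vertex $(\frac ab,\frac cd,\frac ef)$ has children $(\frac ab,\frac{a+c}{b+d},\frac cd)$ and $(\frac cd,\frac{c+e}{d+f},\frac ef)$. Posets: fence posets with chronological ordering $\mathcal{P}(1),\dots,\mathcal{P}(h)$ (each consecutive pair comparable, order = transitive closure), $L=\mathcal{P}(1)$, $R=\mathcal{P}(h)$; $\mathcal{P}\nearrow\mathcal{P}'$ is the concatenation with extra relation $R_{\mathcal{P}}<L_{\mathcal{P}'}$. $\mathcal{W}(\mathcal{P})=\sum_I\prod_{x\in I}\mathrm{wt}(x)$ over order ideals $I$ (including $\emptyset$); $\mathcal{W}(\mathcal{P};R)$, $\mathcal{W}(\mathcal{P};\neg R)$, $\mathcal{W}(\mathcal{P};R,\neg L)$, $\mathcal{W}(\mathcal{P};\neg R,\neg L)$ restrict to ideals containing/not containing $R$, $L$ as indicated. For coprime $p,q>0$, $\mathcal{P}_{p/q}$: let $\Lambda$ be the lattice segments $(m,n)$–$(m+1,n)$ (label $x_3$), $(m,n)$–$(m,n+1)$ (label $x_2$), $(m,n+1)$–$(m+1,n)$ (label $x_1$); $\gamma$ the segment from $(0,0)$ to $(q,p)$ traversed from $(0,0)$, crossing $\tau_1,\dots,\tau_m\in\Lambda$ (away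 from its endpoints) in this order; left/right refer to the direction of travel. For $\tau_j$ labeled $x_a$: one element of weight $\widehat{x_a}^2$ if $k_a=0$, or two consecutive elements if $k_a>0$, the first greater than the second iff $\gamma$ crosses $\tau_j$ strictly closer to its right endpoint, the smaller weighted $k_a\widehat{x_a}$, the larger $\widehat{x_a}/k_a$; between the last element of $\tau_j$'s group and the first of $\tau_{j+1}$'s group, the former is greater iff their shared endpoint lies right of $\gamma$. $H$ is the chain consisting, top to bottom and enumerated top to bottom, of the $x_3$-, then $x_1$-, then $x_2$-elements, where for each $i$ there are, if $k_i>0$, two $x_i$-elements (upper weight $\widehat{x_i}/k_i$, lower $k_i\widehat{x_i}$), and if $k_i=0$ one of weight $\widehat{x_i}^2$. $\widetilde{\mathcal{P}}_{p/q}=\mathcal{P}_{p/q}\nearrow H$ for $p/q>0$; $\widetilde{\mathcal{P}}_{0/1}$ is $H$ with its $x_3$-elements removed (still enumerated top to bottom). $\mathbf{g}_{p/q}=(q-p-1,1-q,p+1)^\top$, $\mathbf{g}^\circ_{p/q}=(q-p,-q,p)^\top$ for $p/q>0$; $\mathbf{g}_{0/1}=(0,0,1)^\top$, $\mathbf{g}^\circ_{0/1}=(1,-1,0)^\top$. For $p/q\in\mathbb{Q}\cap[0,\infty)$, $C_{p/q}=\begin{bmatrix}\mathbf{x}^{\mathbf{g}^\circ_{p/q}}\mathcal{W}(\widetilde{\mathcal{P}}_{p/q};R)&\mathbf{x}^{\mathbf{g}_{p/q}}\mathcal{W}(\widetilde{\mathcal{P}}_{p/q};\neg R)\\ \mathbf{x}^{2\mathbf{g}^\circ_{p/q}-\mathbf{g}_{p/q}}\mathcal{W}(\widetilde{\mathcal{P}}_{p/q};R,\neg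 L)&\mathbf{x}^{\mathbf{g}^\circ_{p/q}}\mathcal{W}(\widetilde{\mathcal{P}}_{p/q};\neg R,\neg L)\end{bmatrix}$, and $C_{1/0}=\begin{bmatrix}x_2\mathscr{M}&x_2\\-k_2\mathscr{M}-\frac{1}{x_2}&-k_2\end{bmatrix}$. *)

theory Defs
  imports
    "HOL-Analysis.Analysis"
    "HOL-Computational_Algebra.Computational_Algebra"
begin

type_synonym poly3 = "int poly poly poly"
type_synonym ratfun = "poly3 fract"

datatype idx = X1 | X2 | X3

fun indet :: "idx \<Rightarrow> ratfun" where
  "indet X1 = to_fract [:[:[:0, 1:]:]:]"
| "indet X2 = to_fract [:[:0, 1:]:]"
| "indet X3 = to_fract [:0, 1:]"

definition monomial :: "(idx \<Rightarrow> int) \<Rightarrow> ratfun" where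
  "monomial v = indet X1 powi v X1 * indet X2 powi v X2 * indet X3 powi v X3"

definition vec3 :: "int \<Rightarrow> int \<Rightarrow> int \<Rightarrow> idx \<Rightarrow> int" where
  "vec3 a b c i = (case i of X1 \<Rightarrow> a | X2 \<Rightarrow> b | X3 \<Rightarrow> c)"

definition laurent_ring :: "ratfun set" where
  "laurent_ring = {to_fract f * monomial v | f v. True}"

fun xhat :: "idx \<Rightarrow> ratfun" where
  "xhat X1 = indet X2 / indet X3"
| "xhat X2 = indet X3 / indet X1"
| "xhat X3 = indet X1 / indet X2"

fun mutate :: "(idx \<Rightarrow> nat) \<Rightarrow> idx \<Rightarrow> ratfun \<times> ratfun \<times> ratfun \<Rightarrow> ratfun \<times> ratfun \<times> ratfun" where
  "mutate k X1 (a, b, c) = ((b^2 + of_nat (k X1) * b * c + c^2) / a, b, c)"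
| "mutate k X2 (a, b, c) = (a, (a^2 + of_nat (k X2) * a * c + c^2) / b, c)"
| "mutate k X3 (a, b, c) = (a, b, (a^2 + of_nat (k X3) * a * b + b^2) / c)"

inductive_set labeled_clusters :: "(idx \<Rightarrow> nat) \<Rightarrow> (ratfun \<times> ratfun \<times> ratfun) set"
  for k :: "idx \<Rightarrow> nat" where
  initial: "(indet X1, indet X2, indet X3) \<in> labeled_clusters k"
| mutated: "c \<in> labeled_clusters k \<Longrightarrow> mutate k i c \<in> labeled_clusters k"

definition nonlabeled_clusters :: "(idx \<Rightarrow> nat) \<Rightarrow> (ratfun \<times> ratfun \<times> ratfun) set" where
  "nonlabeled_clusters k =
     {(a, b, c) | a b c a' b' c'. (a', b', c') \<in> labeled_clusters k \<and> {#a, b, c#} = {#a', b', c'#}}"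

fun cluster_entry :: "idx \<Rightarrow> ratfun \<times> ratfun \<times> ratfun \<Rightarrow> ratfun" where
  "cluster_entry X1 (a, b, c) = a"
| "cluster_entry X2 (a, b, c) = b"
| "cluster_entry X3 (a, b, c) = c"

definition occurs_at :: "(idx \<Rightarrow> nat) \<Rightarrow> ratfun \<Rightarrow> idx \<Rightarrow> bool" where
  "occurs_at k y i \<longleftrightarrow> (\<exists>c \<in> labeled_clusters k. cluster_entry i c = y)"

definition cluster_variable :: "(idx \<Rightarrow> nat) \<Rightarrow> ratfun \<Rightarrow> bool" where
  "cluster_variable k y \<longleftrightarrow> (\<exists>i. occurs_at k y i)"

definition parity :: "(idx \<Rightarrow> nat) \<Rightarrow> ratfun \<Rightarrow> nat" where
  "parity k y = k (THE i. occurs_at k y i)"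

definition scrM :: "(idx \<Rightarrow> nat) \<Rightarrow> ratfun" where
  "scrM k =
     (indet X1 ^ 2 + indet X2 ^ 2 + indet X3 ^ 2
        + of_nat (k X1) * indet X2 * indet X3
        + of_nat (k X2) * indet X1 * indet X3
        + of_nat (k X3) * indet X1 * indet X2)
     / (indet X1 * indet X2 * indet X3)"

definition mat2 :: "ratfun \<Rightarrow> ratfun \<Rightarrow> ratfun \<Rightarrow> ratfun \<Rightarrow> ratfun^2^2" where
  "mat2 a b c d = vector [vector [a, b], vector [c, d]]"

definition SL2_laurent :: "(ratfun^2^2) set" where
  "SL2_laurent = {P. (\<forall>i j. P $ i $ j \<in> laurent_ring) \<and> det P = 1}"

definition S_mat :: "(idx \<Rightarrow> nat) \<Rightarrow> ratfun^2^2 \<Rightarrow> ratfun^2^2" where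
  "S_mat k P =
     (let s = scrM k * P $ 1 $ 2 - trace P in mat2 s 0 (s * scrM k) s)"

definition CGC_matrix :: "(idx \<Rightarrow> nat) \<Rightarrow> ratfun^2^2 \<Rightarrow> bool" where
  "CGC_matrix k P \<longleftrightarrow>
     P \<in> SL2_laurent \<and>
     cluster_variable k (P $ 1 $ 2) \<and>
     trace P = scrM k * P $ 1 $ 2 - of_nat (parity k (P $ 1 $ 2))"

definition CGC_triple :: "(idx \<Rightarrow> nat) \<Rightarrow> ratfun^2^2 \<Rightarrow> ratfun^2^2 \<Rightarrow> ratfun^2^2 \<Rightarrow> bool" where
  "CGC_triple k P Q R \<longleftrightarrow>
     CGC_matrix k P \<and> CGC_matrix k Q \<and> CGC_matrix k R \<and>
     Q = P ** R - S_mat k Q \<and>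
     (P $ 1 $ 2, Q $ 1 $ 2, R $ 1 $ 2) \<in> nonlabeled_clusters k"

text \<open>A fraction \<open>p/q\<close> is the pair \<open>(p, q)\<close>; this accommodates \<open>1/0\<close>.\<close>

inductive_set farey_tree :: "((nat \<times> nat) \<times> (nat \<times> nat) \<times> (nat \<times> nat)) set" where
  root: "((0, 1), (1, 1), (1, 0)) \<in> farey_tree"
| left: "((a, b), (c, d), (e, f)) \<in> farey_tree \<Longrightarrow>
           ((a, b), (a + c, b + d), (c, d)) \<in> farey_tree"
| right: "((a, b), (c, d), (e, f)) \<in> farey_tree \<Longrightarrow>
           ((c, d), (c + e, d + f), (e, f)) \<in> farey_tree"

text \<open>
  \<open>Fence ws us\<close> is the fence poset whose elements, in chronological order, are the positions
  \<open>0, \<dots>, h - 1\<close>, where \<open>h = length ws\<close>; position \<open>i\<close> has weight \<open>ws ! i\<close>. The list \<open>us\<close> has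
  length \<open>h - 1\<close>, and \<open>us ! i\<close> says whether position \<open>i\<close> is less than position \<open>i + 1\<close>
  (otherwise it is greater).
\<close>

datatype fence = Fence (weights: "ratfun list") (ups: "bool list")

definition fence_elems :: "fence \<Rightarrow> nat set" where
  "fence_elems P = {..<length (weights P)}"

definition fence_covers :: "fence \<Rightarrow> (nat \<times> nat) set" where
  "fence_covers P =
     {(i, Suc i) | i. Suc i < length (weights P) \<and> ups P ! i} \<union>
     {(Suc i, i) | i. Suc i < length (weights P) \<and> \<not> ups P ! i}"

definition fence_less :: "fence \<Rightarrow> (nat \<times> nat) set" where
  "fence_less P = (fence_covers P)\<^sup>+"

definition order_ideals :: "fence \<Rightarrow> nat set set" where
  "order_ideals P =
     {I. I \<subseteq> fence_elems P \<and> (\<forall>x y. y \<in> I \<longrightarrow> (x, y) \<in> fence_less P \<longrightarrow> x \<in> I)}"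

definition fence_L :: "fence \<Rightarrow> nat" where
  "fence_L P = 0"

definition fence_R :: "fence \<Rightarrow> nat" where
  "fence_R P = length (weights P) - 1"

definition wsum :: "fence \<Rightarrow> nat set \<Rightarrow> nat set \<Rightarrow> ratfun" where
  "wsum P A B = (\<Sum>I \<in> {I \<in> order_ideals P. A \<subseteq> I \<and> B \<inter> I = {}}. \<Prod>x\<in>I. weights P ! x)"

text \<open>
  Concatenation of nonempty fences; the added relation makes the last element of the first
  fence less than the first element of the second one if \<open>u\<close>, and greater otherwise. In
  particular, \<open>\<P> \<nearrow> \<P>'\<close> is \<open>fence_concat True \<P> \<P>'\<close>.
\<close>

fun fence_concat :: "bool \<Rightarrow> fence \<Rightarrow> fence \<Rightarrow> fence" where
  "fence_concat u (Fence ws us) (Fence ws' us') = Fence (ws @ ws') (us @ [u] @ us')"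

text \<open>
  The one or two elements attached to a label \<open>x\<^sub>a\<close>; \<open>desc\<close> says whether, when there are two,
  the first is greater than the second.
\<close>

definition label_group :: "(idx \<Rightarrow> nat) \<Rightarrow> bool \<Rightarrow> idx \<Rightarrow> fence" where
  "label_group k desc a =
     (if k a = 0 then Fence [xhat a ^ 2] []
      else if desc then Fence [xhat a / of_nat (k a), of_nat (k a) * xhat a] [False]
      else Fence [of_nat (k a) * xhat a, xhat a / of_nat (k a)] [True])"

type_synonym lattice_segment = "idx \<times> int \<times> int"

fun seg_ends :: "lattice_segment \<Rightarrow> (int \<times> int) \<times> (int \<times> int)" where
  "seg_ends (X1, m, n) = ((m, n + 1), (m + 1, n))"
| "seg_ends (X2, m, n) = ((m, n), (m, n + 1))"
| "seg_ends (X3, m, n) = ((m, n), (m + 1, n))"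

definition seg_label :: "lattice_segment \<Rightarrow> idx" where
  "seg_label \<tau> = fst \<tau>"

definition end_set :: "lattice_segment \<Rightarrow> (int \<times> int) set" where
  "end_set \<tau> = {fst (seg_ends \<tau>), snd (seg_ends \<tau>)}"

definition real_pt :: "int \<times> int \<Rightarrow> real \<times> real" where
  "real_pt v = (real_of_int (fst v), real_of_int (snd v))"

definition seg_points :: "lattice_segment \<Rightarrow> (real \<times> real) set" where
  "seg_points \<tau> = closed_segment (real_pt (fst (seg_ends \<tau>))) (real_pt (snd (seg_ends \<tau>)))"

text \<open>The segment from \<open>(0, 0)\<close> to \<open>(q, p)\<close>, parametrised by \<open>t \<in> [0, 1]\<close>.\<close>

definition gam :: "nat \<Rightarrow> nat \<Rightarrow> real \<Rightarrow> real \<times> real" where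
  "gam p q t = (t * real q, t * real p)"

definition crossed :: "nat \<Rightarrow> nat \<Rightarrow> lattice_segment set" where
  "crossed p q = {\<tau>. \<exists>t. 0 < t \<and> t < 1 \<and> gam p q t \<in> seg_points \<tau>}"

text \<open>
  For coprime \<open>p, q > 0\<close> every crossing is transversal and no lattice point lies in the interior
  of the segment, so the crossing parameter is unique and distinct for distinct \<open>\<tau>\<close>.
\<close>

definition crossing_param :: "nat \<Rightarrow> nat \<Rightarrow> lattice_segment \<Rightarrow> real" where
  "crossing_param p q \<tau> = (THE t. 0 < t \<and> t < 1 \<and> gam p q t \<in> seg_points \<tau>)"

definition crossing_list :: "nat \<Rightarrow> nat \<Rightarrow> lattice_segment list" where
  "crossing_list p q = sorted_key_list_of_set (crossing_param p q) (crossed p q)"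

text \<open>\<open>v\<close> is right (left) of the direction \<open>(q, p)\<close> iff \<open>det ((q, p), v)\<close> is negative (positive).\<close>

definition right_of :: "nat \<Rightarrow> nat \<Rightarrow> int \<times> int \<Rightarrow> bool" where
  "right_of p q v \<longleftrightarrow> int q * snd v - int p * fst v < 0"

definition left_of :: "nat \<Rightarrow> nat \<Rightarrow> int \<times> int \<Rightarrow> bool" where
  "left_of p q v \<longleftrightarrow> int q * snd v - int p * fst v > 0"

definition right_end :: "nat \<Rightarrow> nat \<Rightarrow> lattice_segment \<Rightarrow> int \<times> int" where
  "right_end p q \<tau> = (THE v. v \<in> end_set \<tau> \<and> right_of p q v)"

definition left_end :: "nat \<Rightarrow> nat \<Rightarrow> lattice_segment \<Rightarrow> int \<times> int" where
  "left_end p q \<tau> = (THE v. v \<in> end_set \<tau> \<and> left_of p q v)"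

definition closer_right :: "nat \<Rightarrow> nat \<Rightarrow> lattice_segment \<Rightarrow> bool" where
  "closer_right p q \<tau> \<longleftrightarrow>
     (let z = gam p q (crossing_param p q \<tau>)
      in dist z (real_pt (right_end p q \<tau>)) < dist z (real_pt (left_end p q \<tau>)))"

text \<open>Consecutively crossed segments are two sides of a lattice triangle, so they share exactly one
  endpoint.\<close>

definition shared_end :: "lattice_segment \<Rightarrow> lattice_segment \<Rightarrow> int \<times> int" where
  "shared_end \<tau> \<tau>' = (THE v. v \<in> end_set \<tau> \<and> v \<in> end_set \<tau>')"

definition segment_group :: "(idx \<Rightarrow> nat) \<Rightarrow> nat \<Rightarrow> nat \<Rightarrow> lattice_segment \<Rightarrow> fence" where
  "segment_group k p q \<tau> = label_group k (closer_right p q \<tau>) (seg_label \<tau>)"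

fun fence_of_segments :: "(idx \<Rightarrow> nat) \<Rightarrow> nat \<Rightarrow> nat \<Rightarrow> lattice_segment list \<Rightarrow> fence" where
  "fence_of_segments k p q [] = Fence [] []"
| "fence_of_segments k p q [\<tau>] = segment_group k p q \<tau>"
| "fence_of_segments k p q (\<tau> # \<tau>' # \<tau>s) =
     fence_concat (\<not> right_of p q (shared_end \<tau> \<tau>'))
       (segment_group k p q \<tau>) (fence_of_segments k p q (\<tau>' # \<tau>s))"

definition poset_P :: "(idx \<Rightarrow> nat) \<Rightarrow> nat \<Rightarrow> nat \<Rightarrow> fence" where
  "poset_P k p q = fence_of_segments k p q (crossing_list p q)"

definition chain_X12 :: "(idx \<Rightarrow> nat) \<Rightarrow> fence" where
  "chain_X12 k = fence_concat False (label_group k True X1) (label_group k True X2)"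

definition chain_H :: "(idx \<Rightarrow> nat) \<Rightarrow> fence" where
  "chain_H k = fence_concat False (label_group k True X3) (chain_X12 k)"

definition poset_Pt :: "(idx \<Rightarrow> nat) \<Rightarrow> nat \<Rightarrow> nat \<Rightarrow> fence" where
  "poset_Pt k p q =
     (if p = 0 then chain_X12 k else fence_concat True (poset_P k p q) (chain_H k))"

definition g_vec :: "nat \<Rightarrow> nat \<Rightarrow> idx \<Rightarrow> int" where
  "g_vec p q =
     (if p = 0 then vec3 0 0 1 else vec3 (int q - int p - 1) (1 - int q) (int p + 1))"

definition g_circ :: "nat \<Rightarrow> nat \<Rightarrow> idx \<Rightarrow> int" where
  "g_circ p q =
     (if p = 0 then vec3 1 (-1) 0 else vec3 (int q - int p) (- int q) (int p))"

text \<open>For \<open>q > 0\<close> the fraction \<open>p/q\<close> is meant to be in lowest terms; in particular, \<open>p = 0\<close> only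
  occurs as \<open>0/1\<close>. The case \<open>q = 0\<close> is \<open>1/0\<close>.\<close>

definition C_mat :: "(idx \<Rightarrow> nat) \<Rightarrow> nat \<Rightarrow> nat \<Rightarrow> ratfun^2^2" where
  "C_mat k p q =
     (if q = 0 then
        mat2 (indet X2 * scrM k) (indet X2)
             (- of_nat (k X2) * scrM k - 1 / indet X2) (- of_nat (k X2))
      else
        (let P = poset_Pt k p q; L = fence_L P; R = fence_R P; g = g_vec p q; g' = g_circ p q
         in mat2 (monomial g' * wsum P {R} {}) (monomial g * wsum P {} {R})
                 (monomial (\<lambda>i. 2 * g' i - g i) * wsum P {R} {L})
                 (monomial g' * wsum P {} {R, L})))"

end

theory Submission
  imports Defs "HOL-Number_Theory.Cong"
begin

text \<open>
  Normalised to determinant one, the group of a crossed segment labelled \<open>x\<^sub>a\<close> has a transfer matrix with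
  diagonal \<open>x\<^sub>a\<close>-hat, \<open>1/x\<^sub>a\<close>-hat whose only other entry \<open>k\<^sub>a\<close> is below or above the diagonal, according to
  the side of \<open>\<gamma>\<close> on which the midpoint of the segment lies, and a turn contributes \<open>U\<close> or \<open>U\<^sup>T\<close> with
  \<open>U = [[1, 1], [0, 1]]\<close>. Up to a fixed conjugation, \<open>C\<^bsub>p/q\<^esub>\<close> is the product \<open>N\<^bsub>p/q\<^esub> K\<close> of these matrices along
  \<open>\<gamma>\<close>, followed by the matrix \<open>K\<close> of a half-turn around the end point of \<open>\<gamma>\<close>, which is the chain \<open>H\<close>.

  For Farey neighbours \<open>p/q < r/s\<close> the path through \<open>(q, p)\<close> to \<open>(q + s, p + r)\<close> crosses the same segments
  as the straight one, with the same turns. As \<open>(q, p)\<close>, \<open>(s, r)\<close> is a lattice basis, the only midpoint of a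
  crossed segment on which the two paths disagree is \<open>((q + s)/2, (p + r)/2)\<close>. The central symmetry of the straight
  path gives its matrix the form \<open>N = U Z A Z\<^sup>T\<close> with \<open>A\<close> at this midpoint, and changing the side of the midpoint
  adds \<open>k J\<close> to \<open>A\<close>, where \<open>J = [[0, -1], [1, 0]]\<close>. Since \<open>Z J Z\<^sup>T = J\<close>, this yields \<open>Q = P R - S\<^sub>Q\<close>.
  From this relation, Cayley--Hamilton and the invariance of \<open>\<M>\<close> under mutation propagate the remaining
  properties down the Farey tree. That a cluster variable has only one position follows by comparing orders of growth:
  at position \<open>i\<close> it grows like \<open>x\<^sub>i\<close> times a square.
\<close>

section \<open>Order of growth in the field of fractions\<close>

lemma to_fract_less_iff [simp]: "to_fract (a::'a::linordered_idom) < to_fract b \<longleftrightarrow> a < b"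
  by (simp add: to_fract_def)

lemma to_fract_le_iff [simp]: "to_fract (a::'a::linordered_idom) \<le> to_fract b \<longleftrightarrow> a \<le> b"
  by (simp add: to_fract_def)

lemma to_fract_pos_iff [simp]: "0 < to_fract (a::'a::linordered_idom) \<longleftrightarrow> 0 < a"
  using to_fract_less_iff[of 0 a] by (simp only: to_fract_0)

lemma of_nat_fract: "of_nat n = (to_fract (of_nat n) :: 'a::linordered_idom fract)"
  by (induction n) auto

lemma pCons_pos_iff: "0 < pCons a p \<longleftrightarrow> 0 < p \<or> p = 0 \<and> 0 < (a::'a::linordered_idom)"
  by (simp add: less_poly_def pos_poly_pCons)

lemma indet_pos [simp]: "0 < indet i"
  by (cases i) (simp_all add: pCons_pos_iff)

lemma indet_nonzero [simp]: "indet i \<noteq> 0"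
  using indet_pos[of i] by (metis less_irrefl)

text \<open>Being in the same archimedean class, that is, of equal order of growth: in the
  polynomial order \<open>x3\<close> exceeds every polynomial in \<open>x1\<close>,
  \<open>x2\<close>, and \<open>x2\<close> every polynomial in \<open>x1\<close>.\<close>

definition comparable :: "'a::linordered_field \<Rightarrow> 'a \<Rightarrow> bool" where
  "comparable a b \<longleftrightarrow> 0 < a \<and> 0 < b \<and> (\<exists>n. a \<le> of_nat n * b) \<and> (\<exists>n. b \<le> of_nat n * a)"

lemma comparable_refl: "0 < a \<Longrightarrow> comparable a a"
  unfolding comparable_def by (auto intro!: exI[of _ 1])

lemma comparable_sym: "comparable a b \<Longrightarrow> comparable b a"
  unfolding comparable_def by auto

lemma comparable_trans:
  assumes "comparable a b" "comparable b c" shows "comparable a c"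
proof -
  have *: "\<exists>n. x \<le> of_nat n * z"
    if "x \<le> of_nat n * y" "y \<le> of_nat m * z" for x y z :: 'a and n m
  proof -
    have "x \<le> of_nat n * (of_nat m * z)"
      using that by (meson mult_left_mono of_nat_0_le_iff order_trans)
    thus ?thesis by (metis mult.assoc of_nat_mult)
  qed
  show ?thesis using assms * unfolding comparable_def by meson
qed

lemma comparable_mult_right:
  assumes "comparable a b" "0 < c" shows "comparable (a * c) (b * c)"
proof -
  have "x * c \<le> of_nat n * (y * c)" if "x \<le> of_nat n * y" for x y n
    using mult_right_mono[OF that, of c] assms(2) by (simp add: mult.assoc)
  thus ?thesis using assms unfolding comparable_def by (meson mult_pos_pos)
qed

lemma comparable_inverse:
  assumes "comparable a b" shows "comparable (inverse a) (inverse b)"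
proof -
  have ab: "0 < a" "0 < b" using assms by (auto simp: comparable_def)
  have "comparable (b * (inverse a * inverse b)) (a * (inverse a * inverse b))"
    using assms ab by (intro comparable_mult_right comparable_sym[of a b]) auto
  thus ?thesis using ab by (simp add: field_simps)
qed

text \<open>All terms of a mutation numerator are nonnegative, so the square of the larger variable
  dominates: orders of growth mutate tropically.\<close>

lemma comparable_quadratic_max:
  assumes "0 < b" "0 < c"
  shows "comparable (b\<^sup>2 + of_nat m * b * c + c\<^sup>2) ((max b c)\<^sup>2)"
proof -
  define d where "d = max b c"
  have d: "0 < d" "b \<le> d" "c \<le> d" "d = b \<or> d = c" using assms by (auto simp: d_def max_def)
  have "b\<^sup>2 \<le> d\<^sup>2" "c\<^sup>2 \<le> d\<^sup>2" "b * c \<le> d\<^sup>2"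
    using d assms by (auto simp: power2_eq_square intro!: mult_mono)
  moreover from this(3) have "of_nat m * (b * c) \<le> of_nat m * d\<^sup>2"
    by (intro mult_left_mono) auto
  ultimately have "b\<^sup>2 + of_nat m * b * c + c\<^sup>2 \<le> of_nat (m + 2) * d\<^sup>2"
    by (simp add: algebra_simps)
  moreover have "d\<^sup>2 \<le> of_nat 1 * (b\<^sup>2 + of_nat m * b * c + c\<^sup>2)"
    using d(4) assms by (auto simp: add_nonneg_nonneg)
  moreover have "0 < b\<^sup>2 + of_nat m * b * c + c\<^sup>2"
    using assms by (auto simp: add_pos_nonneg add_nonneg_pos)
  ultimately show ?thesis using d(1) unfolding comparable_def d_def[symmetric] by (metis zero_less_power)
qed

text \<open>If either claim failed, \<open>of_nat n * q - p\<close> would have a negative leading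
  coefficient.\<close>

lemma poly_le_of_nat_mult:
  fixes p q :: "'a::linordered_idom poly"
  assumes "0 < p" "0 < q" "p \<le> of_nat n * q"
  shows "degree p \<le> degree q"
    and "degree p = degree q \<Longrightarrow> lead_coeff p \<le> of_nat n * lead_coeff q"
proof -
  have p: "0 < lead_coeff p" using assms(1) by (simp add: less_poly_def pos_poly_def)
  have smult: "of_nat n * q = smult (of_nat n) q" by (simp add: of_nat_poly)
  have nonneg: "0 \<le> lead_coeff r" if "p + r = of_nat n * q" for r
  proof -
    have "0 \<le> r" using assms(3) that by (metis le_add_same_cancel1)
    thus ?thesis by (auto simp: less_eq_poly_def pos_poly_def)
  qed
  obtain r where r: "p + r = of_nat n * q" by (metis add_diff_cancel_left' add.commute diff_add_cancel)
  show deg: "degree p \<le> degree q"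
  proof (rule ccontr)
    assume "\<not> degree p \<le> degree q"
    hence less: "degree (of_nat n * q) < degree p"
      unfolding smult using degree_smult_le[of "of_nat n" q] by simp
    have r': "r = of_nat n * q + - p" unfolding r[symmetric] by simp
    have "degree r = degree (- p)"
      unfolding r' by (rule degree_add_eq_right) (simp only: degree_minus less)
    moreover have "coeff r (degree p) = - lead_coeff p"
      unfolding r' coeff_add coeff_eq_0[OF less] by simp
    ultimately have "degree r = degree p" "lead_coeff r = - lead_coeff p" by simp_all
    thus False using nonneg[OF r] p by simp
  qed
  show "lead_coeff p \<le> of_nat n * lead_coeff q" if "degree p = degree q"
  proof (rule ccontr)
    let ?d = "degree q"
    assume less: "\<not> ?thesis"
    have r': "r = smult (of_nat n) q - p" unfolding smult[symmetric] r[symmetric] by simp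
    have neg: "coeff r ?d < 0" using less that unfolding r' by simp
    have "degree r \<le> ?d"
      unfolding r' by (rule degree_diff_le) (simp_all add: that degree_smult_le)
    hence "degree r = ?d" using neg by (metis coeff_eq_0 le_neq_implies_less less_irrefl)
    thus False using neg nonneg[OF r] by simp
  qed
qed

text \<open>Growth is compared one indeterminate at a time, from the outermost inwards: first
  degrees, then leading coefficients.\<close>

lemma comparable_fract_polyD:
  fixes p q :: "'a::linordered_idom poly"
  assumes "comparable (to_fract p) (to_fract q)"
  shows "degree p = degree q" "comparable (to_fract (lead_coeff p)) (to_fract (lead_coeff q))"
proof -
  have pq: "0 < p" "0 < q" using assms by (auto simp: comparable_def)
  obtain m n where "to_fract p \<le> of_nat n * to_fract q" "to_fract q \<le> of_nat m * to_fract p"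
    using assms by (auto simp: comparable_def)
  hence *: "p \<le> of_nat n * q" "q \<le> of_nat m * p"
    by (simp_all only: of_nat_fract to_fract_mult[symmetric] to_fract_le_iff)
  show deg: "degree p = degree q"
    using poly_le_of_nat_mult(1)[OF pq *(1)] poly_le_of_nat_mult(1)[OF pq(2,1) *(2)] by simp
  have "0 < lead_coeff p" "0 < lead_coeff q" using pq by (simp_all add: less_poly_def pos_poly_def)
  moreover have "lead_coeff p \<le> of_nat n * lead_coeff q" "lead_coeff q \<le> of_nat m * lead_coeff p"
    using poly_le_of_nat_mult(2)[OF pq *(1)] poly_le_of_nat_mult(2)[OF pq(2,1) *(2)] deg by simp_all
  ultimately show "comparable (to_fract (lead_coeff p)) (to_fract (lead_coeff q))"
    unfolding comparable_def
    by (metis of_nat_fract to_fract_mult to_fract_le_iff to_fract_pos_iff)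
qed

text \<open>A parity argument: a product of two distinct indeterminates has odd degree in
  \<open>x3\<close>, or else its leading coefficient has odd degree in \<open>x2\<close>; for a
  square both degrees are even.\<close>

lemma indet_mult_not_comparable_square:
  assumes "i \<noteq> j" "comparable (indet i * indet j) (s\<^sup>2)" shows False
proof -
  obtain f g where s: "s = to_fract f / to_fract g" and g: "g \<noteq> 0"
    by (metis Fract_conv_to_fract Fract_cases)
  have f: "f \<noteq> 0" using assms(2) s by (auto simp: comparable_def)
  obtain h where h: "indet i * indet j = to_fract h"
    and hodd: "odd (degree h) \<or> odd (degree (lead_coeff h))" and hnz: "h \<noteq> 0"
  proof -
    have "\<exists>h. indet i * indet j = to_fract h \<and> h \<noteq> 0 \<and> (odd (degree h) \<or> odd (degree (lead_coeff h)))"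
      using assms(1) by (cases i; cases j; simp flip: to_fract_mult)
    thus ?thesis using that by blast
  qed
  have "comparable (indet i * indet j * (to_fract g)\<^sup>2) (s\<^sup>2 * (to_fract g)\<^sup>2)"
    by (rule comparable_mult_right[OF assms(2)]) (simp add: g)
  hence "comparable (to_fract (h * g\<^sup>2)) (to_fract (f\<^sup>2))"
    using g by (simp add: s h power_divide power2_eq_square)
  from comparable_fract_polyD[OF this] have
    d: "degree (h * g\<^sup>2) = degree (f\<^sup>2)" and
    c: "comparable (to_fract (lead_coeff (h * g\<^sup>2))) (to_fract (lead_coeff (f\<^sup>2)))" by auto
  from comparable_fract_polyD(1)[OF c] have
    e: "degree (lead_coeff h * (lead_coeff g)\<^sup>2) = degree ((lead_coeff f)\<^sup>2)"
    by (simp only: lead_coeff_mult lead_coeff_power)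
  show False
    using hodd
  proof
    assume "odd (degree h)"
    thus False using arg_cong[OF d, of even] f g hnz
      by (simp add: degree_mult_eq degree_power_eq)
  next
    assume "odd (degree (lead_coeff h))"
    thus False using arg_cong[OF e, of even] f g hnz
      by (simp add: degree_mult_eq degree_power_eq)
  qed
qed

section \<open>Clusters\<close>

text \<open>Clusters as functions of the position, so that the three mutations become one
  formula.\<close>

definition cluster_triple :: "(idx \<Rightarrow> ratfun) \<Rightarrow> ratfun \<times> ratfun \<times> ratfun" where
  "cluster_triple y = (y X1, y X2, y X3)"

lemma cluster_entry_triple [simp]: "cluster_entry i (cluster_triple y) = y i"
  by (cases i) (simp_all add: cluster_triple_def)

lemma cluster_triple_entries: "cluster_triple (\<lambda>i. cluster_entry i c) = c"
  by (cases c) (simp add: cluster_triple_def)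

lemma mutate_cluster_triple:
  assumes "distinct [i, j, l]"
  shows "mutate k i (cluster_triple y) =
    cluster_triple (y(i := ((y j)\<^sup>2 + of_nat (k i) * y j * y l + (y l)\<^sup>2) / y i))"
  using assms by (cases i; cases j; cases l) (simp_all add: cluster_triple_def algebra_simps)

lemma idx_other_two: obtains j l where "distinct [i, j, l :: idx]"
  by (cases i) (auto intro: that[of X2 X3] that[of X1 X3] that[of X1 X2])

lemma labeled_clusters_induct_triple [consumes 1, case_names initial mutated]:
  assumes "cluster_triple y \<in> labeled_clusters k"
    and init: "P indet"
    and step: "\<And>y i j l. cluster_triple y \<in> labeled_clusters k \<Longrightarrow> P y \<Longrightarrow> distinct [i, j, l] \<Longrightarrow>
           P (y(i := ((y j)\<^sup>2 + of_nat (k i) * y j * y l + (y l)\<^sup>2) / y i))"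
  shows "P y"
proof -
  have "P (\<lambda>i. cluster_entry i c)" if "c \<in> labeled_clusters k" for c
    using that
  proof induction
    case initial
    have "cluster_triple indet = (indet X1, indet X2, indet X3)" by (simp add: cluster_triple_def)
    thus ?case using init by (metis cluster_entry_triple ext)
  next
    case (mutated c i)
    define z where "z = (\<lambda>i. cluster_entry i c)"
    have c: "c = cluster_triple z" by (simp add: z_def cluster_triple_entries)
    obtain j l where jl: "distinct [i, j, l]" by (rule idx_other_two)
    have "P z" using mutated.IH by (simp add: z_def)
    from step[OF _ this jl] mutated.hyps show ?case
      by (simp add: c mutate_cluster_triple[OF jl] del: fun_upd_apply)
  qed
  from this[OF assms(1)] show ?thesis by simp
qed

text \<open>If \<open>y i\<close> grows like \<open>x_i s^2\<close>, its mutation grows like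
  \<open>d^2 / (x_i s^2) = x_i (d / (x_i s))^2\<close>, where \<open>d\<close> is the larger of the
  other two variables. So the class of \<open>x_i\<close> modulo squares persists.\<close>

lemma labeled_cluster_entries:
  assumes "cluster_triple y \<in> labeled_clusters k"
  shows "\<forall>i. 0 < y i \<and> (\<exists>s>0. comparable (y i) (indet i * s\<^sup>2))"
  using assms
proof (induction rule: labeled_clusters_induct_triple)
  case initial
  show ?case using comparable_refl[OF indet_pos] by (auto intro!: exI[of _ 1])
next
  case (mutated y i j l)
  define u where "u = (y j)\<^sup>2 + of_nat (k i) * y j * y l + (y l)\<^sup>2"
  obtain s where s: "0 < s" "comparable (y i) (indet i * s\<^sup>2)" using mutated.IH by blast
  have pos: "0 < y i" "0 < y j" "0 < y l" using mutated.IH by auto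
  define d where "d = max (y j) (y l)"
  have d: "0 < d" using pos by (simp add: d_def less_max_iff_disj)
  have u: "comparable u (d\<^sup>2)"
    unfolding u_def d_def by (rule comparable_quadratic_max) (use pos in auto)
  hence "0 < u" by (simp add: comparable_def)
  hence "comparable (inverse (y i) * u) (inverse (indet i * s\<^sup>2) * u)"
    by (intro comparable_mult_right comparable_inverse s)
  hence 1: "comparable (u / y i) (u * inverse (indet i * s\<^sup>2))"
    by (simp only: divide_inverse mult.commute)
  have 2: "comparable (u * inverse (indet i * s\<^sup>2)) (d\<^sup>2 * inverse (indet i * s\<^sup>2))"
    by (intro comparable_mult_right u) (simp add: s(1) less_imp_neq[OF s(1), symmetric])
  have "comparable (u / y i) (d\<^sup>2 * inverse (indet i * s\<^sup>2))"
    by (rule comparable_trans[OF 1 2])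
  also have "d\<^sup>2 * inverse (indet i * s\<^sup>2) = indet i * (d / (indet i * s))\<^sup>2"
    using s by (simp add: field_simps power2_eq_square)
  finally have "comparable (u / y i) (indet i * (d / (indet i * s))\<^sup>2)" .
  moreover have "0 < d / (indet i * s)" using d s by simp
  ultimately have "\<exists>s>0. comparable (u / y i) (indet i * s\<^sup>2)" by blast
  moreover have "0 < u / y i" using \<open>0 < u\<close> pos by simp
  ultimately show ?case using mutated.IH unfolding u_def[symmetric] by simp
qed

lemma labeled_clusters_pos: "cluster_triple y \<in> labeled_clusters k \<Longrightarrow> 0 < y i"
  using labeled_cluster_entries by blast

text \<open>If \<open>z\<close> grew both like \<open>x_i s^2\<close> and like
  \<open>x_j t^2\<close>, then \<open>x_i x_j\<close> would grow like the square of
  \<open>x_j t / s\<close>.\<close>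

lemma occurs_at_unique:
  assumes "occurs_at k z i" "occurs_at k z j" shows "i = j"
proof (rule ccontr)
  assume "i \<noteq> j"
  have "\<exists>s>0. comparable z (indet a * s\<^sup>2)" if "occurs_at k z a" for a
    using that labeled_cluster_entries unfolding occurs_at_def
    by (metis cluster_entry_triple cluster_triple_entries)
  then obtain s t where s: "0 < s" "comparable z (indet i * s\<^sup>2)"
    and t: "0 < t" "comparable z (indet j * t\<^sup>2)" using assms by meson
  have "comparable (indet i * s\<^sup>2) (indet j * t\<^sup>2)"
    using s t by (meson comparable_sym comparable_trans)
  hence "comparable (indet i * s\<^sup>2 * (indet j / s\<^sup>2)) (indet j * t\<^sup>2 * (indet j / s\<^sup>2))"
    by (rule comparable_mult_right) (simp add: s(1) less_imp_neq[OF s(1), symmetric])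
  moreover have "indet i * s\<^sup>2 * (indet j / s\<^sup>2) = indet i * indet j"
    "indet j * t\<^sup>2 * (indet j / s\<^sup>2) = (indet j * t / s)\<^sup>2"
    using s by (simp_all add: field_simps power2_eq_square)
  ultimately show False using indet_mult_not_comparable_square[OF \<open>i \<noteq> j\<close>] by metis
qed

lemma occurs_at_cluster_triple:
  "cluster_triple y \<in> labeled_clusters k \<Longrightarrow> occurs_at k (y i) i"
  unfolding occurs_at_def by (metis cluster_entry_triple)

lemma parity_eq: "occurs_at k z i \<Longrightarrow> parity k z = k i"
  unfolding parity_def by (metis occurs_at_unique the_equality)

text \<open>Vieta jumping: the equation is quadratic in \<open>y i\<close>, and the product of its
  two roots is the mutation numerator, so mutation exchanges the roots.\<close>

lemma scrM_invariant:
  assumes "cluster_triple y \<in> labeled_clusters k" "distinct [i, j, l]"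
  shows "scrM k * y i * y j * y l = (y i)\<^sup>2 + (y j)\<^sup>2 + (y l)\<^sup>2
    + of_nat (k i) * y j * y l + of_nat (k j) * y i * y l + of_nat (k l) * y i * y j"
proof -
  define G where "G = (\<lambda>y. scrM k * y X1 * y X2 * y X3 = (y X1)\<^sup>2 + (y X2)\<^sup>2 + (y X3)\<^sup>2
    + of_nat (k X1) * y X2 * y X3 + of_nat (k X2) * y X1 * y X3 + of_nat (k X3) * y X1 * y X2)"
  have G: "G y \<longleftrightarrow> scrM k * y i * y j * y l = (y i)\<^sup>2 + (y j)\<^sup>2 + (y l)\<^sup>2
    + of_nat (k i) * y j * y l + of_nat (k j) * y i * y l + of_nat (k l) * y i * y j"
    if "distinct [i, j, l]" for y i j l
    using that by (cases i; cases j; cases l) (simp_all add: G_def algebra_simps)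
  from assms(1) have "G y"
  proof (induction rule: labeled_clusters_induct_triple)
    case initial
    show ?case by (simp add: G_def scrM_def field_simps)
  next
    case (mutated y i j l)
    define a where "a = y i"
    have a: "0 < a" using labeled_clusters_pos[OF mutated.hyps(1)] by (simp add: a_def)
    define u where "u = (y j)\<^sup>2 + of_nat (k i) * y j * y l + (y l)\<^sup>2"
    have "G y" by (rule mutated.IH)
    hence eq: "scrM k * a * y j * y l = a\<^sup>2 + u + of_nat (k j) * a * y l + of_nat (k l) * a * y j"
      unfolding G[OF mutated.hyps(2)] a_def u_def by (simp add: algebra_simps)
    \<comment> \<open>Multiplying by \<open>u\<close> and then dividing by \<open>a^2\<close> gives
      the equation for \<open>u / a\<close>.\<close>
    hence "scrM k * a * y j * y l * u =
        (a\<^sup>2 + u + of_nat (k j) * a * y l + of_nat (k l) * a * y j) * u" by simp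
    hence "scrM k * (u / a) * y j * y l = (u / a)\<^sup>2 + u + of_nat (k j) * (u / a) * y l + of_nat (k l) * (u / a) * y j"
      using a by (simp add: field_simps power2_eq_square)
    thus ?case using mutated.hyps(2)
      unfolding G[OF mutated.hyps(2)] a_def[symmetric] u_def[symmetric]
      by (auto simp: u_def algebra_simps)
  qed
  thus ?thesis using G[OF assms(2)] by simp
qed

section \<open>Matrices and the Farey recursion\<close>

lemma mat2_nth [simp]:
  "mat2 a b c d $ 1 $ 1 = a" "mat2 a b c d $ 1 $ 2 = b"
  "mat2 a b c d $ 2 $ 1 = c" "mat2 a b c d $ 2 $ 2 = d"
  by (simp_all add: mat2_def)

lemma mat2_eta: "A = mat2 (A $ 1 $ 1) (A $ 1 $ 2) (A $ 2 $ 1) (A $ 2 $ 2)"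
  by (simp add: vec_eq_iff forall_2)

lemma mat2_cases [case_names mat2]: obtains a b c d where "A = mat2 a b c d"
  using mat2_eta by blast

lemma mat2_eq_iff [simp]:
  "mat2 a b c d = mat2 a' b' c' d' \<longleftrightarrow> a = a' \<and> b = b' \<and> c = c' \<and> d = d'"
  by (simp add: vec_eq_iff forall_2)

lemma mat2_mult [simp]:
  "mat2 a b c d ** mat2 a' b' c' d' =
    mat2 (a * a' + b * c') (a * b' + b * d') (c * a' + d * c') (c * b' + d * d')"
  by (simp add: vec_eq_iff forall_2 matrix_matrix_mult_def sum_2)

lemma mat2_add [simp]: "mat2 a b c d + mat2 a' b' c' d' = mat2 (a + a') (b + b') (c + c') (d + d')"
  by (simp add: vec_eq_iff forall_2)

lemma mat2_diff [simp]: "mat2 a b c d - mat2 a' b' c' d' = mat2 (a - a') (b - b') (c - c') (d - d')"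
  by (simp add: vec_eq_iff forall_2)

lemma mat_1_mat2: "mat 1 = mat2 1 0 0 1"
  by (simp add: vec_eq_iff forall_2 mat_def)

lemma transpose_mat2 [simp]: "transpose (mat2 a b c d) = mat2 a c b d"
  by (simp add: vec_eq_iff forall_2 transpose_def)

lemma det_mat2 [simp]: "det (mat2 a b c d) = a * d - b * c"
  by (simp add: det_2)

lemma trace_mat2 [simp]: "trace (mat2 a b c d) = a + d"
  by (simp add: trace_def sum_2)

section \<open>Laurent polynomials\<close>

lemma monomial_nonzero [simp]: "monomial v \<noteq> 0"
  by (simp add: monomial_def)

lemma monomial_add: "monomial (\<lambda>i. v i + w i) = monomial v * monomial w"
  by (simp add: monomial_def power_int_add)

lemma laurent_ring_mult:
  assumes "a \<in> laurent_ring" "b \<in> laurent_ring" shows "a * b \<in> laurent_ring"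
proof -
  obtain f v g w where "a = to_fract f * monomial v" "b = to_fract g * monomial w"
    using assms by (auto simp: laurent_ring_def)
  hence "a * b = to_fract (f * g) * monomial (\<lambda>i. v i + w i)"
    by (simp add: monomial_add algebra_simps)
  thus ?thesis unfolding laurent_ring_def by blast
qed

lemma indet_to_fract: "\<exists>f. indet i = to_fract f"
  by (cases i) auto

lemma monomial_to_fract:
  assumes "\<And>i. 0 \<le> v i" shows "\<exists>f. monomial v = to_fract f"
proof -
  have "\<exists>f. indet i powi v i = to_fract f" for i
  proof -
    obtain f where f: "indet i = to_fract f" using indet_to_fract by blast
    have "to_fract f ^ n = to_fract (f ^ n)" for n by (induction n) auto
    thus ?thesis using assms[of i] f by (auto simp: power_int_def)
  qed
  thus ?thesis unfolding monomial_def by (metis to_fract_mult)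
qed

lemma laurent_ring_add:
  assumes "a \<in> laurent_ring" "b \<in> laurent_ring" shows "a + b \<in> laurent_ring"
proof -
  obtain f v g w where ab: "a = to_fract f * monomial v" "b = to_fract g * monomial w"
    using assms by (auto simp: laurent_ring_def)
  \<comment> \<open>Factoring out the componentwise minimum of the exponents leaves nonnegative
    exponents in both summands.\<close>
  define m where "m i = min (v i) (w i)" for i
  obtain v' w' where vw: "monomial (\<lambda>i. v i - m i) = to_fract v'" "monomial (\<lambda>i. w i - m i) = to_fract w'"
    using monomial_to_fract[of "\<lambda>i. v i - m i"] monomial_to_fract[of "\<lambda>i. w i - m i"] m_def by auto
  have "monomial v = to_fract v' * monomial m" "monomial w = to_fract w' * monomial m"
    using monomial_add[of "\<lambda>i. v i - m i" m] monomial_add[of "\<lambda>i. w i - m i" m] vw by simp_all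
  hence "a + b = to_fract (f * v' + g * w') * monomial m"
    by (simp add: ab algebra_simps)
  thus ?thesis unfolding laurent_ring_def by blast
qed

lemma laurent_ring_to_fract: "to_fract f \<in> laurent_ring"
proof -
  have "to_fract f = to_fract f * monomial (\<lambda>_. 0)" by (simp add: monomial_def)
  thus ?thesis unfolding laurent_ring_def by blast
qed

lemma laurent_ring_of_nat: "of_nat n \<in> laurent_ring"
  unfolding of_nat_fract by (rule laurent_ring_to_fract)

lemma laurent_ring_minus: "a \<in> laurent_ring \<Longrightarrow> - a \<in> laurent_ring"
  using laurent_ring_mult[OF laurent_ring_to_fract[of "-1"]] by fastforce

lemma laurent_ring_diff: "a \<in> laurent_ring \<Longrightarrow> b \<in> laurent_ring \<Longrightarrow> a - b \<in> laurent_ring"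
  using laurent_ring_add[OF _ laurent_ring_minus] by fastforce

lemma laurent_ring_indet: "indet i \<in> laurent_ring"
  using indet_to_fract laurent_ring_to_fract by metis

lemma laurent_ring_inverse_indet: "inverse (indet i) \<in> laurent_ring"
proof -
  have "inverse (indet i) = to_fract 1 * monomial (\<lambda>j. if j = i then -1 else 0)"
    by (cases i) (simp_all add: monomial_def power_int_minus)
  thus ?thesis unfolding laurent_ring_def by blast
qed

lemmas laurent_ring_intros = laurent_ring_add laurent_ring_mult laurent_ring_minus laurent_ring_diff
  laurent_ring_of_nat laurent_ring_indet laurent_ring_inverse_indet

lemma laurent_ring_divide_indet: "a \<in> laurent_ring \<Longrightarrow> a / indet i \<in> laurent_ring"
  unfolding divide_inverse by (intro laurent_ring_intros)

lemma laurent_ring_power: "a \<in> laurent_ring \<Longrightarrow> a ^ n \<in> laurent_ring"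
  using laurent_ring_of_nat[of 1] by (induction n) (auto intro: laurent_ring_mult)

lemma laurent_ring_scrM: "scrM k \<in> laurent_ring"
  unfolding scrM_def divide_inverse inverse_mult_distrib
  by (intro laurent_ring_intros laurent_ring_power)

definition laurent_matrix :: "ratfun^2^2 \<Rightarrow> bool" where
  "laurent_matrix A \<longleftrightarrow> (\<forall>i j. A $ i $ j \<in> laurent_ring)"

lemma laurent_matrix_mat2:
  "laurent_matrix (mat2 a b c d) \<longleftrightarrow>
    a \<in> laurent_ring \<and> b \<in> laurent_ring \<and> c \<in> laurent_ring \<and> d \<in> laurent_ring"
  by (auto simp: laurent_matrix_def forall_2)

lemma laurent_matrix_mult: "laurent_matrix A \<Longrightarrow> laurent_matrix B \<Longrightarrow> laurent_matrix (A ** B)"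
  by (cases A rule: mat2_cases; cases B rule: mat2_cases)
    (simp add: laurent_matrix_mat2 laurent_ring_add laurent_ring_mult)

text \<open>\<open>shear k c\<close> is \<open>S\<^sub>P\<close> for a matrix \<open>P\<close> with \<open>\<M> p\<^sub>1\<^sub>2 - tr P = c\<close>.\<close>

definition shear :: "(idx \<Rightarrow> nat) \<Rightarrow> ratfun \<Rightarrow> ratfun^2^2" where
  "shear k c = mat2 c 0 (c * scrM k) c"

text \<open>This is \<open>tr (S\<inverse> A)\<close> for the unipotent \<open>S = shear k 1\<close>; it equals \<open>-k\<^bsub>p\<^sub>1\<^sub>2\<^esub>\<close> on CGC matrices.\<close>

definition twisted_trace :: "(idx \<Rightarrow> nat) \<Rightarrow> ratfun^2^2 \<Rightarrow> ratfun" where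
  "twisted_trace k A = trace A - scrM k * A $ 1 $ 2"

section \<open>Determinants and twisted traces under the recursion\<close>

lemma laurent_matrix_diff_shear:
  "laurent_matrix A \<Longrightarrow> laurent_matrix (A - shear k (of_nat c))"
  by (cases A rule: mat2_cases)
    (auto simp: laurent_matrix_mat2 shear_def intro!: laurent_ring_intros laurent_ring_scrM)

text \<open>For the unipotent \<open>S = shear k 1\<close>, \<open>det (A - c S)\<close> is
  \<open>det A - c t + c^2\<close> with \<open>t\<close> the twisted trace of \<open>A\<close>, and
  the last two terms cancel for \<open>t = c\<close>.\<close>

lemma det_diff_shear:
  assumes "det A = 1" "twisted_trace k A = c" shows "det (A - shear k c) = 1"
proof (cases A rule: mat2_cases)
  case (mat2 p q r s)
  have "p * s - q * r = 1" "p + s - scrM k * q = c"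
    using assms by (simp_all add: mat2 twisted_trace_def)
  hence "(p - c) * (s - c) - q * (r - c * scrM k) = 1" by algebra
  thus ?thesis by (simp add: mat2 shear_def)
qed

lemma twisted_trace_diff_shear: "twisted_trace k (A - shear k c) = twisted_trace k A - 2 * c"
  by (cases A rule: mat2_cases) (simp add: shear_def twisted_trace_def algebra_simps)

lemma shear_12 [simp]: "shear k c $ 1 $ 2 = 0"
  by (simp add: shear_def)

text \<open>Cayley--Hamilton, \<open>P\<^sup>2 = tr(P) P - 1\<close>, turns \<open>P(PR)\<close> into a combination of \<open>PR\<close> and \<open>R\<close>.\<close>

lemma
  fixes P Q R :: "ratfun^2^2"
  assumes det: "det P = 1" and Q: "Q = P ** R - shear k c" and P: "twisted_trace k P = - d"
  shows twisted_trace_left: "twisted_trace k (P ** R) = c \<Longrightarrow> twisted_trace k (P ** Q) = - twisted_trace k R"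
    and entry_12_left: "(P ** Q) $ 1 $ 2 =
      scrM k * P $ 1 $ 2 * Q $ 1 $ 2 - d * Q $ 1 $ 2 - c * P $ 1 $ 2 - R $ 1 $ 2"
proof -
  obtain p1 p2 p3 p4 where p: "P = mat2 p1 p2 p3 p4" by (rule mat2_cases)
  obtain r1 r2 r3 r4 where r: "R = mat2 r1 r2 r3 r4" by (rule mat2_cases)
  have eqs: "p1 * p4 - p2 * p3 = 1" "p1 + p4 - scrM k * p2 = - d"
    using det P by (simp_all add: p twisted_trace_def)
  have "p1 * (p1 * r2 + p2 * r4) + p2 * (p3 * r2 + p4 * r4 - c) =
      scrM k * p2 * (p1 * r2 + p2 * r4) - d * (p1 * r2 + p2 * r4) - c * p2 - r2"
    using eqs by algebra
  thus "(P ** Q) $ 1 $ 2 =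
      scrM k * P $ 1 $ 2 * Q $ 1 $ 2 - d * Q $ 1 $ 2 - c * P $ 1 $ 2 - R $ 1 $ 2"
    by (simp add: Q p r shear_def)
  show "twisted_trace k (P ** Q) = - twisted_trace k R" if "twisted_trace k (P ** R) = c"
  proof -
    have "p1 * r1 + p2 * r3 + (p3 * r2 + p4 * r4) - scrM k * (p1 * r2 + p2 * r4) = c"
      using that by (simp add: p r twisted_trace_def)
    with eqs have "p1 * (p1 * r1 + p2 * r3 - c) + p2 * (p3 * r1 + p4 * r3 - c * scrM k)
       + (p3 * (p1 * r2 + p2 * r4) + p4 * (p3 * r2 + p4 * r4 - c))
       - scrM k * (p1 * (p1 * r2 + p2 * r4) + p2 * (p3 * r2 + p4 * r4 - c)) = - (r1 + r4 - scrM k * r2)"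
      by algebra
    thus ?thesis by (simp add: Q p r shear_def twisted_trace_def)
  qed
qed

text \<open>The mirror image of the preceding lemma, with \<open>R^2 = tr(R) R - 1\<close> applied
  to \<open>(P R) R\<close>.\<close>

lemma
  fixes P Q R :: "ratfun^2^2"
  assumes det: "det R = 1" and Q: "Q = P ** R - shear k c" and R: "twisted_trace k R = - d"
  shows twisted_trace_right: "twisted_trace k (P ** R) = c \<Longrightarrow> twisted_trace k (Q ** R) = - twisted_trace k P"
    and entry_12_right: "(Q ** R) $ 1 $ 2 =
      scrM k * R $ 1 $ 2 * Q $ 1 $ 2 - d * Q $ 1 $ 2 - c * R $ 1 $ 2 - P $ 1 $ 2"
proof -
  obtain p1 p2 p3 p4 where p: "P = mat2 p1 p2 p3 p4" by (rule mat2_cases)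
  obtain r1 r2 r3 r4 where r: "R = mat2 r1 r2 r3 r4" by (rule mat2_cases)
  have eqs: "r1 * r4 - r2 * r3 = 1" "r1 + r4 - scrM k * r2 = - d"
    using det R by (simp_all add: r twisted_trace_def)
  have "(p1 * r1 + p2 * r3 - c) * r2 + (p1 * r2 + p2 * r4) * r4 =
      scrM k * r2 * (p1 * r2 + p2 * r4) - d * (p1 * r2 + p2 * r4) - c * r2 - p2"
    using eqs by algebra
  thus "(Q ** R) $ 1 $ 2 =
      scrM k * R $ 1 $ 2 * Q $ 1 $ 2 - d * Q $ 1 $ 2 - c * R $ 1 $ 2 - P $ 1 $ 2"
    by (simp add: Q p r shear_def)
  show "twisted_trace k (Q ** R) = - twisted_trace k P" if "twisted_trace k (P ** R) = c"
  proof -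
    have "p1 * r1 + p2 * r3 + (p3 * r2 + p4 * r4) - scrM k * (p1 * r2 + p2 * r4) = c"
      using that by (simp add: p r twisted_trace_def)
    with eqs have "(p1 * r1 + p2 * r3 - c) * r1 + (p1 * r2 + p2 * r4) * r3
       + ((p3 * r1 + p4 * r3 - c * scrM k) * r2 + (p3 * r2 + p4 * r4 - c) * r4)
       - scrM k * ((p1 * r1 + p2 * r3 - c) * r2 + (p1 * r2 + p2 * r4) * r4) = - (p1 + p4 - scrM k * p2)"
      by algebra
    thus ?thesis by (simp add: Q p r shear_def twisted_trace_def)
  qed
qed

text \<open>The position of the cluster variable attached to \<open>p/q\<close>; also the label of the lattice
  segment with midpoint \<open>(q/2, p/2)\<close>.\<close>

definition lab :: "nat \<Rightarrow> nat \<Rightarrow> idx" where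
  "lab p q = (if even q then X2 else if even p then X3 else X1)"

text \<open>Carrying the position \<open>i\<close> explicitly keeps the definite description in
  \<open>parity\<close> out of the induction.\<close>

definition CGC_at :: "(idx \<Rightarrow> nat) \<Rightarrow> (idx \<Rightarrow> ratfun) \<Rightarrow> idx \<Rightarrow> ratfun^2^2 \<Rightarrow> bool" where
  "CGC_at k y i P \<longleftrightarrow> laurent_matrix P \<and> det P = 1 \<and> P $ 1 $ 2 = y i \<and>
    twisted_trace k P = - of_nat (k i)"

lemma CGC_at_imp_CGC_matrix:
  assumes "CGC_at k y i P" "cluster_triple y \<in> labeled_clusters k"
  shows "CGC_matrix k P" "S_mat k P = shear k (of_nat (k i))"
proof -
  have occ: "occurs_at k (P $ 1 $ 2) i"
    using occurs_at_cluster_triple[OF assms(2)] assms(1) by (simp add: CGC_at_def)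
  have tr: "trace P = scrM k * P $ 1 $ 2 - of_nat (k i)"
    using assms(1) by (simp add: CGC_at_def twisted_trace_def algebra_simps)
  show "CGC_matrix k P"
    using assms(1) occ tr parity_eq[OF occ]
    by (auto simp: CGC_matrix_def SL2_laurent_def CGC_at_def laurent_matrix_def cluster_variable_def)
  show "S_mat k P = shear k (of_nat (k i))"
    using tr by (simp add: S_mat_def shear_def Let_def)
qed

text \<open>The condition on \<open>P R\<close> is the trace condition on \<open>Q\<close> in the form that the induction uses.\<close>

definition CGC_triple_at ::
  "(idx \<Rightarrow> nat) \<Rightarrow> idx \<Rightarrow> idx \<Rightarrow> idx \<Rightarrow> ratfun^2^2 \<Rightarrow> ratfun^2^2 \<Rightarrow> ratfun^2^2 \<Rightarrow> bool" where
  "CGC_triple_at k i j l P Q R \<longleftrightarrow> distinct [i, j, l] \<and>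
    Q = P ** R - shear k (of_nat (k j)) \<and> twisted_trace k (P ** R) = of_nat (k j) \<and>
    (\<exists>y. cluster_triple y \<in> labeled_clusters k \<and> CGC_at k y i P \<and> CGC_at k y j Q \<and> CGC_at k y l R)"

lemma CGC_triple_at_imp_CGC_triple:
  assumes "CGC_triple_at k i j l P Q R" shows "CGC_triple k P Q R"
proof -
  obtain y where y: "cluster_triple y \<in> labeled_clusters k"
    and at: "CGC_at k y i P" "CGC_at k y j Q" "CGC_at k y l R"
    and Q: "Q = P ** R - shear k (of_nat (k j))" and ijl: "distinct [i, j, l]"
    using assms by (auto simp: CGC_triple_at_def)
  have "{#y i, y j, y l#} = {#y X1, y X2, y X3#}"
    using ijl by (cases i; cases j; cases l) (auto simp: add_mset_commute)
  moreover have "(y X1, y X2, y X3) \<in> labeled_clusters k" using y by (simp add: cluster_triple_def)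
  ultimately have "(y i, y j, y l) \<in> nonlabeled_clusters k"
    unfolding nonlabeled_clusters_def by blast
  thus ?thesis
    using CGC_at_imp_CGC_matrix[OF _ y] at Q unfolding CGC_triple_def by (simp add: CGC_at_def)
qed

text \<open>The invariant equation, as a quadratic in \<open>y l\<close>, has root sum
  \<open>M y_i y_j - k_i y_j - k_j y_i\<close>. Hence \<open>X $ 1 $ 2\<close> is the other root,
  which is the mutated variable; subtracting the shear turns the twisted trace \<open>k_l\<close>
  into \<open>-k_l\<close>.\<close>

lemma CGC_at_mutation:
  fixes X :: "ratfun^2^2"
  assumes y: "cluster_triple y \<in> labeled_clusters k" and ijl: "distinct [i, j, l]"
    and at: "CGC_at k y i A" "CGC_at k y j B"
    and tr: "twisted_trace k X = of_nat (k l)" and X: "laurent_matrix X" "det X = 1"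
    and entry: "X $ 1 $ 2 = scrM k * y i * y j - of_nat (k i) * y j - of_nat (k j) * y i - y l"
  shows "\<exists>y. cluster_triple y \<in> labeled_clusters k \<and> CGC_at k y i A \<and>
    CGC_at k y l (X - shear k (of_nat (k l))) \<and> CGC_at k y j B"
proof -
  have lij: "distinct [l, i, j]" using ijl by auto
  have pos: "0 < y l" by (rule labeled_clusters_pos[OF y])
  define z where "z = ((y i)\<^sup>2 + of_nat (k l) * y i * y j + (y j)\<^sup>2) / y l"
  have "z * y l = (y i)\<^sup>2 + of_nat (k l) * y i * y j + (y j)\<^sup>2" using pos by (simp add: z_def)
  also have "\<dots> = X $ 1 $ 2 * y l"
    using scrM_invariant[OF y ijl] by (simp add: entry algebra_simps power2_eq_square)
  finally have z: "X $ 1 $ 2 = z" using pos by simp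
  have "cluster_triple (y(l := z)) \<in> labeled_clusters k"
    unfolding z_def mutate_cluster_triple[OF lij, symmetric] by (rule labeled_clusters.mutated[OF y])
  moreover have "CGC_at k (y(l := z)) l (X - shear k (of_nat (k l)))"
    using X tr z by (simp add: CGC_at_def det_diff_shear laurent_matrix_diff_shear twisted_trace_diff_shear)
  moreover have "CGC_at k (y(l := z)) i A" "CGC_at k (y(l := z)) j B"
    using at ijl by (auto simp: CGC_at_def)
  ultimately show ?thesis by blast
qed

lemma CGC_triple_at_left:
  assumes "CGC_triple_at k i j l P Q R"
  shows "CGC_triple_at k i l j P (P ** Q - shear k (of_nat (k l))) Q"
proof -
  obtain y where y: "cluster_triple y \<in> labeled_clusters k"
    and at: "CGC_at k y i P" "CGC_at k y j Q" "CGC_at k y l R"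
    and Q: "Q = P ** R - shear k (of_nat (k j))" and ijl: "distinct [i, j, l]"
    and tr: "twisted_trace k (P ** R) = of_nat (k j)"
    using assms by (auto simp: CGC_triple_at_def)
  have P: "det P = 1" "twisted_trace k P = - of_nat (k i)" using at by (auto simp: CGC_at_def)
  have tr': "twisted_trace k (P ** Q) = of_nat (k l)"
    using twisted_trace_left[OF P(1) Q P(2) tr] at by (simp add: CGC_at_def)
  have "laurent_matrix (P ** Q)" "det (P ** Q) = 1"
    using at by (auto simp: CGC_at_def det_mul laurent_matrix_mult)
  moreover have "(P ** Q) $ 1 $ 2 = scrM k * y i * y j - of_nat (k i) * y j - of_nat (k j) * y i - y l"
    using entry_12_left[OF P(1) Q P(2)] at by (simp add: CGC_at_def)
  ultimately show ?thesis
    using CGC_at_mutation[OF y ijl at(1,2) tr'] tr' ijl by (auto simp: CGC_triple_at_def)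
qed

lemma CGC_triple_at_right:
  assumes "CGC_triple_at k i j l P Q R"
  shows "CGC_triple_at k j i l Q (Q ** R - shear k (of_nat (k i))) R"
proof -
  obtain y where y: "cluster_triple y \<in> labeled_clusters k"
    and at: "CGC_at k y i P" "CGC_at k y j Q" "CGC_at k y l R"
    and Q: "Q = P ** R - shear k (of_nat (k j))" and ijl: "distinct [i, j, l]"
    and tr: "twisted_trace k (P ** R) = of_nat (k j)"
    using assms by (auto simp: CGC_triple_at_def)
  have jli: "distinct [j, l, i]" using ijl by auto
  have R: "det R = 1" "twisted_trace k R = - of_nat (k l)" using at by (auto simp: CGC_at_def)
  have tr': "twisted_trace k (Q ** R) = of_nat (k i)"
    using twisted_trace_right[OF R(1) Q R(2) tr] at by (simp add: CGC_at_def)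
  have "laurent_matrix (Q ** R)" "det (Q ** R) = 1"
    using at by (auto simp: CGC_at_def det_mul laurent_matrix_mult)
  moreover have "(Q ** R) $ 1 $ 2 = scrM k * y j * y l - of_nat (k j) * y l - of_nat (k l) * y j - y i"
    using entry_12_right[OF R(1) Q R(2)] at by (simp add: CGC_at_def)
  ultimately show ?thesis
    using CGC_at_mutation[OF y jli at(2,3) tr'] tr' ijl by (auto simp: CGC_triple_at_def)
qed

section \<open>The Farey tree\<close>

lemma farey_tree_CGC:
  fixes C :: "nat \<Rightarrow> nat \<Rightarrow> ratfun^2^2"
  assumes root: "CGC_triple_at k X3 X1 X2 (C 0 1) (C 1 1) (C 1 0)"
    and rec: "\<And>a b e f. b * e = Suc (a * f) \<Longrightarrow>
      C (a + e) (b + f) = C a b ** C e f - shear k (of_nat (k (lab (a + e) (b + f))))"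
    and tree: "((a, b), (c, d), (e, f)) \<in> farey_tree"
  shows "c = a + e \<and> d = b + f \<and> b * e = Suc (a * f) \<and>
    CGC_triple_at k (lab a b) (lab c d) (lab e f) (C a b) (C c d) (C e f)"
  using tree
proof (induction a b c d e f rule: farey_tree.induct[split_format (complete)])
  case root
  show ?case using assms(1) by (simp add: lab_def)
next
  case (left a b c d e f)
  hence IH: "c = a + e" "d = b + f" "b * e = Suc (a * f)"
    "CGC_triple_at k (lab a b) (lab c d) (lab e f) (C a b) (C c d) (C e f)" by auto
  have bc: "b * c = Suc (a * d)" using IH by (simp add: algebra_simps)
  \<comment> \<open>The new fraction is \<open>(2 a + e) / (2 b + f)\<close>, with the parities of
    \<open>e / f\<close>.\<close>
  have l: "lab (a + c) (b + d) = lab e f" by (simp add: lab_def IH)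
  show ?case
    using CGC_triple_at_left[OF IH(4)] rec[OF bc] bc by (simp add: l)
next
  case (right a b c d e f)
  hence IH: "c = a + e" "d = b + f" "b * e = Suc (a * f)"
    "CGC_triple_at k (lab a b) (lab c d) (lab e f) (C a b) (C c d) (C e f)" by auto
  have de: "d * e = Suc (c * f)" using IH by (simp add: algebra_simps)
  have l: "lab (c + e) (d + f) = lab a b" by (auto simp: lab_def IH)
  show ?case
    using CGC_triple_at_right[OF IH(4)] rec[OF de] de by (simp add: l)
qed

text \<open>Subtractive Euclidean algorithm: if one neighbour dominates the other componentwise,
  subtracting the smaller one leads to the parent vertex and preserves the determinant.\<close>

lemma farey_tree_complete:
  assumes "b * e = Suc (a * f)"
  shows "((a, b), (a + e, b + f), (e, f)) \<in> farey_tree"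
  using assms
proof (induction "a + b + e + f" arbitrary: a b e f rule: less_induct)
  case less
  have be: "0 < b" "0 < e" using less.prems by (auto intro: gr0I)
  consider "a \<le> e \<and> b \<le> f" | "e \<le> a \<and> f \<le> b" | "a < e \<and> f < b" | "e < a \<and> b < f" by linarith
  thus ?case
  proof cases
    case 1
    then obtain e' f' where ef: "e = a + e'" "f = b + f'" by (metis le_iff_add)
    have "b * e' = Suc (a * f')" using less.prems by (simp add: ef algebra_simps)
    hence "((a, b), (a + e', b + f'), (e', f')) \<in> farey_tree"
      using be by (intro less.hyps) (auto simp: ef)
    from farey_tree.left[OF this] show ?thesis by (simp add: ef add_ac)
  next
    case 2
    then obtain a' b' where ab: "a = a' + e" "b = b' + f" by (metis le_iff_add add.commute)
    have "b' * e = Suc (a' * f)" using less.prems by (simp add: ab algebra_simps)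
    hence "((a', b'), (a' + e, b' + f), (e, f)) \<in> farey_tree"
      using be by (intro less.hyps) (auto simp: ab)
    from farey_tree.right[OF this] show ?thesis by (simp add: ab add_ac)
  next
    case 3
    \<comment> \<open>Here \<open>b e \<ge> (a + 1) (f + 1)\<close>, which exceeds
      \<open>a f + 1\<close> unless \<open>a = f = 0\<close>; only the root remains.\<close>
    then obtain x y where x: "e = Suc (a + x)" "b = Suc (f + y)" by (metis less_iff_Suc_add add_Suc_right)
    have "a = 0" "f = 0" "x = 0" "y = 0" using less.prems by (auto simp: x algebra_simps)
    thus ?thesis using farey_tree.root by (simp add: x)
  next
    case 4
    hence "b * e \<le> a * f" by (intro order_trans[OF mult_le_mono[of b f e a]]) (auto simp: mult.commute)
    thus ?thesis using less.prems by simp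
  qed
qed

lemma coprime_farey_parents:
  fixes p q :: nat
  assumes "coprime p q" "0 < p" "0 < q"
  obtains a b e f where "p = a + e" "q = b + f" "b * e = Suc (a * f)"
proof -
  \<comment> \<open>\<open>e\<close> inverts \<open>q\<close> modulo \<open>p\<close>.
    Representatives run from \<open>1\<close> to \<open>p\<close>, so that \<open>p = 1\<close>
    yields \<open>e = 1\<close> and \<open>a = p - e\<close> is a natural number.\<close>
  obtain e where e: "e \<in> {1..p}" "[q * e = 1] (mod p)"
  proof (cases "p = 1")
    case True
    thus ?thesis using that[of 1] by (simp add: cong_def)
  next
    case False
    obtain x where x: "[q * x = 1] (mod p)"
      using cong_solve_coprime_nat[of q p] assms by (auto simp: coprime_commute)
    have "x mod p \<noteq> 0"
    proof
      assume "x mod p = 0"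
      hence "p dvd q * x" by auto
      thus False using x False by (auto simp: cong_def mod_eq_0_iff_dvd[symmetric])
    qed
    moreover have "[q * (x mod p) = 1] (mod p)" using x by (simp add: cong_def mod_mult_right_eq)
    ultimately show ?thesis using that[of "x mod p"] assms(2) by (simp add: less_imp_le)
  qed
  have "1 \<le> q * e" using e assms by simp
  with e(2) have "p dvd q * e - 1" by (simp add: cong_altdef_nat)
  then obtain f where f: "q * e - 1 = p * f" by blast
  have qe: "q * e = Suc (p * f)" using f \<open>1 \<le> q * e\<close> by linarith
  have "p * f < p * q" using qe e by (metis Suc_le_eq atLeastAtMost_iff mult.commute mult_le_mono2)
  hence "f < q" by simp
  then obtain b where b: "q = b + f" by (metis add.commute less_imp_add_positive)
  obtain a where a: "p = a + e" using e by (metis atLeastAtMost_iff le_iff_add add.commute)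
  have "b * e = Suc (a * f)" using qe by (simp add: a b algebra_simps)
  thus ?thesis using that a b by blast
qed

section \<open>Transfer matrices of fence posets\<close>

text \<open>Rows and columns record whether the left and the right element belong to the ideal,
  membership first; the zero is the combination that the relation forbids.\<close>

definition turn :: "bool \<Rightarrow> ratfun^2^2" where
  "turn u = (if u then mat2 1 1 0 1 else mat2 1 0 1 1)"

definition valid_fence :: "fence \<Rightarrow> bool" where
  "valid_fence P \<longleftrightarrow> length (weights P) = Suc (length (ups P))"

text \<open>The last clause is a default value for malformed fences, which
  \<open>valid_fence\<close> excludes.\<close>

function (sequential) fence_mat :: "fence \<Rightarrow> ratfun^2^2" where
  "fence_mat (Fence [w] us) = mat2 w 0 0 1"
| "fence_mat (Fence (w # ws) (u # us)) = mat2 w 0 0 1 ** turn u ** fence_mat (Fence ws us)"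
| "fence_mat P = mat 1"
  by pat_completeness auto
termination by (relation "Wellfounded.measure (\<lambda>P. length (weights P))") auto

lemma valid_fence_concat:
  "valid_fence P \<Longrightarrow> valid_fence Q \<Longrightarrow> valid_fence (fence_concat u P Q)"
  by (cases P; cases Q) (simp add: valid_fence_def)

lemma fence_mat_concat:
  assumes "valid_fence P" "valid_fence Q"
  shows "fence_mat (fence_concat u P Q) = fence_mat P ** turn u ** fence_mat Q"
  using assms(1)
proof (induction P rule: fence_mat.induct)
  case (1 w us)
  obtain ws' us' where Q: "Q = Fence ws' us'" by (cases Q)
  have "us = []" "ws' \<noteq> []" using 1 assms(2) by (auto simp: valid_fence_def Q)
  then obtain w' ws'' where "ws' = w' # ws''" by (cases ws') auto
  thus ?case using \<open>us = []\<close> by (simp add: Q)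
next
  case (2 w v va u' us)
  obtain ws' us' where Q: "Q = Fence ws' us'" by (cases Q)
  have "valid_fence (Fence (v # va) us)" using 2 by (simp add: valid_fence_def)
  from "2.IH"[OF this] show ?case by (simp add: Q matrix_mul_assoc)
qed (auto simp: valid_fence_def)

section \<open>Order ideals and their weight sums\<close>

definition ideals_with :: "fence \<Rightarrow> bool \<Rightarrow> bool \<Rightarrow> nat set set" where
  "ideals_with P l r = {I \<in> order_ideals P. (fence_L P \<in> I) = l \<and> (fence_R P \<in> I) = r}"

definition ideal_sum :: "fence \<Rightarrow> bool \<Rightarrow> bool \<Rightarrow> ratfun" where
  "ideal_sum P l r = (\<Sum>I\<in>ideals_with P l r. \<Prod>x\<in>I. weights P ! x)"

lemma finite_order_ideals: "finite (order_ideals P)"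
  by (rule finite_subset[of _ "Pow (fence_elems P)"]) (auto simp: order_ideals_def fence_elems_def)

lemma finite_ideals_with: "finite (ideals_with P l r)"
  by (rule finite_subset[OF _ finite_order_ideals[of P]]) (auto simp: ideals_with_def)

lemma order_ideals_iff:
  "I \<in> order_ideals P \<longleftrightarrow> I \<subseteq> {..<length (weights P)} \<and>
    (\<forall>i. Suc i < length (weights P) \<longrightarrow> (if ups P ! i then Suc i \<in> I \<longrightarrow> i \<in> I else i \<in> I \<longrightarrow> Suc i \<in> I))"
proof -
  have *: "(\<forall>x y. y \<in> I \<longrightarrow> (x, y) \<in> fence_less P \<longrightarrow> x \<in> I) \<longleftrightarrow>
        (\<forall>x y. y \<in> I \<longrightarrow> (x, y) \<in> fence_covers P \<longrightarrow> x \<in> I)" (is "?A \<longleftrightarrow> ?B")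
  proof
    assume B: ?B
    have "y \<in> I \<longrightarrow> x \<in> I" if "(x, y) \<in> (fence_covers P)\<^sup>+" for x y
      using that by (induction rule: trancl_induct) (use B in blast)+
    thus ?A unfolding fence_less_def by blast
  qed (auto simp: fence_less_def)
  have "?B \<longleftrightarrow> (\<forall>i. Suc i < length (weights P) \<longrightarrow>
      (if ups P ! i then Suc i \<in> I \<longrightarrow> i \<in> I else i \<in> I \<longrightarrow> Suc i \<in> I))"
    unfolding fence_covers_def by auto
  with * show ?thesis unfolding order_ideals_def fence_elems_def by simp
qed

text \<open>Deleting position \<open>0\<close> and shifting the others down leaves an ideal of the
  shorter fence; the first relation only constrains whether this ideal contains its own position
  \<open>0\<close>.\<close>

lemma order_ideals_Cons:
  fixes l :: bool
  assumes "ws \<noteq> []"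
  shows "{I \<in> order_ideals (Fence (w # ws) (u # us)). (0 \<in> I) = l} =
    (\<lambda>I. if l then insert 0 (Suc ` I) else Suc ` I) `
      {I \<in> order_ideals (Fence ws us). if u then 0 \<in> I \<longrightarrow> l else l \<longrightarrow> 0 \<in> I}" (is "?A = ?f ` ?B")
proof (intro equalityI subsetI)
  fix I assume I: "I \<in> ?A"
  define J where "J = {x. Suc x \<in> I}"
  have fJ: "?f J = I"
  proof (intro set_eqI)
    fix x show "x \<in> ?f J \<longleftrightarrow> x \<in> I" using I by (cases x) (auto simp: J_def)
  qed
  have "J \<in> order_ideals (Fence ws us)"
    unfolding order_ideals_iff
  proof (intro conjI allI impI)
    show "J \<subseteq> {..<length (weights (Fence ws us))}" using I by (auto simp: J_def order_ideals_iff)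
    fix i assume "Suc i < length (weights (Fence ws us))"
    thus "if ups (Fence ws us) ! i then Suc i \<in> J \<longrightarrow> i \<in> J else i \<in> J \<longrightarrow> Suc i \<in> J"
      using I by (auto simp: J_def order_ideals_iff dest!: spec[of _ "Suc i"])
  qed
  moreover have "if u then 0 \<in> J \<longrightarrow> l else l \<longrightarrow> 0 \<in> J"
    using I assms by (auto simp: J_def order_ideals_iff dest!: spec[of _ 0])
  ultimately show "I \<in> ?f ` ?B" using fJ by blast
next
  fix I assume "I \<in> ?f ` ?B"
  then obtain J where J: "J \<in> order_ideals (Fence ws us)" "if u then 0 \<in> J \<longrightarrow> l else l \<longrightarrow> 0 \<in> J"
    and I: "I = ?f J" by blast
  have mem: "0 \<in> I \<longleftrightarrow> l" "Suc x \<in> I \<longleftrightarrow> x \<in> J" for x by (auto simp: I)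
  have "I \<in> order_ideals (Fence (w # ws) (u # us))"
    unfolding order_ideals_iff
  proof (intro conjI allI impI)
    show "I \<subseteq> {..<length (weights (Fence (w # ws) (u # us)))}"
      using J(1) by (auto simp: I order_ideals_iff)
    fix i assume "Suc i < length (weights (Fence (w # ws) (u # us)))"
    thus "if ups (Fence (w # ws) (u # us)) ! i then Suc i \<in> I \<longrightarrow> i \<in> I else i \<in> I \<longrightarrow> Suc i \<in> I"
      using J by (cases i) (auto simp: mem order_ideals_iff)
  qed
  thus "I \<in> ?A" using mem by simp
qed

lemma ideal_sum_Cons:
  assumes "ws \<noteq> []"
  shows "ideal_sum (Fence (w # ws) (u # us)) l r = (if l then w else 1) *
    ((if u \<longrightarrow> l then ideal_sum (Fence ws us) True r else 0) +
     (if l \<longrightarrow> u then ideal_sum (Fence ws us) False r else 0))"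
proof -
  let ?P = "Fence (w # ws) (u # us)" and ?Q = "Fence ws us"
  let ?f = "\<lambda>I. if l then insert 0 (Suc ` I) else Suc ` I"
  define B where "B b = (if (if u then b \<longrightarrow> l else l \<longrightarrow> b) then ideals_with ?Q b r else {})" for b
  have fin: "finite (B b)" for b
    by (simp add: B_def finite_ideals_with)
  have R: "fence_R ?P = Suc (fence_R ?Q)" using assms by (simp add: fence_R_def)
  have mem: "Suc x \<in> ?f I \<longleftrightarrow> x \<in> I" for x I by auto
  have "ideals_with ?P l r = {I \<in> {I \<in> order_ideals ?P. (0 \<in> I) = l}. (Suc (fence_R ?Q) \<in> I) = r}"
    by (auto simp: ideals_with_def fence_L_def R)
  also have "\<dots> = ?f ` {I \<in> {I \<in> order_ideals ?Q. if u then 0 \<in> I \<longrightarrow> l else l \<longrightarrow> 0 \<in> I}. (fence_R ?Q \<in> I) = r}"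
    unfolding order_ideals_Cons[OF assms] by (auto simp: mem)
  also have "{I \<in> {I \<in> order_ideals ?Q. if u then 0 \<in> I \<longrightarrow> l else l \<longrightarrow> 0 \<in> I}. (fence_R ?Q \<in> I) = r}
      = B True \<union> B False"
    by (auto simp: B_def ideals_with_def fence_L_def)
  finally have ideals: "ideals_with ?P l r = ?f ` (B True \<union> B False)" .
  have inj: "inj_on ?f S" for S
    by (rule inj_on_inverseI[of _ "\<lambda>I. {x. Suc x \<in> I}"]) auto
  have weight: "(\<Prod>x\<in>?f I. (w # ws) ! x) = (if l then w else 1) * (\<Prod>x\<in>I. ws ! x)"
    if "I \<in> B True \<union> B False" for I
  proof -
    have "finite I"
      using that by (auto simp: B_def ideals_with_def order_ideals_iff split: if_splits intro: finite_subset)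
    thus ?thesis by (simp add: prod.reindex)
  qed
  have "ideal_sum ?P l r = (\<Sum>I\<in>B True \<union> B False. (if l then w else 1) * (\<Prod>x\<in>I. ws ! x))"
    unfolding ideal_sum_def ideals sum.reindex[OF inj] o_def
    by (rule sum.cong) (use weight in auto)
  also have "\<dots> = (if l then w else 1) * ((\<Sum>I\<in>B True. \<Prod>x\<in>I. ws ! x) + (\<Sum>I\<in>B False. \<Prod>x\<in>I. ws ! x))"
    by (subst sum.union_disjoint[OF fin fin])
      (auto simp: B_def ideals_with_def sum_distrib_left distrib_left)
  finally show ?thesis by (cases u; cases l) (auto simp: B_def ideal_sum_def)
qed

lemma ideal_sum_single: "ideal_sum (Fence [w] []) l r = (if l \<noteq> r then 0 else if l then w else 1)"
proof -
  have "I \<in> order_ideals (Fence [w] []) \<longleftrightarrow> I = {} \<or> I = {0}" for I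
    by (auto simp: order_ideals_iff)
  hence "ideals_with (Fence [w] []) l r = (if l \<noteq> r then {} else if l then {{0}} else {{}})"
    by (auto simp: ideals_with_def fence_L_def fence_R_def)
  thus ?thesis by (simp add: ideal_sum_def)
qed

text \<open>The matrix product sums over the membership of every intermediate element, and the turns
  discard the subsets that are not ideals.\<close>

lemma fence_mat_ideal_sum:
  assumes "valid_fence P"
  shows "fence_mat P = mat2 (ideal_sum P True True) (ideal_sum P True False)
      (ideal_sum P False True) (ideal_sum P False False)"
  using assms
proof (induction P rule: fence_mat.induct)
  case (1 w us)
  hence "us = []" by (simp add: valid_fence_def)
  thus ?case by (simp add: ideal_sum_single)
next
  case (2 w v va u us)
  hence "valid_fence (Fence (v # va) us)" by (simp add: valid_fence_def)
  from "2.IH"[OF this] show ?case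
    by (simp add: turn_def ideal_sum_Cons algebra_simps)
qed (auto simp: valid_fence_def)

lemma wsum_ideal_sum:
  fixes P :: fence
  defines "L \<equiv> fence_L P" and "R \<equiv> fence_R P"
  shows "wsum P {R} {} = ideal_sum P True True + ideal_sum P False True"
    and "wsum P {} {R} = ideal_sum P True False + ideal_sum P False False"
    and "wsum P {R} {L} = ideal_sum P False True"
    and "wsum P {} {R, L} = ideal_sum P False False"
proof -
  have split: "(\<Sum>I\<in>ideals_with P True r \<union> ideals_with P False r. \<Prod>x\<in>I. weights P ! x)
      = ideal_sum P True r + ideal_sum P False r" for r
    unfolding ideal_sum_def by (rule sum.union_disjoint[OF finite_ideals_with finite_ideals_with]) (auto simp: ideals_with_def)
  have "{I \<in> order_ideals P. {R} \<subseteq> I \<and> {} \<inter> I = {}} = ideals_with P True True \<union> ideals_with P False True"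
    by (auto simp: ideals_with_def R_def)
  thus "wsum P {R} {} = ideal_sum P True True + ideal_sum P False True"
    unfolding wsum_def by (simp add: split)
  have "{I \<in> order_ideals P. {} \<subseteq> I \<and> {R} \<inter> I = {}} = ideals_with P True False \<union> ideals_with P False False"
    by (auto simp: ideals_with_def R_def)
  thus "wsum P {} {R} = ideal_sum P True False + ideal_sum P False False"
    unfolding wsum_def by (simp add: split)
  have "{I \<in> order_ideals P. {R} \<subseteq> I \<and> {L} \<inter> I = {}} = ideals_with P False True"
    "{I \<in> order_ideals P. {} \<subseteq> I \<and> {R, L} \<inter> I = {}} = ideals_with P False False"
    by (auto simp: ideals_with_def R_def L_def)
  thus "wsum P {R} {L} = ideal_sum P False True" "wsum P {} {R, L} = ideal_sum P False False"
    unfolding wsum_def by (simp_all add: ideal_sum_def)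
qed

lemma xhat_pos: "0 < xhat a"
  by (cases a) (simp_all del: indet.simps)

lemma xhat_nonzero [simp]: "xhat a \<noteq> 0"
  using xhat_pos[of a] by (metis less_irrefl)

section \<open>Matrices of determinant one for segment groups\<close>

definition crossing_mat :: "(idx \<Rightarrow> nat) \<Rightarrow> bool \<Rightarrow> idx \<Rightarrow> ratfun^2^2" where
  "crossing_mat k desc a = (if desc then mat2 (xhat a) 0 (of_nat (k a)) (1 / xhat a)
     else mat2 (xhat a) (of_nat (k a)) 0 (1 / xhat a))"

definition scale_mat :: "ratfun \<Rightarrow> ratfun^2^2 \<Rightarrow> ratfun^2^2" where
  "scale_mat c A = mat2 c 0 0 c ** A"

lemma scale_mat_mat2 [simp]: "scale_mat c (mat2 a b d e) = mat2 (c * a) (c * b) (c * d) (c * e)"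
  by (simp add: scale_mat_def)

lemma scale_mat_mult: "scale_mat c A ** B = scale_mat c (A ** B)" "A ** scale_mat c B = scale_mat c (A ** B)"
  by (cases A rule: mat2_cases; cases B rule: mat2_cases, simp add: algebra_simps)+

lemma scale_mat_scale_mat: "scale_mat c (scale_mat d A) = scale_mat (c * d) A"
  by (cases A rule: mat2_cases) (simp add: algebra_simps)

lemma scale_mat_1 [simp]: "scale_mat 1 A = A"
  by (cases A rule: mat2_cases) simp

lemma valid_label_group: "valid_fence (label_group k desc a)"
  by (simp add: valid_fence_def label_group_def)

text \<open>With \<open>x = xhat a\<close>, the weights \<open>x / k\<close> and \<open>k x\<close>
  give the diagonal \<open>x^2\<close>, \<open>1\<close> and one off-diagonal entry
  \<open>k x\<close>; dividing by \<open>x\<close> normalises the determinant. For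
  \<open>k = 0\<close> the same formula yields the single element of weight
  \<open>x^2\<close>.\<close>

lemma fence_mat_label_group:
  "fence_mat (label_group k desc a) = scale_mat (xhat a) (crossing_mat k desc a)"
  by (auto simp: label_group_def crossing_mat_def turn_def power2_eq_square)

fun mprod :: "(ratfun^2^2) list \<Rightarrow> ratfun^2^2" where
  "mprod [] = mat 1"
| "mprod (A # As) = A ** mprod As"

lemma mprod_append: "mprod (As @ Bs) = mprod As ** mprod Bs"
  by (induction As) (simp_all add: matrix_mul_assoc)

lemma mprod_det: "(\<And>A. A \<in> set As \<Longrightarrow> det A = 1) \<Longrightarrow> det (mprod As) = 1"
  by (induction As) (simp_all add: det_mul)

lemma mprod_scale: "mprod (map (\<lambda>i. scale_mat (c i) (A i)) is) =
    scale_mat (prod_list (map c is)) (mprod (map A is))"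
  by (induction "is") (simp_all add: scale_mat_mult scale_mat_scale_mat mult.commute)

lemma valid_segment_group: "valid_fence (segment_group k p q \<tau>)"
  by (simp add: segment_group_def valid_label_group)

lemma valid_fence_of_segments: "\<tau>s \<noteq> [] \<Longrightarrow> valid_fence (fence_of_segments k p q \<tau>s)"
  by (induction k p q \<tau>s rule: fence_of_segments.induct)
    (auto simp: valid_segment_group intro!: valid_fence_concat)

lemma fence_mat_fence_of_segments:
  fixes s :: "nat \<Rightarrow> lattice_segment"
  assumes "a < b"
  shows "fence_mat (fence_of_segments k p q (map s [a..<b])) = fence_mat (segment_group k p q (s a)) **
    mprod (map (\<lambda>i. turn (\<not> right_of p q (shared_end (s (i - 1)) (s i))) **
      fence_mat (segment_group k p q (s i))) [Suc a..<b])"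
  using assms
proof (induction "b - a" arbitrary: a)
  case (Suc n)
  show ?case
  proof (cases "Suc a = b")
    case True
    thus ?thesis by (simp add: upt_conv_Cons)
  next
    case False
    hence less: "Suc a < b" using Suc.prems by simp
    have "[a..<b] = a # Suc a # [Suc (Suc a)..<b]"
      using less by (metis Suc_lessD upt_conv_Cons)
    moreover have "[Suc a..<b] = Suc a # [Suc (Suc a)..<b]" using less by (simp add: upt_conv_Cons)
    moreover have "n = b - Suc a" using Suc.hyps(2) by simp
    note Suc.hyps(1)[OF this less]
    ultimately show ?thesis
      by (simp add: fence_mat_concat valid_segment_group valid_fence_of_segments matrix_mul_assoc)
  qed
qed simp

section \<open>Crossings of a segment with the lattice\<close>

text \<open>The determinant of \<open>(q, p)\<close> and \<open>v\<close>: up to a factor the signed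
  distance from the line of \<open>\<gamma>\<close>, positive on the left.\<close>

definition height :: "nat \<Rightarrow> nat \<Rightarrow> int \<times> int \<Rightarrow> int" where
  "height p q v = int q * snd v - int p * fst v"

lemma right_of_iff_height: "right_of p q v \<longleftrightarrow> height p q v < 0"
  by (simp add: right_of_def height_def)

lemma left_of_iff_height: "left_of p q v \<longleftrightarrow> height p q v > 0"
  by (simp add: left_of_def height_def)

abbreviation coord_sum :: "int \<times> int \<Rightarrow> int" where
  "coord_sum v \<equiv> fst v + snd v"

lemma height_coord_sum: "height p q v = int q * coord_sum v - int (p + q) * fst v"
  by (simp add: height_def algebra_simps)

text \<open>The point where \<open>\<gamma>\<close> crosses a segment with ends \<open>a\<close>, \<open>b\<close> on opposite sides divides it in the
  ratio of the heights of \<open>a\<close> and \<open>b\<close>.\<close>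

definition cross_weight :: "nat \<Rightarrow> nat \<Rightarrow> lattice_segment \<Rightarrow> real" where
  "cross_weight p q \<tau> = (case seg_ends \<tau> of (a, b) \<Rightarrow>
     real_of_int (height p q a) / (real_of_int (height p q a) - real_of_int (height p q b)))"

text \<open>Along \<open>\<gamma>\<close> the coordinate sum is \<open>t (p + q)\<close>, so the
  crossing parameter can be read off the coordinate sum of the crossing point.\<close>

definition cross_time :: "nat \<Rightarrow> nat \<Rightarrow> lattice_segment \<Rightarrow> real" where
  "cross_time p q \<tau> = (case seg_ends \<tau> of (a, b) \<Rightarrow>
     ((1 - cross_weight p q \<tau>) * coord_sum a + cross_weight p q \<tau> * coord_sum b) / real (p + q))"

lemma dist_convex_combination_ends:
  assumes "z = (1 - s) *\<^sub>R a + s *\<^sub>R b" "0 \<le> s" "s \<le> 1"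
  shows "dist z a = s * dist a b" "dist z b = (1 - s) * dist a (b :: 'a::real_normed_vector)"
proof -
  have "z - a = s *\<^sub>R (b - a)" "z - b = (1 - s) *\<^sub>R (a - b)"
    unfolding assms(1) by (simp_all add: algebra_simps)
  thus "dist z a = s * dist a b" "dist z b = (1 - s) * dist a b"
    using assms by (simp_all add: dist_norm norm_minus_commute)
qed

locale coprime_slope =
  fixes p q :: nat
  assumes coprime: "coprime p q" and p_pos: "0 < p" and q_pos: "0 < q"
begin

abbreviation n :: nat where "n \<equiv> p + q"

lemma cross_weight_bounds:
  assumes "seg_ends \<tau> = (a, b)" "height p q a * height p q b < 0"
  shows "0 < cross_weight p q \<tau>" "cross_weight p q \<tau> < 1"
  using assms by (auto simp: cross_weight_def mult_less_0_iff field_simps)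

lemma gam_mem_seg_points:
  assumes ends: "seg_ends \<tau> = (a, b)" and opp: "height p q a * height p q b < 0"
  shows "gam p q t \<in> seg_points \<tau> \<longleftrightarrow> t = cross_time p q \<tau>"
proof -
  define s where "s = cross_weight p q \<tau>"
  define ha hb where "ha = real_of_int (height p q a)" and "hb = real_of_int (height p q b)"
  have nz: "ha - hb \<noteq> 0" using opp by (auto simp: ha_def hb_def mult_less_0_iff)
  have s: "s = ha / (ha - hb)" by (simp add: s_def cross_weight_def ends ha_def hb_def)
  have s01: "0 \<le> s" "s \<le> 1" using cross_weight_bounds[OF ends opp] by (auto simp: s_def)
  have mem: "gam p q t \<in> seg_points \<tau> \<longleftrightarrow> (\<exists>u::real. 0 \<le> u \<and> u \<le> 1 \<and>
      t * q = (1 - u) * fst a + u * fst b \<and> t * p = (1 - u) * snd a + u * snd b)"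
    by (auto simp: seg_points_def ends closed_segment_def gam_def real_pt_def)
  have time: "cross_time p q \<tau> * n = (1 - s) * coord_sum a + s * coord_sum b"
    using p_pos by (simp add: cross_time_def ends s_def)
  have ha: "ha = real q * snd a - real p * fst a" and hb: "hb = real q * snd b - real p * fst b"
    by (simp_all add: ha_def hb_def height_def)
  show ?thesis
  proof
    assume "gam p q t \<in> seg_points \<tau>"
    then obtain u :: real where u: "t * q = (1 - u) * fst a + u * fst b" "t * p = (1 - u) * snd a + u * snd b"
      unfolding mem by blast
    \<comment> \<open>The height is linear and vanishes on \<open>\<gamma>\<close>, which determines
      \<open>u\<close>.\<close>
    have "q * (t * p) - p * (t * q) = (1 - u) * ha + u * hb"
      unfolding u ha hb by (simp add: algebra_simps)
    hence "u * (ha - hb) = ha" by (simp add: algebra_simps)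
    hence "u = s" using nz by (simp add: s field_simps)
    hence "t * n = cross_time p q \<tau> * n" using u unfolding time by (simp add: algebra_simps)
    thus "t = cross_time p q \<tau>" using p_pos by simp
  next
    assume t: "t = cross_time p q \<tau>"
    define x y where "x = (1 - s) * fst a + s * fst b" and "y = (1 - s) * snd a + s * snd b"
    have tn: "t * n = x + y" using time by (simp add: t x_def y_def algebra_simps)
    have "q * y - p * x = (1 - s) * ha + s * hb" by (simp add: x_def y_def ha hb algebra_simps)
    also have "\<dots> = 0" using nz by (simp add: s field_simps)
    finally have qy: "q * y = p * x" by simp
    have "t * q * n = (t * n) * q" "t * p * n = (t * n) * p" by (simp_all only: mult_ac)
    hence "t * q * n = x * q + q * y" "t * p * n = p * x + y * p"
      unfolding tn by (simp_all add: algebra_simps)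
    hence "t * q * n = x * q + p * x" "t * p * n = q * y + y * p"
      by (simp_all only: qy)
    hence "t * q * n = x * n" "t * p * n = y * n"
      by (simp_all add: algebra_simps)
    hence "t * q = x" "t * p = y" using p_pos by simp_all
    thus "gam p q t \<in> seg_points \<tau>" unfolding mem using s01 by (auto simp: x_def y_def)
  qed
qed

text \<open>On the line of \<open>\<gamma>\<close>, coprimality makes \<open>q\<close> divide the
  first coordinate, which lies strictly between \<open>0\<close> and \<open>q\<close>.\<close>

lemma lattice_point_on_gam:
  assumes "0 < t" "t < 1" "gam p q t = real_pt v" shows False
proof -
  have t: "t * q = fst v" "t * p = snd v" using assms(3) by (auto simp: gam_def real_pt_def)
  have "real q * snd v = real p * fst v" unfolding t[symmetric] by simp
  hence "int q * snd v = int p * fst v" by (metis of_int_eq_iff of_int_mult of_int_of_nat_eq)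
  hence "int q dvd int p * fst v" by (metis dvd_triv_left)
  hence "int q dvd fst v" using coprime by (simp add: coprime_dvd_mult_right_iff coprime_commute)
  moreover have "0 < fst v" using t(1) assms(1) q_pos by (metis mult_pos_pos of_int_0_less_iff of_nat_0_less_iff)
  moreover have "fst v < int q"
  proof -
    have "real_of_int (fst v) < real q" using assms(2) q_pos by (simp flip: t(1))
    thus ?thesis by linarith
  qed
  ultimately show False using zdvd_not_zless by blast
qed

lemma crossed_heights:
  assumes "\<tau> \<in> crossed p q" "seg_ends \<tau> = (a, b)"
  shows "height p q a * height p q b < 0"
proof -
  obtain t u :: real where t: "0 < t" "t < 1" and u: "0 \<le> u" "u \<le> 1"
    and eq: "t * q = (1 - u) * fst a + u * fst b" "t * p = (1 - u) * snd a + u * snd b"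
    using assms by (auto simp: crossed_def seg_points_def closed_segment_def gam_def real_pt_def)
  define ha hb where "ha = real_of_int (height p q a)" and "hb = real_of_int (height p q b)"
  have h: "ha = real q * snd a - real p * fst a" "hb = real q * snd b - real p * fst b"
    by (simp_all add: ha_def hb_def height_def)
  have "q * (t * p) - p * (t * q) = (1 - u) * ha + u * hb"
    unfolding eq h by (simp add: algebra_simps)
  hence 0: "(1 - u) * ha + u * hb = 0" by simp
  \<comment> \<open>No lattice segment is parallel to \<open>\<gamma>\<close>, as \<open>p\<close>
    and \<open>q\<close> are positive.\<close>
  have neq: "ha \<noteq> hb"
    using assms(2) p_pos q_pos by (cases \<tau> rule: seg_ends.cases) (auto simp: h algebra_simps)
  have "u \<noteq> 0" using lattice_point_on_gam[of t a] t eq by (auto simp: gam_def real_pt_def)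
  moreover have "u \<noteq> 1" using lattice_point_on_gam[of t b] t eq by (auto simp: gam_def real_pt_def)
  ultimately have u: "0 < u" "u < 1" using u by auto
  have "ha \<noteq> 0" using 0 u neq by auto
  have "u * (ha * hb) = - ((1 - u) * ha\<^sup>2)"
    using arg_cong[OF 0, of "\<lambda>x. ha * x"] by (simp add: algebra_simps power2_eq_square)
  also have "\<dots> < 0" using u \<open>ha \<noteq> 0\<close> by simp
  finally have "ha * hb < 0" using u by (simp add: mult_less_0_iff)
  thus ?thesis by (simp add: ha_def hb_def flip: of_int_mult)
qed

lemma crossing_param_eq:
  assumes "\<tau> \<in> crossed p q"
  shows "crossing_param p q \<tau> = cross_time p q \<tau>"
proof -
  obtain a b where ends: "seg_ends \<tau> = (a, b)" by (cases "seg_ends \<tau>")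
  note iff = gam_mem_seg_points[OF ends crossed_heights[OF assms ends]]
  have "0 < cross_time p q \<tau> \<and> cross_time p q \<tau> < 1" using assms iff by (auto simp: crossed_def)
  thus ?thesis unfolding crossing_param_def iff by (intro the_equality) auto
qed

lemma ends_right_left:
  assumes "seg_ends \<tau> = (a, b)" "height p q a * height p q b < 0"
  shows "right_end p q \<tau> = (if height p q a < 0 then a else b)"
    and "left_end p q \<tau> = (if height p q a < 0 then b else a)"
  using assms unfolding right_end_def left_end_def right_of_iff_height left_of_iff_height end_set_def
  by (auto simp: mult_less_0_iff intro!: the_equality)

text \<open>The distances to the ends are proportional to the absolute heights. The right end has
  negative height, so it is the closer one iff the sum of the heights, twice the height of the
  midpoint, is positive.\<close>

lemma closer_right_iff:
  assumes cr: "\<tau> \<in> crossed p q" and ends: "seg_ends \<tau> = (a, b)"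
  shows "closer_right p q \<tau> \<longleftrightarrow> 0 < height p q a + height p q b"
proof -
  have opp: "height p q a * height p q b < 0" by (rule crossed_heights[OF cr ends])
  define s where "s = cross_weight p q \<tau>"
  define z where "z = gam p q (crossing_param p q \<tau>)"
  have s: "0 < s" "s < 1" using cross_weight_bounds[OF ends opp] by (auto simp: s_def)
  define ha hb where "ha = real_of_int (height p q a)" and "hb = real_of_int (height p q b)"
  have seq: "s = ha / (ha - hb)" by (simp add: s_def cross_weight_def ends ha_def hb_def)
  have nz: "ha - hb \<noteq> 0" using opp by (auto simp: ha_def hb_def mult_less_0_iff)
  hence sum: "(1 - 2 * s) * (ha - hb) = - (ha + hb)" by (simp add: seq field_simps)
  have "z \<in> seg_points \<tau>" unfolding z_def
    using gam_mem_seg_points[OF ends opp] crossing_param_eq[OF cr] by simp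
  then obtain u where u: "0 \<le> u" "u \<le> 1" "z = (1 - u) *\<^sub>R real_pt a + u *\<^sub>R real_pt b"
    by (auto simp: seg_points_def ends closed_segment_def)
  have us: "u = s"
  proof -
    have "(1 - u) * ha + u * hb = q * snd z - p * fst z"
      by (simp add: u(3) ha_def hb_def height_def real_pt_def algebra_simps)
    also have "\<dots> = 0" by (simp add: z_def gam_def)
    finally have "u * (ha - hb) = ha" by (simp add: algebra_simps)
    thus ?thesis using nz by (simp add: seq field_simps)
  qed
  have "a \<noteq> b" using opp by (auto simp: mult_less_0_iff)
  hence ab: "0 < dist (real_pt a) (real_pt b)" by (auto simp: real_pt_def prod_eq_iff)
  note dists = dist_convex_combination_ends[OF u(3,1,2)]
  have ne: "real_pt a \<noteq> real_pt b" using ab by simp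
  show ?thesis
  proof (cases "height p q a < 0")
    case True
    hence hb: "0 < hb" "ha < 0" using opp by (auto simp: ha_def hb_def mult_less_0_iff)
    have "closer_right p q \<tau> \<longleftrightarrow> s < 1 - s"
      unfolding closer_right_def ends_right_left[OF ends opp] z_def[symmetric] Let_def
      using True dists us ab ne by simp
    also have "\<dots> \<longleftrightarrow> (1 - 2 * s) * (ha - hb) < 0"
      using hb by (auto simp: mult_less_0_iff)
    also have "\<dots> \<longleftrightarrow> 0 < ha + hb" unfolding sum by linarith
    finally show ?thesis by (simp add: ha_def hb_def flip: of_int_add)
  next
    case False
    hence hb: "hb < 0" "0 < ha" using opp by (auto simp: ha_def hb_def mult_less_0_iff)
    have "closer_right p q \<tau> \<longleftrightarrow> 1 - s < s"
      unfolding closer_right_def ends_right_left[OF ends opp] z_def[symmetric] Let_def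
      using False dists us ab ne by simp
    also have "\<dots> \<longleftrightarrow> (1 - 2 * s) * (ha - hb) < 0"
      using hb by (auto simp: mult_less_0_iff)
    also have "\<dots> \<longleftrightarrow> 0 < ha + hb" unfolding sum by linarith
    finally show ?thesis by (simp add: ha_def hb_def flip: of_int_add)
  qed
qed

end

text \<open>\<open>hstep p q j\<close> counts the vertical lattice lines met before the diagonal \<open>x + y = j\<close>; the shift by
  \<open>-1\<close> rounds integral values down, which makes it compatible with concatenation of segments.\<close>

definition hstep :: "nat \<Rightarrow> nat \<Rightarrow> nat \<Rightarrow> int" where
  "hstep p q j = (int j * int q - 1) div int (p + q)"

text \<open>\<open>(midX p q i, midY p q i)\<close> is twice the midpoint of the crossed segment whose midpoint
  satisfies \<open>2 (x + y) = i\<close>; the labels are recovered from the parities of its coordinates.\<close>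

definition midX :: "nat \<Rightarrow> nat \<Rightarrow> nat \<Rightarrow> int" where
  "midX p q i = hstep p q (i div 2) + hstep p q (Suc i div 2) + 1"

definition midY :: "nat \<Rightarrow> nat \<Rightarrow> nat \<Rightarrow> int" where
  "midY p q i = int i - midX p q i"

definition pt_label :: "int \<Rightarrow> int \<Rightarrow> idx" where
  "pt_label x y = (if even x then X2 else if even y then X3 else X1)"

text \<open>Halving a doubled midpoint with rounding down gives the base point \<open>(m, n)\<close>
  of the segment, whatever its label.\<close>

definition seg_at :: "nat \<Rightarrow> nat \<Rightarrow> nat \<Rightarrow> lattice_segment" where
  "seg_at p q i = (pt_label (midX p q i) (midY p q i), midX p q i div 2, midY p q i div 2)"

lemma hstep_eq_iff:
  assumes "0 < p + q"
  shows "hstep p q j = m \<longleftrightarrow> int (p + q) * m < int q * int j \<and> int q * int j \<le> int (p + q) * (m + 1)"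
proof -
  have *: "a div b = m \<longleftrightarrow> b * m \<le> a \<and> a < b * m + b" if "0 < b" for a b m :: int
  proof -
    have "a - b * (a div b) = a mod b" by (simp add: minus_mult_div_eq_mod)
    hence "b * (a div b) \<le> a" "a < b * (a div b) + b"
      using pos_mod_sign[OF that, of a] pos_mod_bound[OF that, of a] by linarith+
    moreover have "a div b = m" if ab: "b * m \<le> a" "a < b * m + b"
      by (rule int_div_pos_eq[of a b m "a - b * m"]) (use ab in auto)
    ultimately show ?thesis by blast
  qed
  have "0 < int (p + q)" using assms by (simp only: of_nat_0_less_iff)
  from *[OF this] show ?thesis unfolding hstep_def distrib_left mult_1_right
    by (auto simp only: mult.commute[of "int j"] zle_diff1_eq)
qed

lemma (in linorder) sorted_key_list_of_set_eqI:
  assumes "sorted (map f xs)" "distinct (map f xs)"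
  shows "sorted_key_list_of_set f (set xs) = xs"
proof -
  interpret folding_insort_key "(\<le>)" "(<)" "set xs" f
    by unfold_locales (use assms(2) in \<open>simp add: distinct_map\<close>)
  show ?thesis by (rule idem_if_sorted_distinct) (use assms in \<open>auto simp: distinct_map\<close>)
qed

lemma midX_double: "midX p q (2 * j) = 2 * hstep p q j + 1"
  by (simp add: midX_def)

lemma midX_Suc_double: "midX p q (Suc (2 * j)) = hstep p q j + hstep p q (Suc j) + 1"
  by (simp add: midX_def)

section \<open>Explicit enumeration of the crossed segments\<close>

context coprime_slope
begin

lemma n_pos: "0 < n"
  using p_pos by simp

definition N :: int where "N = int n"

lemma N: "N = int p + int q" "0 < int p" "0 < int q" "0 < N"
  using p_pos q_pos by (simp_all add: N_def)

lemma height_N: "height p q v = int q * coord_sum v - N * fst v"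
  by (simp only: height_coord_sum N_def)

lemma N_mult_less: "N * a < N * b \<longleftrightarrow> a < b"
  using N(4) by (rule mult_less_cancel_left_pos)

lemma hstep_eq_iff_N: "hstep p q j = m \<longleftrightarrow> N * m < int q * int j \<and> int q * int j \<le> N * (m + 1)"
  unfolding N_def by (rule hstep_eq_iff[OF n_pos])

lemma hstep_bounds: "N * hstep p q j < int q * int j" "int q * int j \<le> N * (hstep p q j + 1)"
  using hstep_eq_iff_N[of j] by auto

text \<open>Equality would make \<open>n\<close>, which is coprime to \<open>q\<close>, divide
  \<open>j\<close>.\<close>

lemma hstep_strict:
  assumes "0 < j" "j < n" shows "int q * int j < N * (hstep p q j + 1)"
proof -
  have "int q * int j \<noteq> N * (hstep p q j + 1)"
  proof
    assume "int q * int j = N * (hstep p q j + 1)"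
    hence "int n dvd int q * int j" unfolding N_def by (metis dvd_triv_left)
    moreover have "coprime n q" using coprime by (simp add: coprime_iff_gcd_eq_1)
    hence "coprime (int n) (int q)" by (simp only: coprime_int_iff)
    ultimately have "int n dvd int j" by (simp only: coprime_dvd_mult_right_iff)
    thus False using assms by (auto dest: zdvd_imp_le)
  qed
  thus ?thesis using hstep_bounds(2)[of j] by simp
qed

lemma hstep_Suc: "hstep p q (Suc j) = hstep p q j \<or> hstep p q (Suc j) = hstep p q j + 1"
proof -
  have "N * hstep p q j < N * (hstep p q (Suc j) + 1)"
    using hstep_bounds(1)[of j] hstep_bounds(2)[of "Suc j"] N by (simp add: algebra_simps)
  moreover have "N * hstep p q (Suc j) < N * (hstep p q j + 2)"
    using hstep_bounds(2)[of j] hstep_bounds(1)[of "Suc j"] N by (simp add: algebra_simps)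
  ultimately have "hstep p q j < hstep p q (Suc j) + 1" "hstep p q (Suc j) < hstep p q j + 2"
    by (simp_all only: N_mult_less)
  thus ?thesis by linarith
qed

lemma seg_at_double: "seg_at p q (2 * j) = (X1, hstep p q j, int j - 1 - hstep p q j)"
proof -
  have "midY p q (2 * j) = 2 * (int j - 1 - hstep p q j) + 1" by (simp add: midY_def midX_double)
  thus ?thesis by (simp add: seg_at_def midX_double pt_label_def)
qed

lemma seg_at_Suc_double:
  "seg_at p q (Suc (2 * j)) =
    (if hstep p q (Suc j) = hstep p q j then (X3, hstep p q j, int j - hstep p q j)
     else (X2, hstep p q (Suc j), int j - hstep p q (Suc j)))"
proof (cases "hstep p q (Suc j) = hstep p q j")
  case True
  hence "midX p q (Suc (2 * j)) = 2 * hstep p q j + 1" "midY p q (Suc (2 * j)) = 2 * (int j - hstep p q j)"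
    by (simp_all add: midY_def midX_Suc_double)
  thus ?thesis using True by (simp add: seg_at_def pt_label_def)
next
  case False
  hence "hstep p q j = hstep p q (Suc j) - 1" using hstep_Suc[of j] by auto
  hence "midX p q (Suc (2 * j)) = 2 * hstep p q (Suc j)"
      "midY p q (Suc (2 * j)) = 2 * (int j - hstep p q (Suc j)) + 1"
    by (simp_all add: midY_def midX_Suc_double)
  thus ?thesis using False by (simp add: seg_at_def pt_label_def)
qed

text \<open>Index \<open>2 j\<close> is the antidiagonal \<open>x + y = j\<close>; index
  \<open>2 j + 1\<close> is the horizontal or vertical segment between this antidiagonal and the
  next.\<close>

lemma crossing_index_cases:
  assumes "i \<in> {2..<2 * n - 1}"
  obtains (even) j where "i = 2 * j" "0 < j" "j < n"
    | (odd) j where "i = Suc (2 * j)" "0 < j" "Suc j < n"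
proof (cases "even i")
  case True
  then obtain j where "i = 2 * j" by (elim evenE)
  thus ?thesis using assms even by auto
next
  case False
  then obtain j where "i = Suc (2 * j)" by (elim oddE) auto
  thus ?thesis using assms odd by auto
qed

lemma seg_at_ends:
  assumes "i \<in> {2..<2 * n - 1}" "seg_ends (seg_at p q i) = (a, b)"
  shows "height p q a * height p q b < 0"
    and "fst a + fst b = midX p q i" "snd a + snd b = midY p q i"
    and "coord_sum a = int (i div 2)" "coord_sum b = int (Suc i div 2)"
proof -
  have "height p q a * height p q b < 0 \<and> fst a + fst b = midX p q i \<and> snd a + snd b = midY p q i \<and>
    coord_sum a = int (i div 2) \<and> coord_sum b = int (Suc i div 2)"
    using assms(1)
  proof (cases rule: crossing_index_cases)
    case (even j)
    define m where "m = hstep p q j"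
    have m: "N * m < int q * int j" "int q * int j < N * (m + 1)"
      using hstep_bounds[of j] hstep_strict[OF even(2,3)] by (auto simp: m_def)
    have ab: "a = (m, int j - m)" "b = (m + 1, int j - 1 - m)"
      using assms(2) by (auto simp: even(1) seg_at_double m_def)
    show ?thesis using m by (simp add: ab even(1) midX_double midY_def height_N m_def mult_less_0_iff)
  next
    case (odd j)
    define m where "m = hstep p q (Suc j)"
    have bounds: "N * hstep p q j < int q * int j" "int q * int j < N * (hstep p q j + 1)"
      "N * m < int q * (int j + 1)" "int q * (int j + 1) < N * (m + 1)"
      using hstep_bounds[of j] hstep_strict[of j] hstep_bounds[of "Suc j"] hstep_strict[of "Suc j"] odd
      by (auto simp: m_def algebra_simps)
    show ?thesis
    proof (cases "m = hstep p q j")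
      case True
      have ab: "a = (m, int j - m)" "b = (m + 1, int j - m)"
        using assms(2) True by (auto simp: odd(1) seg_at_Suc_double m_def)
      have "height p q a = int q * int j - N * m" "height p q b = int q * (int j + 1) - N * (m + 1)"
        by (simp_all add: height_N ab)
      moreover have "N * m < int q * int j" using bounds(1) True by simp
      ultimately have "height p q a * height p q b < 0" using bounds(4) by (simp add: mult_less_0_iff)
      thus ?thesis using True
        by (simp add: ab odd(1) midX_Suc_double midY_def m_def[symmetric])
    next
      case False
      hence h: "hstep p q j = m - 1" using hstep_Suc[of j] by (auto simp: m_def)
      have ab: "a = (m, int j - m)" "b = (m, int j - m + 1)"
        using assms(2) False by (auto simp: odd(1) seg_at_Suc_double m_def)
      have "height p q a = int q * int j - N * m" "height p q b = int q * (int j + 1) - N * m"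
        by (simp_all add: height_N ab)
      moreover have "int q * int j < N * m" using bounds(2) h by simp
      ultimately have "height p q a * height p q b < 0" using bounds(3) by (simp add: mult_less_0_iff)
      thus ?thesis
        by (simp add: ab odd(1) midX_Suc_double midY_def h m_def[symmetric])
    qed
  qed
  thus "height p q a * height p q b < 0"
    and "fst a + fst b = midX p q i" "snd a + snd b = midY p q i"
    and "coord_sum a = int (i div 2)" "coord_sum b = int (Suc i div 2)" by blast+
qed

text \<open>\<open>t n\<close> is the coordinate sum of the crossing point: an integer on
  antidiagonals, strictly between consecutive integers otherwise. This orders the crossings.\<close>

lemma cross_time_seg_at:
  fixes t :: real
  assumes "i \<in> {2..<2 * n - 1}"
  defines "t \<equiv> cross_time p q (seg_at p q i)"
  shows "even i \<Longrightarrow> t * n = real i / 2" "(real i - 1) / 2 < t * n" "t * n < (real i + 1) / 2"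
proof -
  obtain a b where ends: "seg_ends (seg_at p q i) = (a, b)" by (cases "seg_ends (seg_at p q i)")
  note sa = seg_at_ends[OF assms(1) ends]
  define s where "s = cross_weight p q (seg_at p q i)"
  have s: "0 < s" "s < 1" using cross_weight_bounds[OF ends sa(1)] by (auto simp: s_def)
  have tn: "t * n = (1 - s) * real (i div 2) + s * real (Suc i div 2)"
    using p_pos by (simp only: t_def cross_time_def ends s_def sa(4,5) of_int_of_nat_eq prod.case) simp
  have "(even i \<longrightarrow> t * n = real i / 2) \<and> (real i - 1) / 2 < t * n \<and> t * n < (real i + 1) / 2"
  proof (cases "even i")
    case True
    then obtain j where "i = 2 * j" by (elim evenE)
    thus ?thesis using tn by (simp add: algebra_simps)
  next
    case False
    then obtain j where "i = Suc (2 * j)" by (elim oddE) auto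
    thus ?thesis using tn s False by (simp add: algebra_simps)
  qed
  thus "even i \<Longrightarrow> t * n = real i / 2" "(real i - 1) / 2 < t * n" "t * n < (real i + 1) / 2" by auto
qed

lemma cross_time_strict_mono:
  assumes "i \<in> {2..<2 * n - 1}" "i' \<in> {2..<2 * n - 1}" "i < i'"
  shows "cross_time p q (seg_at p q i) < cross_time p q (seg_at p q i')"
proof -
  have "cross_time p q (seg_at p q i) * n < cross_time p q (seg_at p q i') * n"
  proof (cases "Suc i = i'")
    case True
    show ?thesis
    proof (cases "even i")
      case even: True
      thus ?thesis using cross_time_seg_at(1)[OF assms(1)] cross_time_seg_at(2)[OF assms(2)] True by auto
    next
      case False
      thus ?thesis using cross_time_seg_at(3)[OF assms(1)] cross_time_seg_at(1)[OF assms(2)] True by auto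
    qed
  next
    case False
    hence "i + 2 \<le> i'" using assms(3) by simp
    hence "real (i + 2) \<le> real i'" by (simp only: of_nat_le_iff)
    hence "(real i + 1) / 2 \<le> (real i' - 1) / 2" by simp
    thus ?thesis using cross_time_seg_at(3)[OF assms(1)] cross_time_seg_at(2)[OF assms(2)] by linarith
  qed
  thus ?thesis using n_pos by simp
qed

lemma seg_at_crossed:
  assumes "i \<in> {2..<2 * n - 1}" shows "seg_at p q i \<in> crossed p q"
proof -
  obtain a b where ends: "seg_ends (seg_at p q i) = (a, b)" by (cases "seg_ends (seg_at p q i)")
  define t where "t = cross_time p q (seg_at p q i)"
  have "gam p q t \<in> seg_points (seg_at p q i)"
    using gam_mem_seg_points[OF ends seg_at_ends(1)[OF assms ends]] by (simp add: t_def)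
  moreover have "0 < t * n" using cross_time_seg_at(2)[OF assms] assms by (simp add: t_def)
  hence "0 < t" by (simp add: zero_less_mult_iff)
  moreover have "t * n < n" using cross_time_seg_at(3)[OF assms] assms by (simp add: t_def) linarith
  hence "t < 1" using n_pos by simp
  ultimately show ?thesis by (auto simp: crossed_def)
qed

text \<open>The coordinate sum of the crossing point determines the index, and the opposite heights
  of the ends determine \<open>hstep\<close> through \<open>hstep_eq_iff_N\<close>.\<close>

lemma crossed_seg_at:
  assumes "\<tau> \<in> crossed p q" shows "\<tau> \<in> seg_at p q ` {2..<2 * n - 1}"
proof -
  obtain c x y where \<tau>: "\<tau> = (c, x, y)" by (cases \<tau>)
  obtain a b where ends: "seg_ends \<tau> = (a, b)" by (cases "seg_ends \<tau>")
  have opp: "height p q a * height p q b < 0" by (rule crossed_heights[OF assms ends])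
  define s where "s = cross_weight p q \<tau>"
  have s: "0 < s" "s < 1" using cross_weight_bounds[OF ends opp] by (auto simp: s_def)
  obtain t where t: "0 < t" "t < 1" "t = cross_time p q \<tau>"
    using assms gam_mem_seg_points[OF ends opp] by (auto simp: crossed_def)
  have tn: "t * n = (1 - s) * coord_sum a + s * coord_sum b"
    using p_pos by (simp add: t(3) cross_time_def ends s_def)
  have tn01: "0 < t * n" "t * n < n" using t n_pos by auto
  show ?thesis
  proof (cases c)
    case X1
    have ab: "a = (x, y + 1)" "b = (x + 1, y)" using ends by (auto simp: \<tau> X1)
    have "t * n = x + y + 1" using tn by (simp add: ab algebra_simps)
    hence j: "0 < x + y + 1" "x + y + 1 < int n" using tn01 by linarith+
    define j where "j = nat (x + y + 1)"
    have jxy: "int j = x + y + 1" using j by (simp add: j_def)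
    have "height p q a = int q * int j - N * x" "height p q b = int q * int j - N * (x + 1)"
      by (simp_all add: height_N ab jxy algebra_simps)
    moreover have "N * x < N * (x + 1)" using N by simp
    ultimately have "N * x < int q * int j \<and> int q * int j \<le> N * (x + 1)"
      using opp by (auto simp: mult_less_0_iff)
    hence "hstep p q j = x" by (simp only: hstep_eq_iff_N)
    hence "seg_at p q (2 * j) = \<tau>" using jxy by (simp add: seg_at_double \<tau> X1)
    moreover have "2 * j \<in> {2..<2 * n - 1}" using j by (auto simp: j_def)
    ultimately show ?thesis by blast
  next
    case X2
    have ab: "a = (x, y)" "b = (x, y + 1)" using ends by (auto simp: \<tau> X2)
    have "t * n = x + y + s" using tn by (simp add: ab algebra_simps)
    hence j: "0 \<le> x + y" "x + y < int n" using tn01 s by linarith+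
    define j where "j = nat (x + y)"
    have jxy: "int j = x + y" using j by (simp add: j_def)
    have "height p q a = int q * int j - N * x" "height p q b = int q * (int j + 1) - N * x"
      by (simp_all add: height_N ab jxy algebra_simps)
    moreover have "int q * int j < int q * (int j + 1)" using q_pos by simp
    ultimately have opp': "int q * int j < N * x" "N * x < int q * (int j + 1)"
      using opp by (auto simp: mult_less_0_iff)
    have h: "hstep p q j = x - 1" "hstep p q (Suc j) = x"
      unfolding hstep_eq_iff_N using opp' N by (auto simp: algebra_simps)
    \<comment> \<open>Between an end of \<open>\<gamma>\<close> and the nearest antidiagonal,
      \<open>\<gamma>\<close> runs inside one lattice triangle with a vertex at that end, so neither
      \<open>j = 0\<close> nor \<open>j = n - 1\<close> occurs.\<close>
    have "j \<noteq> 0"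
    proof
      assume "j = 0"
      hence "0 < N * x" "N * x < int q" using opp' by auto
      hence "0 < x" "N * x < N * 1" using N(1,2,4) by (simp add: zero_less_mult_iff, linarith)
      thus False by (simp only: N_mult_less)
    qed
    moreover have "Suc j \<noteq> n"
    proof
      assume "Suc j = n"
      hence jN: "int j = N - 1" by (simp add: N_def)
      have "N * x < N * int q" "N * int q - int q < N * x"
        using opp'[unfolded jN] by (simp_all add: algebra_simps)
      moreover from this(2) have "N * (int q - 1) < N * x" using N by (simp add: algebra_simps)
      ultimately have "x < int q" "int q - 1 < x"
        by (simp_all only: N_mult_less)
      thus False by simp
    qed
    ultimately have "Suc (2 * j) \<in> {2..<2 * n - 1}" using j by (auto simp: j_def)
    moreover have "seg_at p q (Suc (2 * j)) = \<tau>" using jxy h by (simp add: seg_at_Suc_double \<tau> X2)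
    ultimately show ?thesis by blast
  next
    case X3
    have ab: "a = (x, y)" "b = (x + 1, y)" using ends by (auto simp: \<tau> X3)
    have "t * n = x + y + s" using tn by (simp add: ab algebra_simps)
    hence j: "0 \<le> x + y" "x + y < int n" using tn01 s by linarith+
    define j where "j = nat (x + y)"
    have jxy: "int j = x + y" using j by (simp add: j_def)
    have "height p q a = int q * int j - N * x" "height p q b = int q * (int j + 1) - N * (x + 1)"
      by (simp_all add: height_N ab jxy algebra_simps)
    moreover have "int q * (int j + 1) - N * (x + 1) < int q * int j - N * x"
      using N by (simp add: algebra_simps)
    ultimately have opp': "N * x < int q * int j" "int q * (int j + 1) < N * (x + 1)"
      using opp by (auto simp: mult_less_0_iff)
    have h: "hstep p q j = x" "hstep p q (Suc j) = x"
      unfolding hstep_eq_iff_N using opp' N by (auto simp: algebra_simps)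
    have "j \<noteq> 0"
    proof
      assume "j = 0"
      hence "N * x < 0" "0 < N * (x + 1)" using opp' q_pos by auto
      thus False using N by (auto simp: zero_less_mult_iff mult_less_0_iff)
    qed
    moreover have "Suc j \<noteq> n"
    proof
      assume "Suc j = n"
      hence jN: "int j = N - 1" by (simp add: N_def)
      have "N * x < N * int q - int q" "N * int q < N * (x + 1)"
        using opp'[unfolded jN] by (simp_all add: algebra_simps)
      moreover from this(1) have "N * x < N * int q" using N(3) by linarith
      ultimately have "x < int q" "int q < x + 1"
        by (simp_all only: N_mult_less)
      thus False by simp
    qed
    ultimately have "Suc (2 * j) \<in> {2..<2 * n - 1}" using j by (auto simp: j_def)
    moreover have "seg_at p q (Suc (2 * j)) = \<tau>" using jxy h by (simp add: seg_at_Suc_double \<tau> X3)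
    ultimately show ?thesis by blast
  qed
qed

lemma crossing_list_eq: "crossing_list p q = map (seg_at p q) [2..<2 * n - 1]"
proof -
  let ?S = "seg_at p q ` {2..<2 * n - 1}"
  have S: "crossed p q = ?S" using seg_at_crossed crossed_seg_at by blast
  have mono: "crossing_param p q (seg_at p q i) < crossing_param p q (seg_at p q i')"
    if "i \<in> {2..<2 * n - 1}" "i' \<in> {2..<2 * n - 1}" "i < i'" for i i'
    using cross_time_strict_mono[OF that] seg_at_crossed that by (simp add: crossing_param_eq)
  have sorted: "sorted_wrt (<) (map (crossing_param p q) (map (seg_at p q) [2..<2 * n - 1]))"
    unfolding map_map sorted_wrt_map
    by (rule sorted_wrt_mono_rel[OF _ sorted_wrt_upt]) (use mono in auto)
  hence "sorted (map (crossing_param p q) (map (seg_at p q) [2..<2 * n - 1]))"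
    "distinct (map (crossing_param p q) (map (seg_at p q) [2..<2 * n - 1]))"
    unfolding strict_sorted_iff by blast+
  moreover have "set (map (seg_at p q) [2..<2 * n - 1]) = ?S" by simp
  ultimately show ?thesis
    unfolding crossing_list_def S by (metis sorted_key_list_of_set_eqI)
qed

lemma seg_at_closer_right:
  assumes "i \<in> {2..<2 * n - 1}"
  shows "closer_right p q (seg_at p q i) \<longleftrightarrow> int p * midX p q i < int q * midY p q i"
proof -
  obtain a b where ends: "seg_ends (seg_at p q i) = (a, b)" by (cases "seg_ends (seg_at p q i)")
  show ?thesis
    unfolding closer_right_iff[OF seg_at_crossed[OF assms] ends] seg_at_ends(2,3)[OF assms ends, symmetric]
    by (simp add: height_def algebra_simps)
qed

text \<open>One of the two segments is an antidiagonal. Whether \<open>midX\<close> changes tells if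
  the other is vertical or horizontal, and the parity of \<open>i\<close> tells which comes first;
  together they fix the shared end.\<close>

lemma seg_at_turn:
  assumes "i \<in> {2..<2 * n - 1}" "Suc i \<in> {2..<2 * n - 1}"
  shows "right_of p q (shared_end (seg_at p q i) (seg_at p q (Suc i))) \<longleftrightarrow>
    (even i \<longleftrightarrow> midX p q (Suc i) \<noteq> midX p q i)"
  using assms(1)
proof (cases rule: crossing_index_cases)
  case (even j)
  define m where "m = hstep p q j"
  have m: "N * m < int q * int j" "int q * int j < N * (m + 1)"
    using hstep_bounds[of j] hstep_strict[OF even(2,3)] by (auto simp: m_def)
  show ?thesis
  proof (cases "hstep p q (Suc j) = m")
    case True
    have "shared_end (seg_at p q i) (seg_at p q (Suc i)) = (m, int j - m)"
      unfolding shared_end_def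
      by (rule the_equality) (auto simp: even(1) seg_at_double seg_at_Suc_double end_set_def True m_def[symmetric])
    thus ?thesis using m
      by (simp add: right_of_iff_height height_N even(1) midX_double midX_Suc_double True m_def[symmetric])
  next
    case False
    hence h: "hstep p q (Suc j) = m + 1" using hstep_Suc[of j] by (auto simp: m_def)
    have "shared_end (seg_at p q i) (seg_at p q (Suc i)) = (m + 1, int j - 1 - m)"
      unfolding shared_end_def
      by (rule the_equality) (auto simp: even(1) seg_at_double seg_at_Suc_double end_set_def h m_def[symmetric])
    thus ?thesis using m
      by (simp add: right_of_iff_height height_N even(1) midX_double midX_Suc_double h m_def[symmetric])
  qed
next
  case (odd j)
  have SS: "Suc (Suc (2 * j)) = 2 * Suc j" by simp
  define m where "m = hstep p q (Suc j)"
  have m: "N * m < int q * (int j + 1)" "int q * (int j + 1) < N * (m + 1)"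
    using hstep_bounds[of "Suc j"] hstep_strict[of "Suc j"] odd by (auto simp: m_def algebra_simps)
  show ?thesis
  proof (cases "m = hstep p q j")
    case True
    have "shared_end (seg_at p q i) (seg_at p q (Suc i)) = (m + 1, int j - m)"
      unfolding shared_end_def odd(1) SS seg_at_double seg_at_Suc_double
      by (rule the_equality) (auto simp: end_set_def True[symmetric] m_def[symmetric])
    thus ?thesis using m unfolding odd(1) SS midX_double midX_Suc_double
      by (simp add: right_of_iff_height height_N m_def[symmetric]) (simp add: True add.commute)
  next
    case False
    hence h: "hstep p q j = m - 1" using hstep_Suc[of j] by (auto simp: m_def)
    have "shared_end (seg_at p q i) (seg_at p q (Suc i)) = (m, int j - m + 1)"
      unfolding shared_end_def odd(1) SS seg_at_double seg_at_Suc_double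
      by (rule the_equality) (auto simp: end_set_def h m_def[symmetric])
    thus ?thesis using m unfolding odd(1) SS midX_double midX_Suc_double
      by (simp add: right_of_iff_height height_N h m_def[symmetric])
  qed
qed

end

section \<open>Matrices of lattice paths\<close>

declare indet.simps [simp del]

definition path_label :: "nat \<Rightarrow> nat \<Rightarrow> nat \<Rightarrow> idx" where
  "path_label p q i = pt_label (midX p q i) (midY p q i)"

definition path_desc :: "nat \<Rightarrow> nat \<Rightarrow> nat \<Rightarrow> bool" where
  "path_desc p q i \<longleftrightarrow> int p * midX p q i < int q * midY p q i"

definition path_turn :: "nat \<Rightarrow> nat \<Rightarrow> nat \<Rightarrow> bool" where
  "path_turn p q i \<longleftrightarrow> (even i \<longleftrightarrow> midX p q i \<noteq> midX p q (i - 1))"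

definition path_step :: "(idx \<Rightarrow> nat) \<Rightarrow> nat \<Rightarrow> nat \<Rightarrow> bool \<Rightarrow> nat \<Rightarrow> ratfun^2^2" where
  "path_step k p q desc i = turn (path_turn p q i) ** crossing_mat k desc (path_label p q i)"

text \<open>The flag \<open>c\<close> determines on which side of \<open>\<gamma>\<close> its midpoint \<open>(q/2, p/2)\<close>, which belongs to
  the index \<open>p + q\<close>, is considered to be. The poset \<open>\<P>\<^bsub>p/q\<^esub>\<close> corresponds to \<open>c = False\<close>.\<close>

definition path_prod :: "(idx \<Rightarrow> nat) \<Rightarrow> nat \<Rightarrow> nat \<Rightarrow> bool \<Rightarrow> ratfun^2^2" where
  "path_prod k p q c =
    mprod (map (\<lambda>i. path_step k p q (path_desc p q i \<or> (i = p + q \<and> c)) i) [2..<2 * (p + q) - 1])"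

lemma path_label_seg_at: "seg_label (seg_at p q i) = path_label p q i"
  by (simp add: seg_label_def seg_at_def path_label_def)

lemma monomial_vec3: "monomial (vec3 a b c) = indet X1 powi a * indet X2 powi b * indet X3 powi c"
  by (simp add: monomial_def vec3_def)

lemma monomial_vec3_mult:
  "monomial (vec3 a b c) * monomial (vec3 a' b' c') = monomial (vec3 (a + a') (b + b') (c + c'))"
  by (simp add: monomial_vec3 power_int_add)

lemma monomial_vec3_0: "monomial (vec3 0 0 0) = 1"
  by (simp add: monomial_vec3)

lemma xhat_monomial:
  "xhat X1 = monomial (vec3 0 1 (-1))" "xhat X2 = monomial (vec3 (-1) 0 1)" "xhat X3 = monomial (vec3 1 (-1) 0)"
  by (simp_all add: monomial_vec3 power_int_minus field_simps)

text \<open>\<open>g_vec\<close> and \<open>g_circ\<close> always differ by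
  \<open>(-1, 1, 1)\<close>, so conjugation by one fixed diagonal matrix accounts for the different
  monomials in the entries.\<close>

definition conj_mat :: "ratfun^2^2 \<Rightarrow> ratfun^2^2" where
  "conj_mat A = mat2 1 0 0 (1 / monomial (vec3 (-1) 1 1)) ** A ** mat2 1 0 0 (monomial (vec3 (-1) 1 1))"

lemma conj_mat_mat2: "conj_mat (mat2 a b c d) =
    mat2 a (b * monomial (vec3 (-1) 1 1)) (c / monomial (vec3 (-1) 1 1)) d"
  by (simp add: conj_mat_def)

lemma conj_mat_mult: "conj_mat (A ** B) = conj_mat A ** conj_mat B"
  by (cases A rule: mat2_cases; cases B rule: mat2_cases) (simp add: conj_mat_mat2 field_simps)

lemma conj_mat_diff: "conj_mat (A - B) = conj_mat A - conj_mat B"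
  by (cases A rule: mat2_cases; cases B rule: mat2_cases) (simp add: conj_mat_mat2 diff_divide_distrib algebra_simps)

lemma conj_mat_scale: "conj_mat (scale_mat c A) = scale_mat c (conj_mat A)"
  by (cases A rule: mat2_cases) (simp add: conj_mat_mat2)

text \<open>The factor \<open>turn True\<close> adds the second row to the first, which lifts the
  condition on \<open>L\<close> there; the second row keeps \<open>L\<close> out of the
  ideal.\<close>

lemma wsum_mat_eq_conj_mat:
  assumes "valid_fence P" and gg: "\<And>i. g i = g' i + vec3 (-1) 1 1 i"
  shows "mat2 (monomial g' * wsum P {fence_R P} {}) (monomial g * wsum P {} {fence_R P})
      (monomial (\<lambda>i. 2 * g' i - g i) * wsum P {fence_R P} {fence_L P})
      (monomial g' * wsum P {} {fence_R P, fence_L P}) =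
    scale_mat (monomial g') (conj_mat (turn True ** fence_mat P))"
proof -
  define t where "t = monomial (vec3 (-1) 1 1)"
  have "g = (\<lambda>i. g' i + vec3 (-1) 1 1 i)" using gg by auto
  hence g: "monomial g = monomial g' * t" by (simp add: monomial_add t_def)
  have "monomial (\<lambda>i. (2 * g' i - g i) + vec3 (-1) 1 1 i) = monomial g'" by (simp add: gg)
  hence "monomial (\<lambda>i. 2 * g' i - g i) * t = monomial g'" by (simp only: monomial_add t_def)
  hence g2: "monomial (\<lambda>i. 2 * g' i - g i) = monomial g' / t" by (simp add: t_def field_simps)
  show ?thesis
    unfolding wsum_ideal_sum fence_mat_ideal_sum[OF assms(1)] g g2
    by (simp add: turn_def conj_mat_mat2 t_def[symmetric] algebra_simps)
qed

text \<open>The factors \<open>loop_x3\<close>, \<open>loop_x1\<close>, \<open>loop_x2\<close> of \<open>loop_mat\<close> come from the chain \<open>H\<close>.\<close>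

definition loop_x3 where "loop_x3 k = turn True ** crossing_mat k True X3"
definition loop_x1 where "loop_x1 k = turn False ** crossing_mat k True X1"
definition loop_x2 where "loop_x2 k = turn False ** crossing_mat k True X2"

definition loop_mat :: "(idx \<Rightarrow> nat) \<Rightarrow> ratfun^2^2" where
  "loop_mat k = loop_x3 k ** loop_x1 k ** loop_x2 k"

definition root_left :: "(idx \<Rightarrow> nat) \<Rightarrow> ratfun^2^2" where
  "root_left k = turn True ** crossing_mat k True X1 ** loop_x2 k"

text \<open>The first two factors form the inverse of \<open>loop_x2 k\<close>: a right neighbour
  \<open>1/0\<close> cancels the last crossing of the left factor and closes the loop anew.\<close>

definition root_right :: "(idx \<Rightarrow> nat) \<Rightarrow> ratfun^2^2" where
  "root_right k = mat2 (1 / xhat X2) 0 (- of_nat (k X2)) (xhat X2) ** mat2 1 0 (-1) 1 ** loop_mat k"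

lemma loop_x2_root_right: "loop_x2 k ** root_right k = loop_mat k"
proof -
  define X where "X = mat2 (1 / xhat X2) 0 (- of_nat (k X2)) (xhat X2) ** mat2 1 0 (-1) 1"
  have "loop_x2 k ** X = mat 1"
    by (simp add: X_def loop_x2_def turn_def crossing_mat_def mat_1_mat2 field_simps del: xhat.simps)
  moreover have "loop_x2 k ** root_right k = (loop_x2 k ** X) ** loop_mat k"
    unfolding root_right_def X_def[symmetric] by (simp only: matrix_mul_assoc)
  ultimately show ?thesis by simp
qed

section \<open>The chain \<open>H\<close> and the two root matrices\<close>

lemma valid_chain_X12: "valid_fence (chain_X12 k)"
  unfolding chain_X12_def by (intro valid_fence_concat valid_label_group)

lemma fence_mat_chain_X12:
  "fence_mat (chain_X12 k) = scale_mat (monomial (vec3 (-1) 1 0)) (crossing_mat k True X1 ** loop_x2 k)"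
  by (simp add: chain_X12_def fence_mat_concat valid_label_group fence_mat_label_group scale_mat_mult
      scale_mat_scale_mat loop_x2_def matrix_mul_assoc xhat_monomial monomial_vec3_mult del: xhat.simps)

text \<open>No monomial remains, since the three \<open>xhat\<close> multiply to \<open>1\<close>.
  The \<open>turn True\<close> is the relation that attaches the chain to the fence.\<close>

lemma fence_mat_chain_H: "turn True ** fence_mat (chain_H k) = loop_mat k"
  by (simp add: chain_H_def fence_mat_concat valid_label_group valid_chain_X12 fence_mat_chain_X12
      fence_mat_label_group scale_mat_mult scale_mat_scale_mat loop_mat_def loop_x1_def loop_x3_def
      matrix_mul_assoc xhat_monomial monomial_vec3_mult monomial_vec3_0 del: xhat.simps)

lemma C_mat_0_1: "C_mat k 0 1 = conj_mat (root_left k)"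
proof -
  have "vec3 0 0 1 i = vec3 1 (-1) 0 i + vec3 (-1) 1 1 i" for i by (cases i) (simp_all add: vec3_def)
  from wsum_mat_eq_conj_mat[OF valid_chain_X12 this, of k]
  have "C_mat k 0 1 = scale_mat (monomial (vec3 1 (-1) 0)) (conj_mat (turn True ** fence_mat (chain_X12 k)))"
    by (simp add: C_mat_def poset_Pt_def g_vec_def g_circ_def Let_def)
  thus ?thesis
    by (simp add: fence_mat_chain_X12 scale_mat_mult conj_mat_scale scale_mat_scale_mat monomial_vec3_mult
      monomial_vec3_0 root_left_def matrix_mul_assoc)
qed

lemma C_mat_1_0: "C_mat k 1 0 = conj_mat (root_right k)"
  by (simp add: C_mat_def root_right_def loop_mat_def loop_x1_def loop_x2_def loop_x3_def turn_def
      crossing_mat_def conj_mat_mat2 monomial_vec3 power_int_minus scrM_def)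
    (simp add: field_simps power2_eq_square)

text \<open>\<open>mat2 1 (-1) 1 0\<close> is \<open>U J\<close>, so \<open>U J K\<close> is
  conjugate to the unipotent matrix in \<open>S_mat\<close>: \<open>scrM k\<close> comes from the
  three crossings around a lattice point.\<close>

lemma conj_mat_loop: "conj_mat (mat2 1 (-1) 1 0 ** loop_mat k) = shear k 1"
  by (simp add: loop_mat_def loop_x1_def loop_x2_def loop_x3_def turn_def shear_def
      crossing_mat_def conj_mat_mat2 monomial_vec3 power_int_minus scrM_def)
    (simp add: field_simps power2_eq_square)

section \<open>From the fence poset to the path matrix\<close>

context coprime_slope
begin

lemma hstep_0: "hstep p q 0 = -1"
  using N by (subst hstep_eq_iff_N) simp

lemma hstep_1: "hstep p q 1 = 0"
  using N by (subst hstep_eq_iff_N) simp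

lemma hstep_reflect:
  assumes "0 < j" "j < n" shows "hstep p q (n - j) = int q - 1 - hstep p q j"
proof -
  have "int q * int (n - j) = N * int q - int q * int j"
    using assms by (simp add: of_nat_diff N_def algebra_simps)
  thus ?thesis
    unfolding hstep_eq_iff_N using hstep_bounds(1)[of j] hstep_strict[OF assms] by (simp add: algebra_simps)
qed

lemma hstep_n_minus_1: "hstep p q (n - 1) = int q - 1"
  using hstep_reflect[of 1] hstep_1 p_pos q_pos by simp

text \<open>Evaluated formally before the first segment, the turn supplies the leading
  \<open>turn True\<close> of \<open>wsum_mat_eq_conj_mat\<close>.\<close>

lemma path_turn_2: "path_turn p q 2"
  using hstep_0 hstep_1 midX_double[of p q 1] midX_Suc_double[of p q 0] by (simp add: path_turn_def)

lemma path_turn_eq: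
  assumes "i \<in> {2..<2 * n - 1}" "Suc i \<in> {2..<2 * n - 1}"
  shows "path_turn p q (Suc i) \<longleftrightarrow> \<not> right_of p q (shared_end (seg_at p q i) (seg_at p q (Suc i)))"
  unfolding seg_at_turn[OF assms] by (auto simp: path_turn_def)

lemma path_label_double: "path_label p q (2 * j) = X1"
  by (simp add: path_label_seg_at[symmetric] seg_at_double seg_label_def)

lemma path_label_Suc_double:
  "path_label p q (Suc (2 * j)) = (if hstep p q (Suc j) = hstep p q j then X3 else X2)"
  by (simp add: path_label_seg_at[symmetric] seg_at_Suc_double seg_label_def)

text \<open>Each further pair of crossings contributes \<open>xhat X3 * xhat X1\<close> or
  \<open>xhat X2 * xhat X1\<close>, according to \<open>hstep\<close>. At the last antidiagonal,
  \<open>j = n - 1\<close>, the product is the inverse of \<open>monomial (g_circ p q)\<close> and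
  cancels the prefactor in \<open>C_mat\<close>.\<close>

lemma prod_list_xhat:
  assumes "0 < j"
  shows "prod_list (map (\<lambda>i. xhat (path_label p q i)) [2..<Suc (2 * j)]) =
    monomial (vec3 (int j - 1 - 2 * hstep p q j) (hstep p q j + 1) (hstep p q j - int j))"
  using assms
proof (induction j rule: nat_induct_non_zero)
  case 1
  have "[2..<Suc (2 * 1)] = [2]" by (simp add: upt_rec)
  thus ?case using hstep_1 path_label_double[of 1] xhat_monomial by simp
next
  case (Suc j)
  have upt: "[2..<Suc (2 * Suc j)] = [2..<Suc (2 * j)] @ [Suc (2 * j), 2 * Suc j]"
    using Suc.hyps by (simp add: upt_Suc_append)
  show ?case
  proof (cases "hstep p q (Suc j) = hstep p q j")
    case True
    thus ?thesis unfolding upt using Suc.IH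
      by (simp add: path_label_double path_label_Suc_double xhat_monomial monomial_vec3_mult mult.assoc
          del: xhat.simps mult_Suc_right upt_Suc) (simp add: algebra_simps)
  next
    case False
    hence "hstep p q (Suc j) = hstep p q j + 1" using hstep_Suc[of j] by auto
    thus ?thesis unfolding upt using Suc.IH
      by (simp add: path_label_double path_label_Suc_double xhat_monomial monomial_vec3_mult mult.assoc
          del: xhat.simps mult_Suc_right upt_Suc) (simp add: algebra_simps)
  qed
qed

lemma fence_mat_segment_group:
  assumes "i \<in> {2..<2 * n - 1}"
  shows "fence_mat (segment_group k p q (seg_at p q i)) =
    scale_mat (xhat (path_label p q i)) (crossing_mat k (path_desc p q i) (path_label p q i))"
  by (simp only: segment_group_def fence_mat_label_group path_label_seg_at seg_at_closer_right[OF assms] path_desc_def)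

lemma valid_poset_P: "valid_fence (poset_P k p q)"
  unfolding poset_P_def crossing_list_eq using p_pos q_pos by (intro valid_fence_of_segments) simp

lemma turn_fence_mat_poset_P:
  "turn True ** fence_mat (poset_P k p q) =
    scale_mat (monomial (vec3 (int p - int q) (int q) (- int p))) (path_prod k p q False)"
proof -
  let ?R = "[2..<2 * n - 1]"
  have less: "2 < 2 * n - 1" using p_pos q_pos by simp
  have R: "?R = 2 # [Suc 2..<2 * n - 1]" using less by (simp add: upt_conv_Cons)
  have "turn True ** fence_mat (poset_P k p q) =
      mprod (map (\<lambda>i. turn (path_turn p q i) ** fence_mat (segment_group k p q (seg_at p q i))) ?R)"
  proof -
    have "map (\<lambda>i. turn (\<not> right_of p q (shared_end (seg_at p q (i - 1)) (seg_at p q i))) **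
        fence_mat (segment_group k p q (seg_at p q i))) [Suc 2..<2 * n - 1] =
      map (\<lambda>i. turn (path_turn p q i) ** fence_mat (segment_group k p q (seg_at p q i))) [Suc 2..<2 * n - 1]"
    proof (rule map_cong[OF refl])
      fix i assume "i \<in> set [Suc 2..<2 * n - 1]"
      hence i: "i - 1 \<in> {2..<2 * n - 1}" "Suc (i - 1) \<in> {2..<2 * n - 1}" "Suc (i - 1) = i" by auto
      show "turn (\<not> right_of p q (shared_end (seg_at p q (i - 1)) (seg_at p q i))) **
          fence_mat (segment_group k p q (seg_at p q i)) =
        turn (path_turn p q i) ** fence_mat (segment_group k p q (seg_at p q i))"
        using path_turn_eq[OF i(1,2)] unfolding i(3) by simp
    qed
    thus ?thesis
      unfolding poset_P_def crossing_list_eq fence_mat_fence_of_segments[OF less]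
      by (simp only: R list.map mprod.simps path_turn_2 matrix_mul_assoc)
  qed
  also have "map (\<lambda>i. turn (path_turn p q i) ** fence_mat (segment_group k p q (seg_at p q i))) ?R =
      map (\<lambda>i. scale_mat (xhat (path_label p q i)) (path_step k p q (path_desc p q i \<or> (i = n \<and> False)) i)) ?R"
    by (rule map_cong[OF refl])
      (simp only: set_upt fence_mat_segment_group path_step_def scale_mat_mult simp_thms)
  also have "mprod \<dots> = scale_mat (prod_list (map (\<lambda>i. xhat (path_label p q i)) ?R)) (path_prod k p q False)"
    unfolding mprod_scale path_prod_def ..
  also have "2 * n - 1 = Suc (2 * (n - 1))" using less by arith
  also have "prod_list (map (\<lambda>i. xhat (path_label p q i)) [2..<\<dots>]) =
      monomial (vec3 (int p - int q) (int q) (- int p))"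
    using p_pos q_pos by (subst prod_list_xhat) (simp_all add: hstep_n_minus_1[unfolded One_nat_def] of_nat_diff)
  finally show ?thesis .
qed

lemma C_mat_eq: "C_mat k p q = conj_mat (path_prod k p q False ** loop_mat k)"
proof -
  let ?g = "vec3 (int q - int p - 1) (1 - int q) (int p + 1)"
    and ?g' = "vec3 (int q - int p) (- int q) (int p)"
  have valid: "valid_fence (poset_Pt k p q)"
    using p_pos by (simp add: poset_Pt_def chain_H_def valid_fence_concat valid_poset_P valid_label_group valid_chain_X12)
  have "?g i = ?g' i + vec3 (-1) 1 1 i" for i by (cases i) (simp_all add: vec3_def)
  from wsum_mat_eq_conj_mat[OF valid this]
  have "C_mat k p q = scale_mat (monomial ?g') (conj_mat (turn True ** fence_mat (poset_Pt k p q)))"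
    using p_pos q_pos by (simp add: C_mat_def g_vec_def g_circ_def Let_def)
  also have "turn True ** fence_mat (poset_Pt k p q) =
      turn True ** fence_mat (poset_P k p q) ** (turn True ** fence_mat (chain_H k))"
    using p_pos by (simp add: poset_Pt_def fence_mat_concat valid_poset_P chain_H_def valid_fence_concat
        valid_label_group valid_chain_X12 matrix_mul_assoc)
  finally show ?thesis
    by (simp add: turn_fence_mat_poset_P fence_mat_chain_H scale_mat_mult conj_mat_scale scale_mat_scale_mat
        monomial_vec3_mult monomial_vec3_0)
qed

section \<open>Central symmetry of the path\<close>

lemma midX_reflect:
  assumes "i \<in> {2..<2 * n - 1}" shows "midX p q (2 * n - i) = 2 * int q - midX p q i"
  using assms
proof (cases rule: crossing_index_cases)
  case (even j)
  hence "2 * n - i = 2 * (n - j)" by simp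
  thus ?thesis using hstep_reflect[of j] even by (simp add: midX_double)
next
  case (odd j)
  hence "2 * n - i = Suc (2 * (n - Suc j))" "Suc (n - Suc j) = n - j" by simp_all
  thus ?thesis using hstep_reflect[of j] hstep_reflect[of "Suc j"] odd by (simp add: midX_Suc_double)
qed

lemma midY_reflect:
  assumes "i \<in> {2..<2 * n - 1}" shows "midY p q (2 * n - i) = 2 * int p - midY p q i"
proof -
  have "i \<le> 2 * n" using assms by auto
  hence "int (2 * n - i) = 2 * int p + 2 * int q - int i" by (simp add: of_nat_diff)
  thus ?thesis unfolding midY_def midX_reflect[OF assms] by simp
qed

lemma n_mem: "n \<in> {2..<2 * n - 1}"
  using p_pos q_pos by simp

lemma midpoint_n: "midX p q n = int q" "midY p q n = int p"
proof -
  have nn: "2 * n - n = n" by simp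
  show "midX p q n = int q" "midY p q n = int p"
    using midX_reflect[OF n_mem, unfolded nn] midY_reflect[OF n_mem, unfolded nn] by linarith+
qed

lemma path_label_reflect:
  assumes "i \<in> {2..<2 * n - 1}" shows "path_label p q (2 * n - i) = path_label p q i"
  unfolding path_label_def midX_reflect[OF assms] midY_reflect[OF assms] by (simp add: pt_label_def)

text \<open>A midpoint on the line of \<open>\<gamma>\<close> would make \<open>n\<close> divide
  \<open>i\<close>, which happens only at the centre; elsewhere the rotation exchanges the
  sides.\<close>

lemma path_desc_reflect:
  assumes "i \<in> {2..<2 * n - 1}" "i \<noteq> n"
  shows "path_desc p q (2 * n - i) \<longleftrightarrow> \<not> path_desc p q i"
proof -
  have "int p * midX p q i \<noteq> int q * midY p q i"
  proof
    assume "int p * midX p q i = int q * midY p q i"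
    hence "int n * midX p q i = int q * int i" by (simp add: midY_def algebra_simps)
    hence "int n dvd int q * int i" by (metis dvd_triv_left)
    moreover have "coprime n q" using coprime by (simp add: coprime_iff_gcd_eq_1)
    hence "coprime (int n) (int q)" by (simp only: coprime_int_iff)
    ultimately have "int n dvd int i" by (simp only: coprime_dvd_mult_right_iff)
    then obtain c where c: "i = n * c" by (auto simp only: int_dvd_int_iff elim: dvdE)
    have "0 < c" using c assms(1) by (cases c) auto
    moreover have "n * c < n * 2" using c assms(1) by auto
    hence "c < 2" by (simp only: mult_less_cancel1)
    ultimately have "c = 1" by simp
    thus False using c assms(2) by simp
  qed
  thus ?thesis
    unfolding path_desc_def midX_reflect[OF assms(1)] midY_reflect[OF assms(1)] by (auto simp: algebra_simps)
qed

text \<open>The index of a turn is that of the segment after it, and rotation reverses the order;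
  hence the offset by one.\<close>

lemma path_turn_reflect:
  assumes "i \<in> {2..<2 * n - 1}" "Suc i \<in> {2..<2 * n - 1}"
  shows "path_turn p q (2 * n - i) \<longleftrightarrow> \<not> path_turn p q (Suc i)"
proof -
  have "2 * n - i - 1 = 2 * n - Suc i" "even (2 * n - i) \<longleftrightarrow> even i" using assms by auto
  thus ?thesis
    unfolding path_turn_def using midX_reflect[OF assms(1)] midX_reflect[OF assms(2)] by auto
qed

end

lemma transpose_turn: "transpose (turn u) = turn (\<not> u)"
  by (simp add: turn_def)

lemma transpose_crossing_mat: "transpose (crossing_mat k d a) = crossing_mat k (\<not> d) a"
  by (simp add: crossing_mat_def)

lemma det_turn: "det (turn u) = 1"
  by (simp add: turn_def)

lemma det_crossing_mat: "det (crossing_mat k d a) = 1"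
  by (simp add: crossing_mat_def del: xhat.simps)

lemma crossing_mat_diff: "crossing_mat k True a - crossing_mat k False a = mat2 0 (- of_nat (k a)) (of_nat (k a)) 0"
  by (simp add: crossing_mat_def)

lemma mat_mult_diff:
  fixes A B C :: "ratfun^2^2"
  shows "A ** (B - C) = A ** B - A ** C" "(A - B) ** C = A ** C - B ** C"
  by (cases A rule: mat2_cases; cases B rule: mat2_cases; cases C rule: mat2_cases, simp add: algebra_simps)+

lemma det_1_symplectic:
  assumes "det Z = 1" shows "Z ** mat2 0 (- c) c 0 ** transpose Z = mat2 0 (- c) c 0"
proof (cases Z rule: mat2_cases)
  case (mat2 a b d e)
  hence 1: "a * e - b * d = 1" using assms by simp
  have "b * c * d + - (a * c * e) = - c" "e * c * a + - (d * c * b) = c" using 1 by algebra+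
  thus ?thesis by (simp add: mat2 algebra_simps)
qed

context coprime_slope
begin

text \<open>The rotation by \<open>180\<degree>\<close> about the midpoint of \<open>\<gamma>\<close> transposes all factors except the central one,
  so that \<open>path_prod\<close> has the shape \<open>U Z A Z\<^sup>T\<close>, where only the central factor \<open>A\<close> depends on the flag.\<close>

definition half_path :: "(idx \<Rightarrow> nat) \<Rightarrow> nat \<Rightarrow> ratfun^2^2" where
  "half_path k m = mprod (map (\<lambda>i. crossing_mat k (path_desc p q i) (path_label p q i) **
     turn (path_turn p q (Suc i))) [2..<m])"

lemma det_half_path: "det (half_path k m) = 1"
  unfolding half_path_def by (rule mprod_det) (auto simp: det_mul det_turn det_crossing_mat)

lemma half_path_Suc:
  "2 \<le> m \<Longrightarrow> half_path k (Suc m) = half_path k m ** (crossing_mat k (path_desc p q m) (path_label p q m) **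
     turn (path_turn p q (Suc m)))"
  by (simp add: half_path_def mprod_append)

text \<open>Regrouping: each turn joins the segment before it instead of the one after it, so the
  initial \<open>turn True\<close> splits off.\<close>

lemma half_path_left:
  assumes "2 \<le> m"
  shows "mprod (map (\<lambda>i. path_step k p q (path_desc p q i) i) [2..<m]) ** turn (path_turn p q m) =
    turn True ** half_path k m"
  using assms
proof (induction m rule: dec_induct)
  case base
  show ?case by (simp add: half_path_def path_turn_2)
next
  case (step m)
  have "mprod (map (\<lambda>i. path_step k p q (path_desc p q i) i) [2..<Suc m]) =
      (mprod (map (\<lambda>i. path_step k p q (path_desc p q i) i) [2..<m]) ** turn (path_turn p q m)) **
        crossing_mat k (path_desc p q m) (path_label p q m)"
    using step.hyps by (simp add: mprod_append path_step_def matrix_mul_assoc)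
  thus ?case using step by (simp add: half_path_Suc matrix_mul_assoc)
qed

lemma half_path_right:
  assumes "2 \<le> m" "m \<le> n"
  shows "mprod (map (\<lambda>i. path_step k p q (path_desc p q i) i) [Suc (2 * n) - m..<2 * n - 1]) =
    transpose (half_path k m)"
  using assms
proof (induction m rule: dec_induct)
  case base
  show ?case by (simp add: half_path_def transpose_mat)
next
  case (step m)
  have m: "m \<in> {2..<2 * n - 1}" "Suc m \<in> {2..<2 * n - 1}" "m \<noteq> n" using step by auto
  have "[Suc (2 * n) - Suc m..<2 * n - 1] = (2 * n - m) # [Suc (2 * n) - m..<2 * n - 1]"
    using step by (simp add: upt_conv_Cons Suc_diff_le)
  moreover have "path_step k p q (path_desc p q (2 * n - m)) (2 * n - m) =
      transpose (crossing_mat k (path_desc p q m) (path_label p q m) ** turn (path_turn p q (Suc m)))"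
    unfolding path_step_def path_label_reflect[OF m(1)] path_desc_reflect[OF m(1,3)] path_turn_reflect[OF m(1,2)]
    by (simp only: matrix_transpose_mul transpose_turn transpose_crossing_mat)
  ultimately show ?case using step by (simp add: half_path_Suc matrix_transpose_mul)
qed

lemma path_prod_factor:
  "path_prod k p q c = turn True ** half_path k n ** crossing_mat k c (path_label p q n) ** transpose (half_path k n)"
proof -
  let ?f = "\<lambda>i. path_step k p q (path_desc p q i \<or> (i = n \<and> c)) i"
  let ?g = "\<lambda>i. path_step k p q (path_desc p q i) i"
  have "2 \<le> n" using n_mem by simp
  hence left: "mprod (map ?g [2..<n]) ** turn (path_turn p q n) = turn True ** half_path k n"
    by (rule half_path_left)
  have "Suc (2 * n) - n = Suc n" by simp
  with half_path_right[OF \<open>2 \<le> n\<close> order_refl, of k]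
  have right: "mprod (map ?g [Suc n..<2 * n - 1]) = transpose (half_path k n)" by (simp only:)
  have eq: "2 * n - 1 = n + (n - 1)" using n_pos by arith
  have "[2..<2 * n - 1] = [2..<n] @ [n..<2 * n - 1]"
    unfolding eq by (rule upt_add_eq_append) (use n_mem in simp)
  also have "[n..<2 * n - 1] = n # [Suc n..<2 * n - 1]" using n_mem by (simp add: upt_conv_Cons)
  finally have "path_prod k p q c = mprod (map ?f [2..<n]) ** ?f n ** mprod (map ?f [Suc n..<2 * n - 1])"
    unfolding path_prod_def by (simp only: map_append list.map mprod_append mprod.simps matrix_mul_assoc)
  also have "map ?f [2..<n] = map ?g [2..<n]" by (rule map_cong) simp_all
  also have "map ?f [Suc n..<2 * n - 1] = map ?g [Suc n..<2 * n - 1]" by (rule map_cong) simp_all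
  \<comment> \<open>At the centre \<open>path_desc\<close> compares \<open>p q\<close> with
    \<open>q p\<close> and is false, so the flag \<open>c\<close> alone decides.\<close>
  also have "?f n = turn (path_turn p q n) ** crossing_mat k c (path_label p q n)"
    by (simp add: path_step_def path_desc_def midpoint_n mult.commute)
  also have "mprod (map ?g [2..<n]) ** (turn (path_turn p q n) ** crossing_mat k c (path_label p q n)) ** mprod (map ?g [Suc n..<2 * n - 1])
     = turn True ** half_path k n ** crossing_mat k c (path_label p q n) ** transpose (half_path k n)"
    by (simp only: matrix_mul_assoc left right)
  finally show ?thesis .
qed

lemma path_label_n: "path_label p q n = lab p q"
  by (simp add: path_label_def midpoint_n pt_label_def lab_def)

lemma path_prod_diff:
  "path_prod k p q True - path_prod k p q False = scale_mat (of_nat (k (lab p q))) (mat2 1 (-1) 1 0)"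
proof -
  let ?Z = "half_path k n" and ?c = "of_nat (k (lab p q)) :: ratfun"
  have "path_prod k p q True - path_prod k p q False =
      turn True ** ?Z ** (crossing_mat k True (lab p q) - crossing_mat k False (lab p q)) ** transpose ?Z"
    unfolding path_prod_factor path_label_n by (simp only: mat_mult_diff)
  also have "\<dots> = turn True ** (?Z ** mat2 0 (- ?c) ?c 0 ** transpose ?Z)"
    unfolding crossing_mat_diff by (simp only: matrix_mul_assoc)
  also have "\<dots> = scale_mat ?c (mat2 1 (-1) 1 0)"
    unfolding det_1_symplectic[OF det_half_path] by (simp add: turn_def)
  finally show ?thesis .
qed

end

section \<open>Concatenation at a Farey mediant\<close>

lemma map_add_upt_left: "map (\<lambda>i. c + i) [m..<m'] = [c + m..<c + m']" for c m m' :: nat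
  by (induction m') auto

lemma coprime_if_det_1:
  fixes p q r s :: nat
  assumes "q * r = Suc (p * s)" shows "coprime p q" "coprime r s"
proof -
  have "d = 1" if "d dvd q * r" "d dvd p * s" for d :: nat
    using that assms by (metis Suc_eq_plus1 dvd_add_right_iff nat_dvd_1_iff_1)
  thus "coprime p q" "coprime r s" by (auto intro!: coprimeI simp: nat_dvd_1_iff_1)
qed

locale farey_pair =
  fixes p q r s :: nat
  assumes det: "q * r = Suc (p * s)"
begin

abbreviation a :: nat where "a \<equiv> p + q"
abbreviation b :: nat where "b \<equiv> r + s"

lemma pos: "0 < q" "0 < r" "0 < a" "0 < b"
proof -
  show "0 < q" "0 < r" using det by (auto intro: gr0I)
  thus "0 < a" "0 < b" by simp_all
qed

lemma det_int: "int q * int r = int p * int s + 1"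
  using arg_cong[OF det, of int] by simp

lemma mediant: "coprime_slope (p + r) (q + s)"
proof
  have "q * (p + r) = Suc (p * (q + s))" using det by (simp add: algebra_simps)
  hence "(q + s) * r = Suc ((p + r) * s)" using det by (simp add: algebra_simps)
  thus "coprime (p + r) (q + s)" by (rule coprime_if_det_1)
  show "0 < p + r" "0 < q + s" using pos by simp_all
qed

lemma left_slope: "0 < p \<Longrightarrow> coprime_slope p q"
  using coprime_if_det_1[OF det] pos by unfold_locales auto

lemma right_slope: "0 < s \<Longrightarrow> coprime_slope r s"
  using coprime_if_det_1[OF det] pos by unfold_locales auto

lemma sum_ab: "(p + r) + (q + s) = a + b" by simp

lemma hstep_mediant_iff:
  "hstep (p + r) (q + s) j = m \<longleftrightarrow> int (a + b) * m < int (q + s) * int j \<and> int (q + s) * int j \<le> int (a + b) * (m + 1)"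
  using hstep_eq_iff[of "p + r" "q + s" j m] pos by (simp only: sum_ab)

text \<open>The proofs of the next two lemmas rest on \<open>(q + s) a = q (a + b) - 1\<close> and \<open>(q + s) b = s (a + b) + 1\<close>.\<close>

lemma hstep_left:
  assumes "j \<le> a" shows "hstep (p + r) (q + s) j = hstep p q j"
proof -
  define m where "m = hstep p q j"
  define A N where "A = int a" and "N = int (a + b)"
  have A: "0 < A" and jN: "int j < N" and N: "0 < N"
    using pos assms by (auto simp: A_def N_def)
  have id: "A * (int (q + s) * int j) = N * (int q * int j) - int j"
    using det_int by (simp add: A_def N_def algebra_simps)
  have m: "A * m < int q * int j" "int q * int j \<le> A * (m + 1)"
    using hstep_eq_iff[of p q j m] pos by (auto simp: m_def A_def)
  have "A * (N * m) = N * (A * m)" by (simp add: mult.left_commute)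
  \<comment> \<open>Integrality turns \<open>A m < q j\<close> into a gap of one; multiplied by
    \<open>N\<close> it outweighs the error \<open>j < N\<close>.\<close>
  also have "\<dots> \<le> N * (int q * int j - 1)" using m(1) N by (intro mult_left_mono) auto
  also have "\<dots> < A * (int (q + s) * int j)" unfolding id using jN by (simp add: right_diff_distrib)
  finally have 1: "N * m < int (q + s) * int j" using A by (simp only: mult_less_cancel_left_pos)
  have "A * (int (q + s) * int j) \<le> N * (int q * int j)" unfolding id by simp
  also have "\<dots> \<le> N * (A * (m + 1))" using m(2) N by (intro mult_left_mono) auto
  also have "\<dots> = A * (N * (m + 1))" by (simp add: mult.left_commute)
  finally have "int (q + s) * int j \<le> N * (m + 1)" using A by (simp only: mult_le_cancel_left_pos)
  with 1 show ?thesis unfolding hstep_mediant_iff N_def m_def by blast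
qed

lemma hstep_right:
  assumes "j \<le> b" shows "hstep (p + r) (q + s) (a + j) = int q + hstep r s j"
proof -
  define m where "m = hstep r s j"
  define B N where "B = int b" and "N = int (a + b)"
  have B: "0 < B" and N: "0 < N" "B < N" and jB: "int j \<le> B" "0 \<le> int j"
    using pos assms by (auto simp: B_def N_def)
  define w t where "w = int (q + s) * int (a + j)" and "t = w - int q * N"
  have id: "B * t = N * (int s * int j) + int j - B"
    using det_int unfolding t_def w_def B_def N_def of_nat_add by algebra
  have m: "B * m < int s * int j" "int s * int j \<le> B * (m + 1)"
    using hstep_eq_iff[of r s j m] pos by (auto simp: m_def B_def)
  have "B * (N * m) = N * (B * m)" by (simp add: mult.left_commute)
  also have "\<dots> \<le> N * (int s * int j - 1)" using m(1) N by (intro mult_left_mono) auto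
  also have "\<dots> < B * t" unfolding id using jB N by (simp add: right_diff_distrib)
  finally have 1: "N * m < t" using B by (simp only: mult_less_cancel_left_pos)
  have "B * t \<le> N * (int s * int j)" unfolding id using jB by simp
  also have "\<dots> \<le> N * (B * (m + 1))" using m(2) N by (intro mult_left_mono) auto
  also have "\<dots> = B * (N * (m + 1))" by (simp add: mult.left_commute)
  finally have 2: "t \<le> N * (m + 1)" using B by (simp only: mult_le_cancel_left_pos)
  have "N * (int q + m) < w" "w \<le> N * ((int q + m) + 1)"
    using 1 2 by (simp_all add: t_def algebra_simps)
  thus ?thesis unfolding hstep_mediant_iff N_def m_def w_def by blast
qed

lemma midX_left: "i \<le> 2 * a \<Longrightarrow> midX (p + r) (q + s) i = midX p q i"
  unfolding midX_def by (subst (1 2) hstep_left) auto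

lemma midX_right: "i \<le> 2 * b \<Longrightarrow> midX (p + r) (q + s) (2 * a + i) = 2 * int q + midX r s i"
proof -
  assume "i \<le> 2 * b"
  moreover have "(2 * a + i) div 2 = a + i div 2" "Suc (2 * a + i) div 2 = a + Suc i div 2" by simp_all
  ultimately show ?thesis unfolding midX_def by (simp only:) (simp add: hstep_right)
qed

lemma midY_right: "i \<le> 2 * b \<Longrightarrow> midY (p + r) (q + s) (2 * a + i) = 2 * int p + midY r s i"
  unfolding midY_def by (simp only: midX_right) simp

lemma path_label_left: "i \<le> 2 * a \<Longrightarrow> path_label (p + r) (q + s) i = path_label p q i"
  by (simp add: path_label_def midY_def midX_left)

lemma path_label_right: "i \<le> 2 * b \<Longrightarrow> path_label (p + r) (q + s) (2 * a + i) = path_label r s i"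
  unfolding path_label_def midX_right midY_right by (simp add: pt_label_def)

lemma path_turn_left: "i \<le> 2 * a \<Longrightarrow> path_turn (p + r) (q + s) i = path_turn p q i"
  by (simp add: path_turn_def midX_left)

lemma path_turn_right:
  assumes "0 < i" "i \<le> 2 * b" shows "path_turn (p + r) (q + s) (2 * a + i) = path_turn r s i"
proof -
  have "2 * a + i - 1 = 2 * a + (i - 1)" using assms by simp
  moreover have "i - 1 \<le> 2 * b" using assms by simp
  ultimately show ?thesis unfolding path_turn_def using assms(2) by (simp only: midX_right) simp
qed

text \<open>In the coordinates \<open>(\<alpha>, \<beta>)\<close> with respect to the basis \<open>(q, p)\<close>, \<open>(s, r)\<close>, doubled midpoints between the
  mediant segment and the broken line through \<open>(q, p)\<close> satisfy \<open>\<alpha> = \<beta> = 1\<close>.\<close>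

lemma basis_coordinates:
  fixes x y :: int
  defines "\<alpha> \<equiv> int r * x - int s * y" and "\<beta> \<equiv> int q * y - int p * x"
  shows "int a * \<alpha> + int b * \<beta> = x + y"
    and "int p * x < int q * y \<longleftrightarrow> 0 < \<beta>"
    and "int r * (x - 2 * int q) < int s * (y - 2 * int p) \<longleftrightarrow> \<alpha> < 2"
    and "int (p + r) * x < int (q + s) * y \<longleftrightarrow> \<alpha> < \<beta>"
proof -
  show "int a * \<alpha> + int b * \<beta> = x + y"
    using det_int unfolding \<alpha>_def \<beta>_def of_nat_add by algebra
  show "int p * x < int q * y \<longleftrightarrow> 0 < \<beta>" by (simp add: \<beta>_def)
  have "int r * (x - 2 * int q) - int s * (y - 2 * int p) = \<alpha> - 2"
    using det_int unfolding \<alpha>_def by algebra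
  thus "int r * (x - 2 * int q) < int s * (y - 2 * int p) \<longleftrightarrow> \<alpha> < 2" by linarith
  show "int (p + r) * x < int (q + s) * y \<longleftrightarrow> \<alpha> < \<beta>" by (simp add: \<alpha>_def \<beta>_def algebra_simps)
qed

lemma center_coordinates:
  assumes "i = a + b"
  defines "x \<equiv> midX (p + r) (q + s) i" and "y \<equiv> midY (p + r) (q + s) i"
  shows "int r * x - int s * y = 1" "int q * y - int p * x = 1"
proof -
  interpret M: coprime_slope "p + r" "q + s" by (rule mediant)
  have "x = int (q + s)" "y = int (p + r)"
    using M.midpoint_n unfolding x_def y_def assms(1) sum_ab by simp_all
  thus "int r * x - int s * y = 1" "int q * y - int p * x = 1"
    using det_int by (simp_all add: algebra_simps)
qed

text \<open>The sides disagree only if \<open>0 < \<beta> \<le> \<alpha>\<close> or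
  \<open>\<alpha> < \<beta> \<le> 0\<close>. Since \<open>a \<alpha> + b \<beta> = i\<close>, the
  bound \<open>i < 2 a\<close> reduces the first case to the centre, and \<open>0 < i\<close>
  excludes the second.\<close>

lemma path_desc_left:
  assumes "0 < i" "i < 2 * a"
  shows "path_desc p q i \<longleftrightarrow> path_desc (p + r) (q + s) i \<or> i = a + b"
proof -
  define x y where "x = midX (p + r) (q + s) i" and "y = midY (p + r) (q + s) i"
  define \<alpha> \<beta> where "\<alpha> = int r * x - int s * y" and "\<beta> = int q * y - int p * x"
  note coords = basis_coordinates[of x y, folded \<alpha>_def \<beta>_def]
  have i: "int a * \<alpha> + int b * \<beta> = int i" using coords(1) by (simp add: x_def y_def midY_def)
  have "midX p q i = x" "midY p q i = y" using assms by (simp_all add: x_def y_def midY_def midX_left)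
  hence P: "path_desc p q i \<longleftrightarrow> 0 < \<beta>" by (simp add: path_desc_def coords(2))
  have Q: "path_desc (p + r) (q + s) i \<longleftrightarrow> \<alpha> < \<beta>"
    unfolding path_desc_def x_def[symmetric] y_def[symmetric] by (rule coords(4))
  have center: "i = a + b \<Longrightarrow> \<alpha> = 1 \<and> \<beta> = 1"
    using center_coordinates[of i] by (simp add: \<alpha>_def \<beta>_def x_def y_def)
  define A B where "A = int a" and "B = int b"
  have AB: "0 < A" "0 < B" using pos by (simp_all add: A_def B_def)
  have i': "A * \<alpha> + B * \<beta> = int i" "0 < int i" "int i < 2 * A"
    using i assms by (simp_all add: A_def B_def)
  have 1: "i = a + b" if "0 < \<beta>" "\<beta> \<le> \<alpha>"
  proof -
    have "0 < B * \<beta>" using AB that by simp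
    hence "A * \<alpha> < A * 2" using i' by linarith
    hence "\<alpha> < 2" using AB by (simp only: mult_less_cancel_left_pos)
    hence "\<alpha> = 1" "\<beta> = 1" using that by auto
    thus ?thesis using i by simp
  qed
  have 2: False if "\<alpha> < \<beta>" "\<beta> \<le> 0"
  proof -
    have "A * \<alpha> \<le> 0" "B * \<beta> \<le> 0" using AB that by (simp_all add: mult_nonneg_nonpos)
    thus False using i' by linarith
  qed
  show ?thesis unfolding P Q using center 1 2 by (metis not_less zero_less_one)
qed

text \<open>Here disagreement means \<open>\<beta> \<le> \<alpha> < 2\<close> or
  \<open>2 \<le> \<alpha> < \<beta>\<close>, and \<open>a (\<alpha> - 2) + b \<beta> = i\<close>
  with \<open>0 < i < 2 b\<close> leaves only the centre.\<close>

lemma path_desc_right: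
  assumes "0 < i" "i < 2 * b"
  shows "path_desc r s i \<longleftrightarrow> path_desc (p + r) (q + s) (2 * a + i) \<or> 2 * a + i = a + b"
proof -
  define x y where "x = midX (p + r) (q + s) (2 * a + i)" and "y = midY (p + r) (q + s) (2 * a + i)"
  define \<alpha> \<beta> where "\<alpha> = int r * x - int s * y" and "\<beta> = int q * y - int p * x"
  note coords = basis_coordinates[of x y, folded \<alpha>_def \<beta>_def]
  have i: "int a * \<alpha> + int b * \<beta> = int (2 * a + i)" using coords(1) by (simp add: x_def y_def midY_def)
  have "i \<le> 2 * b" using assms by simp
  from midX_right[OF this] midY_right[OF this]
  have "midX r s i = x - 2 * int q" "midY r s i = y - 2 * int p"
    unfolding x_def y_def by linarith+
  hence P: "path_desc r s i \<longleftrightarrow> \<alpha> < 2" by (simp only: path_desc_def coords(3))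
  have Q: "path_desc (p + r) (q + s) (2 * a + i) \<longleftrightarrow> \<alpha> < \<beta>"
    unfolding path_desc_def x_def[symmetric] y_def[symmetric] by (rule coords(4))
  have center: "2 * a + i = a + b \<Longrightarrow> \<alpha> = 1 \<and> \<beta> = 1"
    using center_coordinates[of "2 * a + i"] by (simp add: \<alpha>_def \<beta>_def x_def y_def)
  define A B where "A = int a" and "B = int b"
  have AB: "0 < A" "0 < B" using pos by (simp_all add: A_def B_def)
  have i': "A * (\<alpha> - 2) + B * \<beta> = int i" "0 < int i" "int i < 2 * B"
    using i assms by (simp_all add: A_def B_def algebra_simps)
  have 1: "2 * a + i = a + b" if "\<alpha> < 2" "\<beta> \<le> \<alpha>"
  proof -
    have "A * (\<alpha> - 2) < 0" using AB that by (simp add: mult_pos_neg)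
    hence "0 < B * \<beta>" using i' by linarith
    hence "0 < \<beta>" using AB by (simp add: zero_less_mult_iff)
    hence "\<alpha> = 1" "\<beta> = 1" using that by auto
    thus ?thesis using i by simp
  qed
  have 2: False if "\<alpha> < \<beta>" "2 \<le> \<alpha>"
  proof -
    have "0 \<le> A * (\<alpha> - 2)" using AB that by simp
    hence "B * \<beta> < B * 2" using i' by linarith
    hence "\<beta> < 2" using AB by (simp only: mult_less_cancel_left_pos)
    thus False using that by simp
  qed
  show ?thesis unfolding P Q using center 1 2 by (metis not_less one_less_numeral_iff semiring_norm(76))
qed

section \<open>Passage of the mediant path around \<open>(q, p)\<close>\<close>

lemma hstep_end: "hstep p q a = int q - 1"
  unfolding hstep_eq_iff[OF pos(3)] using pos by (simp add: algebra_simps)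

text \<open>The mediant segment passes to the left of \<open>(q, p)\<close>, crossing segments that
  end there: a horizontal one at index \<open>2 a - 1\<close> if \<open>p > 0\<close>, an
  antidiagonal at \<open>2 a\<close>, a vertical one at \<open>2 a + 1\<close> if
  \<open>s > 0\<close>. Rounding down in \<open>hstep\<close> selects the antidiagonal on this
  side.\<close>

lemma midX_end: "midX (p + r) (q + s) (2 * a) = 2 * int q - 1"
proof -
  have "midX (p + r) (q + s) (2 * a) = midX p q (2 * a)" by (rule midX_left) simp
  also have "\<dots> = 2 * hstep p q a + 1" by (rule midX_double)
  finally show ?thesis unfolding hstep_end by simp
qed

lemma midX_before_end:
  assumes "0 < p"
  shows "midX (p + r) (q + s) (2 * a - 1) = 2 * int q - 1" "midX (p + r) (q + s) (2 * a - 2) = 2 * int q - 1"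
proof -
  interpret P: coprime_slope p q by (rule left_slope[OF assms])
  have "2 * a - 1 = Suc (2 * (a - 1))" "Suc (a - 1) = a" using pos by arith+
  hence "midX p q (2 * a - 1) = hstep p q (a - 1) + hstep p q a + 1" by (metis midX_Suc_double)
  thus "midX (p + r) (q + s) (2 * a - 1) = 2 * int q - 1"
    unfolding P.hstep_n_minus_1 hstep_end by (simp add: midX_left)
  have "2 * a - 2 = 2 * (a - 1)" by simp
  hence "midX p q (2 * a - 2) = 2 * hstep p q (a - 1) + 1" by (metis midX_double)
  thus "midX (p + r) (q + s) (2 * a - 2) = 2 * int q - 1"
    unfolding P.hstep_n_minus_1 by (simp add: midX_left)
qed

lemma midX_after_end:
  assumes "0 < s" shows "midX (p + r) (q + s) (2 * a + 1) = 2 * int q"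
proof -
  interpret R: coprime_slope r s by (rule right_slope[OF assms])
  have "midX r s 1 = 0" using midX_Suc_double[of r s 0] R.hstep_0 R.hstep_1 by simp
  thus ?thesis using midX_right[of 1] pos by simp
qed

abbreviation mediant_step :: "(idx \<Rightarrow> nat) \<Rightarrow> nat \<Rightarrow> ratfun^2^2" where
  "mediant_step k i \<equiv>
    path_step k (p + r) (q + s) (path_desc (p + r) (q + s) i \<or> (i = (p + r) + (q + s) \<and> True)) i"

lemma mediant_step_left:
  assumes "0 < i" "i < 2 * a"
  shows "mediant_step k i = path_step k p q (path_desc p q i \<or> (i = a \<and> False)) i"
  using assms unfolding path_step_def sum_ab simp_thms
  by (simp only: path_turn_left path_label_left path_desc_left less_imp_le)

lemma mediant_step_right:
  assumes "0 < i" "i < 2 * b"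
  shows "mediant_step k (2 * a + i) = path_step k r s (path_desc r s i \<or> (i = b \<and> False)) i"
  using assms unfolding path_step_def sum_ab simp_thms
  by (simp only: path_turn_right path_label_right path_desc_right less_imp_le)

lemma mediant_step_loop_x3:
  assumes "0 < p" shows "mediant_step k (2 * a - 1) = loop_x3 k"
proof -
  note X = midX_before_end[OF assms]
  have Y: "midY (p + r) (q + s) (2 * a - 1) = 2 * int p"
    using pos by (simp only: midY_def X) (simp add: of_nat_diff)
  have "2 * a - 1 - 1 = 2 * a - 2" "odd (2 * a - 1)" using pos by auto
  hence turn: "path_turn (p + r) (q + s) (2 * a - 1)" by (simp only: path_turn_def X) simp
  have label: "path_label (p + r) (q + s) (2 * a - 1) = X3"
    unfolding path_label_def X Y by (simp add: pt_label_def)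
  have "int (q + s) * (2 * int p) - int (p + r) * (2 * int q - 1) = int p + int r - 2"
    using det_int by (simp add: algebra_simps)
  \<comment> \<open>The difference vanishes only for \<open>p = r = 1\<close>. There the strict test
    in \<open>path_desc\<close> fails, but the index is the centre, where the flag applies.\<close>
  moreover have "2 * a - 1 = a + b" if "p = 1" "r = 1" using that det by simp
  hence "2 * a - 1 = a + b" if "int p + int r \<le> 2" using that assms pos by simp
  ultimately have "path_desc (p + r) (q + s) (2 * a - 1) \<or> 2 * a - 1 = a + b"
    unfolding path_desc_def X Y by linarith
  thus ?thesis by (simp only: path_step_def turn label loop_x3_def sum_ab simp_thms)
qed

text \<open>For \<open>p = 0\<close> the antidiagonal is the first crossing and carries the initial
  \<open>turn True\<close>; otherwise it follows the horizontal segment with \<open>(q, p)\<close>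
  as shared end on the right.\<close>

lemma mediant_step_x1: "mediant_step k (2 * a) = turn (p = 0) ** crossing_mat k True X1"
proof -
  note X = midX_end
  have Y: "midY (p + r) (q + s) (2 * a) = 2 * int p + 1"
    by (simp only: midY_def X) simp
  have turn: "path_turn (p + r) (q + s) (2 * a) \<longleftrightarrow> p = 0"
  proof (cases "p = 0")
    case True
    interpret M: coprime_slope "p + r" "q + s" by (rule mediant)
    have "2 * a = 2" using det True by simp
    thus ?thesis using M.path_turn_2 True by simp
  next
    case False
    hence "midX (p + r) (q + s) (2 * a - 1) = midX (p + r) (q + s) (2 * a)"
      using midX_before_end(1) midX_end by simp
    thus ?thesis using False unfolding path_turn_def by (simp only:) simp
  qed
  have label: "path_label (p + r) (q + s) (2 * a) = X1"
    unfolding path_label_def X Y by (simp add: pt_label_def)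
  have "int (q + s) * (2 * int p + 1) - int (p + r) * (2 * int q - 1) = int a + int b - 2"
    using det_int by (simp add: algebra_simps)
  moreover have "a = b" if "int a + int b \<le> 2" using that pos by linarith
  hence "2 * a = a + b" if "int a + int b \<le> 2" using that by simp
  ultimately have "path_desc (p + r) (q + s) (2 * a) \<or> 2 * a = a + b"
    unfolding path_desc_def X Y by linarith
  thus ?thesis by (simp only: path_step_def turn label sum_ab simp_thms)
qed

lemma mediant_step_loop_x2:
  assumes "0 < s" shows "mediant_step k (2 * a + 1) = loop_x2 k"
proof -
  note X = midX_after_end[OF assms]
  have Y: "midY (p + r) (q + s) (2 * a + 1) = 2 * int p + 1"
    by (simp only: midY_def X) simp
  have "2 * a + 1 - 1 = 2 * a" "odd (2 * a + 1)" by auto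
  hence turn: "path_turn (p + r) (q + s) (2 * a + 1) \<longleftrightarrow> False"
    by (simp only: path_turn_def X midX_end) simp
  have label: "path_label (p + r) (q + s) (2 * a + 1) = X2"
    unfolding path_label_def X Y by (simp add: pt_label_def)
  have "int (q + s) * (2 * int p + 1) - int (p + r) * (2 * int q) = int q + int s - 2"
    using det_int by (simp add: algebra_simps)
  moreover have "2 * a + 1 = a + b" if "q = 1" "s = 1" using that det by simp
  hence "2 * a + 1 = a + b" if "int q + int s \<le> 2" using that assms pos by simp
  ultimately have "path_desc (p + r) (q + s) (2 * a + 1) \<or> 2 * a + 1 = a + b"
    unfolding path_desc_def X Y by linarith
  thus ?thesis by (simp only: path_step_def turn label loop_x2_def sum_ab simp_thms)
qed

text \<open>The matrix of \<open>\<gamma>\<^bsub>p/q\<^esub>\<close> together with the part of the loop around its end that precedes the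
  vertical segment.\<close>

definition left_part :: "(idx \<Rightarrow> nat) \<Rightarrow> ratfun^2^2" where
  "left_part k = (if p = 0 then turn True ** crossing_mat k True X1
     else path_prod k p q False ** loop_x3 k ** loop_x1 k)"

lemma mediant_steps_left: "mprod (map (mediant_step k) [2..<Suc (2 * a)]) = left_part k"
proof (cases "p = 0")
  case True
  hence "2 * a = 2" using det by simp
  hence "[2..<Suc (2 * a)] = [2 * a]" by (simp only:) simp
  moreover have "(p = 0) = True" using True by simp
  ultimately show ?thesis
    by (simp only: list.map mprod.simps mediant_step_x1 matrix_mul_rid left_part_def if_True)
next
  case False
  have "[2..<Suc (2 * a)] = [2..<2 * a - 1] @ [2 * a - 1, 2 * a]"
  proof -
    have "Suc (2 * a) = Suc (Suc (2 * a - 1))" "2 * a = Suc (2 * a - 1)" "2 \<le> 2 * a - 1" using pos False by auto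
    thus ?thesis by (metis append_assoc append_Cons append_Nil upt_Suc_append le_SucI)
  qed
  moreover have "map (mediant_step k) [2..<2 * a - 1] =
      map (\<lambda>i. path_step k p q (path_desc p q i \<or> (i = a \<and> False)) i) [2..<2 * a - 1]"
  proof (rule map_cong[OF refl])
    fix i assume "i \<in> set [2..<2 * a - 1]"
    thus "mediant_step k i = path_step k p q (path_desc p q i \<or> (i = a \<and> False)) i"
      by (intro mediant_step_left) auto
  qed
  moreover have "mediant_step k (2 * a - 1) = loop_x3 k" "mediant_step k (2 * a) = loop_x1 k"
    using False mediant_step_loop_x3 mediant_step_x1 by (simp_all only: loop_x1_def)
  ultimately show ?thesis using False
    by (simp only: map_append list.map mprod_append mprod.simps left_part_def path_prod_def matrix_mul_assoc
        matrix_mul_rid if_False)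
qed

text \<open>The mediant path is the path to \<open>(q, p)\<close>, the passage around this point and
  the translated path of \<open>r/s\<close>. For \<open>s = 0\<close> it ends with the antidiagonal
  at index \<open>2 a\<close>.\<close>

lemma mediant_path_prod:
  "path_prod k (p + r) (q + s) True =
    (if s = 0 then left_part k else left_part k ** loop_x2 k ** path_prod k r s False)"
proof (cases "s = 0")
  case True
  hence len: "2 * ((p + r) + (q + s)) - 1 = Suc (2 * a)" using det by simp
  have "path_prod k (p + r) (q + s) True = left_part k"
    unfolding path_prod_def len by (rule mediant_steps_left)
  thus ?thesis using True by simp
next
  case False
  have len: "2 * ((p + r) + (q + s)) - 1 = Suc (2 * a) + (2 * b - 2)"
    "2 * a + (2 * b - 1) = Suc (2 * a) + (2 * b - 2)" using pos by simp_all
  have "[2..<2 * ((p + r) + (q + s)) - 1] = [2..<Suc (2 * a)] @ [Suc (2 * a)..<2 * a + (2 * b - 1)]"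
    unfolding len by (rule upt_add_eq_append) (use pos in simp)
  also have "[Suc (2 * a)..<2 * a + (2 * b - 1)] = (2 * a + 1) # [2 * a + 2..<2 * a + (2 * b - 1)]"
    using False pos by (simp add: upt_conv_Cons)
  also have "[2 * a + 2..<2 * a + (2 * b - 1)] = map (\<lambda>i. 2 * a + i) [2..<2 * b - 1]"
    by (rule map_add_upt_left[symmetric])
  finally have "path_prod k (p + r) (q + s) True = left_part k ** (mediant_step k (2 * a + 1) **
      mprod (map (\<lambda>i. mediant_step k (2 * a + i)) [2..<2 * b - 1]))"
    unfolding path_prod_def mediant_steps_left[symmetric]
    by (simp only: map_append list.map mprod_append mprod.simps map_map o_def)
  also have "map (\<lambda>i. mediant_step k (2 * a + i)) [2..<2 * b - 1] =
      map (\<lambda>i. path_step k r s (path_desc r s i \<or> (i = b \<and> False)) i) [2..<2 * b - 1]"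
  proof (rule map_cong[OF refl])
    fix i assume "i \<in> set [2..<2 * b - 1]"
    thus "mediant_step k (2 * a + i) = path_step k r s (path_desc r s i \<or> (i = b \<and> False)) i"
      by (intro mediant_step_right) auto
  qed
  finally show ?thesis
    using False mediant_step_loop_x2[of k] by (simp only: path_prod_def if_False matrix_mul_assoc)
qed

lemma C_mat_left: "C_mat k p q = conj_mat (if p = 0 then root_left k else path_prod k p q False ** loop_mat k)"
proof (cases "p = 0")
  case True
  hence "q = 1" using det by simp
  thus ?thesis using True C_mat_0_1 by simp
next
  case False
  thus ?thesis using coprime_slope.C_mat_eq[OF left_slope] by simp
qed

lemma C_mat_right: "C_mat k r s = conj_mat (if s = 0 then root_right k else path_prod k r s False ** loop_mat k)"
proof (cases "s = 0")
  case True
  hence "r = 1" using det by simp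
  thus ?thesis using True C_mat_1_0 by simp
next
  case False
  thus ?thesis using coprime_slope.C_mat_eq[OF right_slope] by simp
qed

text \<open>The loop that ends \<open>C_mat k p q\<close> is the passage around
  \<open>(q, p)\<close>, so the product is again a path matrix, but with the central midpoint on the
  other side.\<close>

lemma C_mat_product: "C_mat k p q ** C_mat k r s = conj_mat (path_prod k (p + r) (q + s) True ** loop_mat k)"
proof -
  have 1: "(if p = 0 then root_left k else path_prod k p q False ** loop_mat k) = left_part k ** loop_x2 k"
    by (simp add: left_part_def root_left_def loop_mat_def matrix_mul_assoc)
  have 2: "left_part k ** loop_x2 k ** root_right k = left_part k ** loop_mat k"
  proof (cases "p = 0")
    case True
    have "loop_x2 k ** root_right k = loop_mat k"
      using loop_x2_root_right .
    thus ?thesis by (metis matrix_mul_assoc)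
  next
    case False
    show ?thesis using loop_x2_root_right by (metis matrix_mul_assoc)
  qed
  show ?thesis
    unfolding C_mat_left C_mat_right 1 mediant_path_prod conj_mat_mult[symmetric]
    by (simp add: 2 matrix_mul_assoc)
qed

lemma C_mat_mediant:
  "C_mat k (p + r) (q + s) = C_mat k p q ** C_mat k r s - shear k (of_nat (k (lab (p + r) (q + s))))"
proof -
  interpret M: coprime_slope "p + r" "q + s" by (rule mediant)
  let ?c = "of_nat (k (lab (p + r) (q + s))) :: ratfun"
  have "C_mat k p q ** C_mat k r s - C_mat k (p + r) (q + s) =
      conj_mat ((path_prod k (p + r) (q + s) True - path_prod k (p + r) (q + s) False) ** loop_mat k)"
    unfolding C_mat_product M.C_mat_eq by (simp only: conj_mat_diff mat_mult_diff)
  also have "\<dots> = scale_mat ?c (conj_mat (mat2 1 (-1) 1 0 ** loop_mat k))"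
    unfolding M.path_prod_diff by (simp only: scale_mat_mult conj_mat_scale)
  also have "\<dots> = shear k ?c" unfolding conj_mat_loop by (simp add: shear_def)
  finally show ?thesis by (simp add: algebra_simps)
qed

end

section \<open>The root of the Farey tree and the conclusion\<close>

lemma C_mat_0_1_entries:
  "C_mat k 0 1 = mat2
     (indet X2 / indet X1 + of_nat (k X1) * indet X3 / indet X1 + indet X3 * indet X3 / indet X1 / indet X2
        + of_nat (k X2) * indet X3 / indet X2)
     (indet X3)
     (of_nat (k X1) / indet X2 + indet X3 / indet X2 / indet X2 + of_nat (k X2) * indet X1 / indet X2 / indet X2)
     (indet X1 / indet X2)"
  unfolding C_mat_0_1
  by (simp add: root_left_def loop_x2_def turn_def crossing_mat_def conj_mat_mat2 monomial_vec3
      power_int_minus) (simp add: field_simps)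

lemma C_mat_1_0_entries:
  "C_mat k 1 0 = mat2 (indet X2 * scrM k) (indet X2)
     (- of_nat (k X2) * scrM k - 1 / indet X2) (- of_nat (k X2))"
  by (simp add: C_mat_def)

lemma cluster_triple_indet: "cluster_triple indet \<in> labeled_clusters k"
  unfolding cluster_triple_def by (rule labeled_clusters.initial)

lemma CGC_at_0_1: "CGC_at k indet X3 (C_mat k 0 1)"
proof -
  have "laurent_matrix (C_mat k 0 1)"
    unfolding C_mat_0_1_entries laurent_matrix_mat2
    by (intro conjI laurent_ring_intros laurent_ring_divide_indet)
  moreover have "det (C_mat k 0 1) = 1"
    unfolding C_mat_0_1_entries det_mat2 by (simp add: field_simps)
  moreover have "twisted_trace k (C_mat k 0 1) = - of_nat (k X3)"
    unfolding C_mat_0_1_entries twisted_trace_def by (simp add: scrM_def field_simps power2_eq_square)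
  moreover have "C_mat k 0 1 $ 1 $ 2 = indet X3" by (simp only: C_mat_0_1_entries mat2_nth)
  ultimately show ?thesis unfolding CGC_at_def by blast
qed

lemma CGC_at_1_0: "CGC_at k indet X2 (C_mat k 1 0)"
proof -
  have "1 / indet X2 \<in> laurent_ring" using laurent_ring_inverse_indet by (simp add: inverse_eq_divide)
  hence "laurent_matrix (C_mat k 1 0)"
    unfolding C_mat_1_0_entries laurent_matrix_mat2
    by (intro conjI laurent_ring_intros laurent_ring_scrM)
  moreover have "det (C_mat k 1 0) = 1"
    unfolding C_mat_1_0_entries det_mat2 by (simp add: field_simps)
  moreover have "twisted_trace k (C_mat k 1 0) = - of_nat (k X2)"
    unfolding C_mat_1_0_entries twisted_trace_def by (simp add: algebra_simps)
  moreover have "C_mat k 1 0 $ 1 $ 2 = indet X2" by (simp only: C_mat_1_0_entries mat2_nth)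
  ultimately show ?thesis unfolding CGC_at_def by blast
qed

text \<open>The first mutation of the initial cluster, at \<open>X1\<close>; the root matrices are
  explicit, so the conditions on their product are verified by computation.\<close>

lemma CGC_triple_at_root: "CGC_triple_at k X3 X1 X2 (C_mat k 0 1) (C_mat k 1 1) (C_mat k 1 0)"
proof -
  let ?X = "C_mat k 0 1 ** C_mat k 1 0"
  interpret farey_pair 0 1 1 0 by unfold_locales simp
  have C: "C_mat k 1 1 = ?X - shear k (of_nat (k X1))"
    using C_mat_mediant[of k] by (simp add: lab_def)
  have tr: "twisted_trace k ?X = of_nat (k X1)"
    unfolding C_mat_0_1_entries C_mat_1_0_entries twisted_trace_def
    by (simp add: scrM_def field_simps power2_eq_square)
  have X: "laurent_matrix ?X" "det ?X = 1"
    using CGC_at_0_1[of k] CGC_at_1_0[of k] by (auto simp: CGC_at_def det_mul laurent_matrix_mult)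
  have "?X $ 1 $ 2 = scrM k * indet X3 * indet X2 - of_nat (k X3) * indet X2 - of_nat (k X2) * indet X3 - indet X1"
    unfolding C_mat_0_1_entries C_mat_1_0_entries by (simp add: scrM_def field_simps power2_eq_square)
  from CGC_at_mutation[OF cluster_triple_indet _ CGC_at_0_1 CGC_at_1_0 tr X this]
  show ?thesis using tr C by (auto simp: CGC_triple_at_def)
qed

theorem theorem9p3:
  fixes k :: "idx \<Rightarrow> nat"
  shows "(\<forall>p q :: nat. coprime p q \<and> q > 0 \<longrightarrow> CGC_matrix k (C_mat k p q))
       \<and> CGC_matrix k (C_mat k 1 0)
       \<and> (\<forall>p q r s :: nat. ((p, q), (p + r, q + s), (r, s)) \<in> farey_tree \<longrightarrow>
            CGC_triple k (C_mat k p q) (C_mat k (p + r) (q + s)) (C_mat k r s))"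
proof (intro conjI allI impI)
  have rec: "C_mat k (a + e) (b + f) = C_mat k a b ** C_mat k e f - shear k (of_nat (k (lab (a + e) (b + f))))"
    if "b * e = Suc (a * f)" for a b e f
    using that by (intro farey_pair.C_mat_mediant) (unfold_locales)
  note tree = farey_tree_CGC[OF CGC_triple_at_root rec]
  show triple: "CGC_triple k (C_mat k p q) (C_mat k (p + r) (q + s)) (C_mat k r s)"
    if "((p, q), (p + r, q + s), (r, s)) \<in> farey_tree" for p q r s
    using tree[OF _ that] CGC_triple_at_imp_CGC_triple by blast
  show "CGC_matrix k (C_mat k 1 0)"
    using triple[of 0 1 1 0] farey_tree.root by (simp add: CGC_triple_def)
  show "CGC_matrix k (C_mat k p q)" if "coprime p q \<and> q > 0" for p q
  proof (cases "p = 0")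
    case True
    hence "q = 1" using that by simp
    thus ?thesis using True triple[of 0 1 1 0] farey_tree.root by (simp add: CGC_triple_def)
  next
    case False
    hence "coprime p q" "0 < p" "0 < q" using that by auto
    \<comment> \<open>A reduced fraction with positive numerator is the mediant of its Farey
      parents, hence the middle entry of a vertex.\<close>
    then obtain a b e f where "p = a + e" "q = b + f" "b * e = Suc (a * f)"
      by (rule coprime_farey_parents)
    thus ?thesis using triple[OF farey_tree_complete] by (simp add: CGC_triple_def)
  qed
qed

end
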